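(* Let $\mu\in(0,1]$, $\bar t^\mu\doteq\mu(2m/\kappa)^{1/2}$, $\bar c\doteq\sqrt{m\kappa}\tan\sqrt2$, and let $\mathcal{K}_\mu\doteq\mathcal{M}_\mu^{1/2}$ with $\mathcal{M}_\mu\doteq(\mathcal{A}^{-1}+\mu^2\mathcal{I})^{1/2}$ on $\mathcal{X}_{1/2}$. (1) For every $c\in(\bar c,\infty)$, $t\in[0,\bar t^\mu)$ and $x,z\in\mathcal{X}_{1/2}$, $$W^{\mu,c}(t,x,z)=\breve W^{\mu,c}(t,x,z)\doteq\tfrac12\langle x,\breve{\mathcal{P}}^{\mu,c}(t)x\rangle_{1/2}+\langle x,\breve{\mathcal{Q}}^{\mu,c}(t)z\rangle_{1/2}+\tfrac12\langle z,\breve{\mathcal{R}}^{\mu,c}(t)z\rangle_{1/2},$$ where $\breve{\mathcal{P}}^{\mu,c},\breve{\mathcal{Q}}^{\mu,c},\breve{\mathcal{R}}^{\mu,c}:[0,\bar t^\mu)\to\mathcal{L}(\mathcal{X}_{1/2})$ are the operators $x\mapsto\sum_{n=1}^\infty f_n(t)\langle x,\tilde\varphi_n\rangle_{1/2}\tilde\varphi_n$ with $f_n=p_n^{\mu,c},q_n^{\mu,c},r_n^{\mu,c}$ respectively, and, with $\theta^c=\tan^{-1}(\sqrt{m\kappa}/c)$, $$p_n^{\mu,c}(t)=-\frac{1}{\alpha_n^\mu}\frac{1}{\tan(\omega_n^\mu t+\theta^c)},\quad q_n^{\mu,c}(t)=\frac{1}{\alpha_n^\mu}\left(\frac{1}{1+(\sqrt{m\kappa}/c)^2}\right)^{1/2}\frac{1}{\sin(\omega_n^\mu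 t+\theta^c)},$$ $$r_n^{\mu,c}(t)=-\frac{1}{\alpha_n^\mu}\left(\frac{1}{1+(\sqrt{m\kappa}/c)^2}\right)\left[\frac{\sqrt{m\kappa}}{c}+\frac{1}{\tan(\omega_n^\mu t+\theta^c)}\right].$$ (2) For any $\delta\in(0,\bar t^\mu)$, and all $t\in(\delta,\bar t^\mu)$, $x,z\in\mathcal{X}_{1/2}$, $$W^{\mu,\infty}(t,x,z)=\lim_{c\to\infty}\breve W^{\mu,c}(t,x,z)=\tfrac12\langle x,\breve{\mathcal{P}}^{\mu,\infty}(t)x\rangle_{1/2}+\langle x,\breve{\mathcal{Q}}^{\mu,\infty}(t)z\rangle_{1/2}+\tfrac12\langle z,\breve{\mathcal{R}}^{\mu,\infty}(t)z\rangle_{1/2},$$ where $\breve{\mathcal{P}}^{\mu,\infty},\breve{\mathcal{Q}}^{\mu,\infty},\breve{\mathcal{R}}^{\mu,\infty}:(\delta,\bar t^\mu)\to\mathcal{L}(\mathcal{X}_{1/2})$ are the operators $x\mapsto\sum_{n=1}^\infty f_n(t)\langle x,\tilde\varphi_n\rangle_{1/2}\tilde\varphi_n$ (with domain $\mathcal{X}_{1/2}$) with $f_n=p_n^{\mu,\infty},q_n^{\mu,\infty},r_n^{\mu,\infty}$ respectively, and $$p_n^{\mu,\infty}(t)=-\frac{1}{\alpha_n^\mu}\frac{1}{\tan(\omega_n^\mu t)},\quad q_n^{\mu,\infty}(t)=\frac{1}{\alpha_n^\mu}\frac{1}{\sin(\omega_n^\mu t)},\quad r_n^{\mu,\infty}(t)=-\frac{1}{\alpha_n^\mu}\frac{1}{\tan(\omega_n^\mu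 t)}.$$
   Context: Fix constants $L,\kappa,m>0$ and $\Lambda=(0,L)$. $\mathcal{X}=L^2(\Lambda;\mathbb{R})$ with the standard inner product $\langle\cdot,\cdot\rangle$ and norm $\|\cdot\|$. $\mathcal{X}_0=\{x\in\mathcal{X}: x,\partial x \text{ absolutely continuous},\ x(0)=0=x(L),\ \partial^2x\in\mathcal{X}\}$. $\mathcal{A}x=-\partial^2x$ with domain $\mathcal{X}_0$; it is a self-adjoint, positive, boundedly invertible operator on $\mathcal{X}$, with unique positive self-adjoint square root $\mathcal{A}^{1/2}$, and $\mathcal{J}\doteq(\mathcal{A}^{1/2})^{-1}$. $\mathcal{X}_{1/2}=\mathrm{dom}(\mathcal{A}^{1/2})$ is a Hilbert space with $\langle x,\xi\rangle_{1/2}=\langle\mathcal{A}^{1/2}x,\mathcal{A}^{1/2}\xi\rangle$ and norm $\|\cdot\|_{1/2}$; $\mathcal{L}(\mathcal{X}_{1/2})$ denotes its bounded linear operators, and square roots of operators on $\mathcal{X}_{1/2}$ are positive self-adjoint square roots. $\mathcal{I}$ is the identity. $\tilde\varphi_n(\lambda)=\frac{\sqrt{2L}}{n\pi}\sin(\frac{n\pi}{L}\lambda)$, $n\in\mathbb{N}$, is an orthonormal basis of $\mathcal{X}_{1/2}$. $\lambda_n=(n\pi/L)^2$, $\lambda_n^\mu=\frac{\lambda_n}{1+\mu^2\lambda_n}$, $\alpha_n^\mu=(\frac{\lambda_n^\mu}{m\kappa})^{1/2}$, $\omega_n^\mu=(\frac{\kappa}{m}\lambda_n^\mu)^{1/2}$.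 $\mathcal{W}[0,t]=L^2([0,t];\mathcal{X}_{1/2})$. For $w\in\mathcal{X}_{1/2}$, $\mathcal{J}^\mu w=(\mathcal{J}w,\mu w)$ and $\|\mathcal{J}^\mu w\|_{1/2}^2=\|\mathcal{J}w\|_{1/2}^2+\mu^2\|w\|_{1/2}^2$. For $M>0$ and a terminal payoff $\psi:\mathcal{X}_{1/2}\to\mathbb{R}\cup\{-\infty\}$, $$J^\mu_{M,\psi}(t,x,w)=\int_0^t\Big(\tfrac{\kappa}{2}\|\xi(s)\|_{1/2}^2-\tfrac{M}{2}\|\mathcal{J}^\mu w(s)\|_{1/2}^2\Big)ds+\psi(\xi(t)),\qquad \xi(s)=x+\int_0^sw(\sigma)\,d\sigma.$$ $\psi^{\mu,c}(x,z)=-\tfrac{c}{2}\|\mathcal{K}_\mu(x-z)\|_{1/2}^2$; $\psi^{\mu,\infty}(x,z)=0$ if $\|\mathcal{K}_\mu(x-z)\|_{1/2}=0$ and $-\infty$ otherwise. $W^{\mu,c}(t,x,z)=\sup_{w\in\mathcal{W}[0,t]}J^\mu_{m,\psi^{\mu,c}(\cdot,z)}(t,x,w)$ and $W^{\mu,\infty}(t,x,z)=\sup_{w\in\mathcal{W}[0,t]}J^\mu_{m,\psi^{\mu,\infty}(\cdot,z)}(t,x,w)$. Standing assumption: with a fixed $\underline{m}\in(0,m)$ and $\overline{W}^\mu(t,x)\doteq\sup_{w\in\mathcal{W}[0,t]}J^\mu_{\underline{m},0}(t,x,w)$ (zero terminal payoff), $\overline{W}^\mu(t,x)<\infty$ for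 all $\mu\in(0,1]$, $t\in(0,\bar t^\mu)$, $x\in\mathcal{X}_{1/2}$. *)

theory Defs
  imports "HOL-Analysis.Analysis"
begin

section \<open>The Hilbert space of real square-integrable functions on the line\<close>

text \<open>
  The space \<open>L\<^sup>2(0, L)\<close> depends on the real parameter \<open>L\<close>, so it is not a type of its own. It is
  realised below as a closed subspace of the type \<open>L2\<close> of square-integrable functions on the
  whole line, modulo equality almost everywhere. The instances \<open>banach\<close> and
  \<open>second_countable_topology\<close> make the library's Bochner integral available for \<open>L2\<close>-valued
  functions.
\<close>

definition square_integrable :: "(real \<Rightarrow> real) \<Rightarrow> bool" where
  "square_integrable f \<longleftrightarrow>
     f \<in> borel_measurable lebesgue \<and> integrable lebesgue (\<lambda>s. (f s)\<^sup>2)"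

definition L2_eq :: "(real \<Rightarrow> real) \<Rightarrow> (real \<Rightarrow> real) \<Rightarrow> bool" where
  "L2_eq f g \<longleftrightarrow> square_integrable f \<and> square_integrable g \<and> (AE s in lebesgue. f s = g s)"

lemma square_integrable_0: "square_integrable (\<lambda>_. 0)"
  by (simp add: square_integrable_def)

quotient_type L2 = "real \<Rightarrow> real" / partial: L2_eq morphisms rep_L2 abs_L2
proof (rule part_equivpI)
  show "\<exists>f. L2_eq f f"
    using square_integrable_0 by (auto simp: L2_eq_def)
  show "symp L2_eq"
    by (auto simp: symp_def L2_eq_def elim: AE_mp)
  show "transp L2_eq"
    unfolding transp_def L2_eq_def by (auto elim: AE_mp)
qed

lemma square_integrable_mult:
  assumes "square_integrable f" "square_integrable g"
  shows "integrable lebesgue (\<lambda>s. f s * g s)"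
proof (rule Bochner_Integration.integrable_bound)
  show "integrable lebesgue (\<lambda>s. (f s)\<^sup>2 + (g s)\<^sup>2)"
    using assms by (auto simp: square_integrable_def)
  show "(\<lambda>s. f s * g s) \<in> borel_measurable lebesgue"
    using assms by (auto simp: square_integrable_def)
  have "\<bar>a * b\<bar> \<le> a\<^sup>2 + b\<^sup>2" for a b :: real
    using sum_squares_bound[of "\<bar>a\<bar>" "\<bar>b\<bar>"]
      mult_nonneg_nonneg[OF abs_ge_zero[of a] abs_ge_zero[of b]]
    unfolding abs_mult power2_abs by linarith
  then show "AE s in lebesgue. norm (f s * g s) \<le> norm ((f s)\<^sup>2 + (g s)\<^sup>2)"
    by (intro AE_I2) (simp add: abs_of_nonneg)
qed

lemma square_integrable_add:
  assumes "square_integrable f" "square_integrable g"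
  shows "square_integrable (\<lambda>s. f s + g s)"
proof -
  have "integrable lebesgue (\<lambda>s. (f s)\<^sup>2 + (g s)\<^sup>2 + 2 * (f s * g s))"
    using assms square_integrable_mult[OF assms] by (auto simp: square_integrable_def)
  then show ?thesis
    using assms by (auto simp: square_integrable_def power2_sum mult.assoc)
qed

lemma square_integrable_scale:
  "square_integrable f \<Longrightarrow> square_integrable (\<lambda>s. c * f s)"
  by (auto simp: square_integrable_def power_mult_distrib)

lemma square_integrable_minus:
  "square_integrable f \<Longrightarrow> square_integrable (\<lambda>s. - f s)"
  by (auto simp: square_integrable_def)

lemma square_integrable_diff:
  assumes "square_integrable f" "square_integrable g"
  shows "square_integrable (\<lambda>s. f s - g s)"
  using square_integrable_add[OF assms(1) square_integrable_minus[OF assms(2)]] by simp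

instantiation L2 :: real_inner
begin

lift_definition zero_L2 :: L2 is "\<lambda>_. 0"
  by (simp add: L2_eq_def square_integrable_0)

lift_definition plus_L2 :: "L2 \<Rightarrow> L2 \<Rightarrow> L2" is "\<lambda>f g s. f s + g s"
  unfolding L2_eq_def by (auto intro: square_integrable_add elim: AE_mp)

lift_definition uminus_L2 :: "L2 \<Rightarrow> L2" is "\<lambda>f s. - f s"
  unfolding L2_eq_def by (auto intro: square_integrable_minus)

lift_definition minus_L2 :: "L2 \<Rightarrow> L2 \<Rightarrow> L2" is "\<lambda>f g s. f s - g s"
  unfolding L2_eq_def by (auto intro: square_integrable_diff elim: AE_mp)

lift_definition scaleR_L2 :: "real \<Rightarrow> L2 \<Rightarrow> L2" is "\<lambda>c f s. c * f s"
  unfolding L2_eq_def by (auto intro: square_integrable_scale elim: AE_mp)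

lift_definition inner_L2 :: "L2 \<Rightarrow> L2 \<Rightarrow> real" is "\<lambda>f g. \<integral>s. f s * g s \<partial>lebesgue"
proof -
  fix f f' g g' assume "L2_eq f f'" "L2_eq g g'"
  then show "(\<integral>s. f s * g s \<partial>lebesgue) = (\<integral>s. f' s * g' s \<partial>lebesgue)"
    unfolding L2_eq_def square_integrable_def
    by (intro integral_cong_AE) (auto elim: AE_mp)
qed

definition norm_L2 :: "L2 \<Rightarrow> real" where "norm_L2 x = sqrt (inner x x)"
definition dist_L2 :: "L2 \<Rightarrow> L2 \<Rightarrow> real" where "dist_L2 x y = norm (x - y)"
definition sgn_L2 :: "L2 \<Rightarrow> L2" where "sgn_L2 x = inverse (norm x) *\<^sub>R x"
definition uniformity_L2 :: "(L2 \<times> L2) filter" where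
  "uniformity_L2 = (INF e\<in>{0<..}. principal {(x, y). dist x y < e})"
definition open_L2 :: "L2 set \<Rightarrow> bool" where
  "open_L2 U = (\<forall>x\<in>U. eventually (\<lambda>(x', y). x' = x \<longrightarrow> y \<in> U) uniformity)"

instance
proof
  fix x y z :: L2 and c d :: real
  show "x + y + z = x + (y + z)"
    by transfer (auto simp: L2_eq_def add.assoc intro: square_integrable_add)
  show "x + y = y + x"
    by transfer (auto simp: L2_eq_def add.commute intro: square_integrable_add)
  show "0 + x = x"
    by transfer (auto simp: L2_eq_def)
  show "- x + x = 0"
    by transfer (auto simp: L2_eq_def square_integrable_0)
  show "x - y = x + - y"
    by transfer (auto simp: L2_eq_def intro: square_integrable_diff)
  show "c *\<^sub>R (x + y) = c *\<^sub>R x + c *\<^sub>R y"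
    by transfer (auto simp: L2_eq_def distrib_left
        intro!: square_integrable_scale square_integrable_add)
  show "(c + d) *\<^sub>R x = c *\<^sub>R x + d *\<^sub>R x"
    by transfer (auto simp: L2_eq_def distrib_right
        intro!: square_integrable_scale square_integrable_add)
  show "c *\<^sub>R d *\<^sub>R x = (c * d) *\<^sub>R x"
    by transfer (auto simp: L2_eq_def mult.assoc intro!: square_integrable_scale)
  show "1 *\<^sub>R x = x"
    by transfer (auto simp: L2_eq_def)
  show "dist x y = norm (x - y)" by (fact dist_L2_def)
  show "sgn x = inverse (norm x) *\<^sub>R x" by (fact sgn_L2_def)
  show "(uniformity :: (L2 \<times> L2) filter) = (INF e\<in>{0<..}. principal {(x, y). dist x y < e})"
    by (fact uniformity_L2_def)
  show "open U = (\<forall>x\<in>U. eventually (\<lambda>(x', y). x' = x \<longrightarrow> y \<in> U) uniformity)" for U :: "L2 set"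
    by (fact open_L2_def)
  show "inner x y = inner y x"
    by transfer (simp add: mult.commute)
  show "inner (x + y) z = inner x z + inner y z"
    by transfer (auto simp: L2_eq_def distrib_right square_integrable_mult)
  show "inner (c *\<^sub>R x) y = c * inner x y"
    by transfer (simp add: mult.assoc)
  show "0 \<le> inner x x"
    by transfer simp
  show "inner x x = 0 \<longleftrightarrow> x = 0"
  proof transfer
    fix f assume "L2_eq f f"
    then have f: "square_integrable f" by (simp add: L2_eq_def)
    then have "(\<integral>s. f s * f s \<partial>lebesgue) = 0 \<longleftrightarrow> (AE s in lebesgue. f s * f s = 0)"
      by (intro integral_nonneg_eq_0_iff_AE square_integrable_mult) auto
    then show "(\<integral>s. f s * f s \<partial>lebesgue) = 0 \<longleftrightarrow> L2_eq f (\<lambda>_. 0)"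
      using f by (simp add: L2_eq_def square_integrable_0)
  qed
  show "norm x = sqrt (inner x x)" by (fact norm_L2_def)
qed

end

lemma square_integrable_rep: "square_integrable (rep_L2 x)"
  using Quotient_rep_reflp[OF Quotient_L2, of x] by (simp add: L2_eq_def)

lemma abs_rep_L2 [simp]: "abs_L2 (rep_L2 x) = x"
  by (rule Quotient_abs_rep[OF Quotient_L2])

lemma rep_abs_L2:
  assumes "square_integrable f"
  shows "AE s in lebesgue. rep_L2 (abs_L2 f) s = f s"
  using Quotient_rep_abs[OF Quotient_L2, of f] assms by (simp add: L2_eq_def)

lemma abs_L2_eq_iff:
  assumes "square_integrable f" "square_integrable g"
  shows "abs_L2 f = abs_L2 g \<longleftrightarrow> (AE s in lebesgue. f s = g s)"
  using assms Quotient_rel[OF Quotient_L2, of f g] by (auto simp: L2_eq_def)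

lemma abs_L2_add:
  assumes "square_integrable f" "square_integrable g"
  shows "abs_L2 f + abs_L2 g = abs_L2 (\<lambda>s. f s + g s)"
  using assms by (intro plus_L2.abs_eq) (auto simp: L2_eq_def eq_onp_def)

lemma abs_L2_diff:
  assumes "square_integrable f" "square_integrable g"
  shows "abs_L2 f - abs_L2 g = abs_L2 (\<lambda>s. f s - g s)"
  using assms by (intro minus_L2.abs_eq) (auto simp: L2_eq_def eq_onp_def)

lemma abs_L2_scaleR:
  assumes "square_integrable f"
  shows "c *\<^sub>R abs_L2 f = abs_L2 (\<lambda>s. c * f s)"
  using assms by (intro scaleR_L2.abs_eq) (auto simp: L2_eq_def eq_onp_def)

lemma norm_abs_L2:
  assumes "square_integrable f"
  shows "(norm (abs_L2 f))\<^sup>2 = (\<integral>s. (f s)\<^sup>2 \<partial>lebesgue)"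
proof -
  have "inner (abs_L2 f) (abs_L2 f) = (\<integral>s. f s * f s \<partial>lebesgue)"
    using assms by (intro inner_L2.abs_eq) (auto simp: L2_eq_def eq_onp_def)
  then show ?thesis
    unfolding power2_norm_eq_inner unfolding power2_eq_square .
qed

lemma nn_norm_abs_L2:
  assumes "square_integrable f"
  shows "(\<integral>\<^sup>+s. ennreal ((f s)\<^sup>2) \<partial>lebesgue) = ennreal ((norm (abs_L2 f))\<^sup>2)"
  unfolding norm_abs_L2[OF assms]
  using assms by (intro nn_integral_eq_integral) (auto simp: square_integrable_def)

lemma square_integrable_nn:
  assumes "f \<in> borel_measurable lebesgue" "(\<integral>\<^sup>+s. ennreal ((f s)\<^sup>2) \<partial>lebesgue) < \<infinity>"
  shows "square_integrable f"
  using assms by (auto simp: square_integrable_def intro!: integrableI_nonneg)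

lemma rep_L2_measurable [measurable]: "rep_L2 x \<in> borel_measurable lebesgue"
  using square_integrable_rep[of x] by (simp add: square_integrable_def)

lemma rep_L2_diff: "AE s in lebesgue. rep_L2 (x - y) s = rep_L2 x s - rep_L2 y s"
  using rep_abs_L2[OF square_integrable_diff[OF square_integrable_rep square_integrable_rep], of x y]
    abs_L2_diff[OF square_integrable_rep square_integrable_rep, of x y]
  by simp

lemma nn_norm_L2: "(\<integral>\<^sup>+s. ennreal ((rep_L2 x s)\<^sup>2) \<partial>lebesgue) = ennreal ((norm x)\<^sup>2)"
  using nn_norm_abs_L2[OF square_integrable_rep, of x] by simp

lemma nn_norm_L2_diff:
  "(\<integral>\<^sup>+s. ennreal ((rep_L2 x s - rep_L2 y s)\<^sup>2) \<partial>lebesgue) = ennreal ((norm (x - y))\<^sup>2)"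
  unfolding nn_norm_L2[of "x - y", symmetric]
  using rep_L2_diff[of x y] by (intro nn_integral_cong_AE) (auto elim: AE_mp)

lemma L2_AE_Cauchy:
  assumes d: "\<And>k. norm (Y (Suc k) - Y k) \<le> (1/4)^k"
  shows "AE s in lebesgue. convergent (\<lambda>k. rep_L2 (Y k) s)"
proof -
  define u where "u k s = rep_L2 (Y (Suc k)) s - rep_L2 (Y k) s" for k s
  have [measurable]: "u k \<in> borel_measurable lebesgue" for k
    unfolding u_def[abs_def] by measurable
  have le: "(\<integral>\<^sup>+s. ennreal (4^k * (u k s)\<^sup>2) \<partial>lebesgue) \<le> ennreal ((1/4)^k)" for k
  proof -
    have "(\<integral>\<^sup>+s. ennreal (4^k * (u k s)\<^sup>2) \<partial>lebesgue) = ennreal (4^k) * (\<integral>\<^sup>+s. ennreal ((u k s)\<^sup>2) \<partial>lebesgue)"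
      by (subst nn_integral_cmult[symmetric]) (auto simp: ennreal_mult)
    also have "\<dots> = ennreal (4^k * (norm (Y (Suc k) - Y k))\<^sup>2)"
      unfolding u_def nn_norm_L2_diff by (simp add: ennreal_mult)
    also have "\<dots> \<le> ennreal (4^k * ((1/4)^k)\<^sup>2)"
      using d[of k] by (intro ennreal_leI mult_left_mono power_mono) auto
    also have "4^k * ((1/4)^k)\<^sup>2 = ((1/4)^k :: real)"
      by (simp add: power2_eq_square power_one_over)
    finally show ?thesis .
  qed
  have "(\<integral>\<^sup>+s. (\<Sum>k. ennreal (4^k * (u k s)\<^sup>2)) \<partial>lebesgue)
      = (\<Sum>k. \<integral>\<^sup>+s. ennreal (4^k * (u k s)\<^sup>2) \<partial>lebesgue)"
    by (intro nn_integral_suminf) auto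
  also have "\<dots> \<le> (\<Sum>k. ennreal ((1/4)^k))"
    by (intro suminf_le le) auto
  also have "\<dots> = ennreal (\<Sum>k. (1/4)^k)"
    by (intro suminf_ennreal2) (auto intro: summable_geometric)
  also have "\<dots> < \<infinity>" by simp
  finally have "(\<integral>\<^sup>+s. (\<Sum>k. ennreal (4^k * (u k s)\<^sup>2)) \<partial>lebesgue) < \<infinity>" .
  then have "AE s in lebesgue. (\<Sum>k. ennreal (4^k * (u k s)\<^sup>2)) \<noteq> \<infinity>"
    by (intro nn_integral_PInf_AE) auto
  then show ?thesis
  proof (eventually_elim)
    case (elim s)
    then have "summable (\<lambda>k. 4^k * (u k s)\<^sup>2)"
      by (intro summable_suminf_not_top) (auto simp: top_ennreal.rep_eq)
    then have "Bseq (\<lambda>k. 4^k * (u k s)\<^sup>2)"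
      by (intro convergent_imp_Bseq) (auto simp: convergent_def dest: summable_LIMSEQ_zero)
    then obtain K where K: "0 < K" "\<And>k. norm (4^k * (u k s)\<^sup>2) \<le> K"
      unfolding Bseq_def by auto
    have b: "norm (u k s) \<le> sqrt K * (1/2)^k" for k
    proof -
      have "(2^k * u k s)\<^sup>2 = 4^k * (u k s)\<^sup>2"
        using power_mult[of "2::real" k 2] power_mult[of "2::real" 2 k]
        by (simp add: power_mult_distrib mult.commute)
      also have "\<dots> \<le> K" using K(2)[of k] by simp
      finally have "\<bar>2^k * u k s\<bar> \<le> sqrt K" by (rule real_le_rsqrt[of "\<bar>_\<bar>", simplified])
      then show ?thesis by (simp add: abs_mult field_simps power_one_over)
    qed
    have "summable (\<lambda>k. u k s)"
      by (rule summable_comparison_test'[of "\<lambda>k. sqrt K * (1/2)^k" 0])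
         (use b in \<open>auto intro!: summable_mult summable_geometric\<close>)
    then have "convergent (\<lambda>n. \<Sum>k<n. u k s)"
      by (simp add: summable_iff_convergent)
    then have "convergent (\<lambda>n. rep_L2 (Y n) s - rep_L2 (Y 0) s)"
      unfolding u_def using sum_lessThan_telescope[of "\<lambda>n. rep_L2 (Y n) s"] by simp
    from convergent_add[OF this convergent_const[of "rep_L2 (Y 0) s"]]
    show ?case by simp
  qed
qed

instance L2 :: complete_space
proof
  fix X :: "nat \<Rightarrow> L2"
  assume C: "Cauchy X"
  then have "\<exists>N. \<forall>m\<ge>N. \<forall>n\<ge>N. norm (X m - X n) < (1/4)^k" for k
    using CauchyD[OF C, of "(1/4)^k"] by auto
  then obtain N where N: "\<And>k m n. m \<ge> N k \<Longrightarrow> n \<ge> N k \<Longrightarrow> norm (X m - X n) < (1/4)^k"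
    by metis
  define r where "r k = (\<Sum>i\<le>k. N i) + k" for k
  have r_ge: "N k \<le> r k" "r k \<le> r (Suc k)" "k \<le> r k" for k
    using member_le_sum[of k "{..k}" N] by (auto simp: r_def)
  define Y where "Y k = X (r k)" for k
  have "norm (Y (Suc k) - Y k) \<le> (1/4)^k" for k
    unfolding Y_def using r_ge[of k] by (auto intro!: less_imp_le[OF N])
  then have conv: "AE s in lebesgue. convergent (\<lambda>k. rep_L2 (Y k) s)"
    by (rule L2_AE_Cauchy)
  define g where "g s = lim (\<lambda>k. rep_L2 (Y k) s)" for s
  have [measurable]: "g \<in> borel_measurable lebesgue"
    unfolding g_def[abs_def] by (rule borel_measurable_lim_metric) measurable
  have bound: "(\<integral>\<^sup>+s. ennreal ((g s - rep_L2 (X n) s)\<^sup>2) \<partial>lebesgue) \<le> ennreal (((1/4)^j)\<^sup>2)"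
    if n: "N j \<le> n" for n j
  proof -
    have "(\<integral>\<^sup>+s. ennreal ((g s - rep_L2 (X n) s)\<^sup>2) \<partial>lebesgue)
        = (\<integral>\<^sup>+s. liminf (\<lambda>k. ennreal ((rep_L2 (Y k) s - rep_L2 (X n) s)\<^sup>2)) \<partial>lebesgue)"
    proof (rule nn_integral_cong_AE)
      show "AE s in lebesgue. ennreal ((g s - rep_L2 (X n) s)\<^sup>2)
          = liminf (\<lambda>k. ennreal ((rep_L2 (Y k) s - rep_L2 (X n) s)\<^sup>2))"
        using conv
      proof eventually_elim
        case (elim s)
        then have "(\<lambda>k. rep_L2 (Y k) s) \<longlonglongrightarrow> g s"
          unfolding g_def by (simp add: convergent_LIMSEQ_iff)
        then have "(\<lambda>k. ennreal ((rep_L2 (Y k) s - rep_L2 (X n) s)\<^sup>2)) \<longlonglongrightarrow>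
            ennreal ((g s - rep_L2 (X n) s)\<^sup>2)"
          by (intro tendsto_ennrealI tendsto_intros)
        then show ?case
          by (intro lim_imp_Liminf[symmetric]) auto
      qed
    qed
    also have "\<dots> \<le> liminf (\<lambda>k. \<integral>\<^sup>+s. ennreal ((rep_L2 (Y k) s - rep_L2 (X n) s)\<^sup>2) \<partial>lebesgue)"
      by (intro nn_integral_liminf) measurable
    also have "\<dots> = liminf (\<lambda>k. ennreal ((norm (Y k - X n))\<^sup>2))"
      by (simp add: nn_norm_L2_diff)
    also have "\<dots> \<le> limsup (\<lambda>k. ennreal ((norm (Y k - X n))\<^sup>2))"
      by (rule Liminf_le_Limsup) simp
    also have "\<dots> \<le> ennreal (((1/4)^j)\<^sup>2)"
    proof (rule Limsup_bounded, unfold eventually_sequentially, intro exI allI impI)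
      fix k assume "N j \<le> k"
      then have "N j \<le> r k" using r_ge(3)[of k] by simp
      then show "ennreal ((norm (Y k - X n))\<^sup>2) \<le> ennreal (((1/4)^j)\<^sup>2)"
        unfolding Y_def using n
        by (intro ennreal_leI power_mono less_imp_le[OF N]) auto
    qed
    finally show ?thesis .
  qed
  have d: "square_integrable (\<lambda>s. g s - rep_L2 (X n) s)" if "N j \<le> n" for n j
    by (rule square_integrable_nn, measurable)
       (rule le_less_trans[OF bound[OF that]], simp)
  have g: "square_integrable g"
    using square_integrable_add[OF d[of 0 "N 0"] square_integrable_rep[of "X (N 0)"]] by simp
  have dist: "norm (X n - abs_L2 g) \<le> (1/4)^j" if "N j \<le> n" for n j
  proof -
    have "abs_L2 g - X n = abs_L2 (\<lambda>s. g s - rep_L2 (X n) s)"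
      using abs_L2_diff[OF g square_integrable_rep[of "X n"]] by simp
    then have "ennreal ((norm (abs_L2 g - X n))\<^sup>2) \<le> ennreal (((1/4)^j)\<^sup>2)"
      using nn_norm_abs_L2[OF d[OF that]] bound[OF that] by simp
    then have "(norm (abs_L2 g - X n))\<^sup>2 \<le> ((1/4)^j)\<^sup>2"
      by (subst (asm) ennreal_le_iff) auto
    then have "norm (abs_L2 g - X n) \<le> (1/4)^j"
      by (rule power2_le_imp_le) simp
    then show ?thesis by (simp add: norm_minus_commute)
  qed
  have "X \<longlonglongrightarrow> abs_L2 g"
  proof (rule LIMSEQ_I)
    fix e :: real assume "0 < e"
    then obtain j where "(1/4)^j < e"
      using real_arch_pow_inv[of e "1/4"] by auto
    then show "\<exists>no. \<forall>n\<ge>no. norm (X n - abs_L2 g) < e"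
      using dist[of j] by (intro exI[of _ "N j"]) (auto intro: le_less_trans)
  qed
  then show "convergent X" by (auto simp: convergent_def)
qed

instance L2 :: banach ..

lemma square_integrable_indicator:
  assumes "A \<in> lmeasurable"
  shows "square_integrable (indicat_real A)"
proof -
  have "(indicat_real A s)\<^sup>2 = indicat_real A s" for s
    by (simp add: indicator_def)
  then show ?thesis
    using assms unfolding square_integrable_def
    by (auto simp: fmeasurable_def intro!: borel_measurable_indicator integrable_real_indicator)
qed

lemma norm_indicator_diff:
  assumes "A \<in> lmeasurable" "B \<in> lmeasurable" "A \<subseteq> B"
  shows "(norm (abs_L2 (indicat_real B) - abs_L2 (indicat_real A)))\<^sup>2 = measure lebesgue (B - A)"
proof -
  note i = square_integrable_indicator[OF assms(1)] square_integrable_indicator[OF assms(2)]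
  have "((indicat_real B s - indicat_real A s)\<^sup>2) = indicat_real (B - A) s" for s
    using assms(3) by (auto simp: indicator_def)
  then show ?thesis
    using norm_abs_L2[OF square_integrable_diff[OF i(2,1)]] abs_L2_diff[OF i(2,1)] assms
    by simp
qed

definition rational_steps :: "L2 set" where
  "rational_steps = range (\<lambda>l :: (rat \<times> rat \<times> rat) list.
     \<Sum>(c, a, b)\<leftarrow>l. of_rat c *\<^sub>R abs_L2 (indicat_real {of_rat a<..<of_rat b}))"

lemma countable_rational_steps: "countable rational_steps"
  unfolding rational_steps_def by simp

lemma rational_steps_add:
  assumes "x \<in> rational_steps" "y \<in> rational_steps"
  shows "x + y \<in> rational_steps"
proof -
  obtain k l where "x = (\<Sum>(c, a, b)\<leftarrow>k. of_rat c *\<^sub>R abs_L2 (indicat_real {of_rat a<..<of_rat b}))"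
    "y = (\<Sum>(c, a, b)\<leftarrow>l. of_rat c *\<^sub>R abs_L2 (indicat_real {of_rat a<..<of_rat b}))"
    using assms unfolding rational_steps_def by blast
  then show ?thesis
    unfolding rational_steps_def by (intro range_eqI[of _ _ "k @ l"]) simp
qed

lemma rational_steps_scaleR:
  assumes "x \<in> rational_steps"
  shows "of_rat q *\<^sub>R x \<in> rational_steps"
proof -
  obtain l :: "(rat \<times> rat \<times> rat) list"
    where l: "x = (\<Sum>(c, a, b)\<leftarrow>l. of_rat c *\<^sub>R abs_L2 (indicat_real {of_rat a<..<of_rat b}))"
    using assms unfolding rational_steps_def by blast
  have "of_rat q *\<^sub>R x = (\<Sum>(c, a, b)\<leftarrow>map (\<lambda>(c, a, b). (q * c, a, b)) l.
      of_rat c *\<^sub>R abs_L2 (indicat_real {of_rat a<..<of_rat b}))"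
    unfolding l by (induction l) (auto simp: scaleR_add_right of_rat_mult)
  then show ?thesis
    unfolding rational_steps_def by blast
qed

lemma rational_steps_indicator:
  assumes "a \<in> \<rat>" "b \<in> \<rat>"
  shows "abs_L2 (indicat_real {a<..<b}) \<in> rational_steps"
proof -
  obtain a' b' where "a = of_rat a'" "b = of_rat b'"
    using assms by (auto elim!: Rats_cases)
  then show ?thesis
    unfolding rational_steps_def by (intro range_eqI[of _ _ "[(1, a', b')]"]) simp
qed

lemma closure_steps_add:
  assumes "x \<in> closure rational_steps" "y \<in> closure rational_steps"
  shows "x + y \<in> closure rational_steps"
proof -
  obtain f g where "\<And>n. f n \<in> rational_steps" "f \<longlonglongrightarrow> x" "\<And>n. g n \<in> rational_steps" "g \<longlonglongrightarrow> y"
    using assms unfolding closure_sequential by blast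
  then show ?thesis
    unfolding closure_sequential
    by (intro exI[of _ "\<lambda>n. f n + g n"]) (auto intro: rational_steps_add tendsto_add)
qed

lemma closure_steps_scaleR:
  assumes "x \<in> closure rational_steps"
  shows "c *\<^sub>R x \<in> closure rational_steps"
proof -
  obtain f where f: "\<And>n. f n \<in> rational_steps" "f \<longlonglongrightarrow> x"
    using assms unfolding closure_sequential by blast
  have "c \<in> closure \<rat>" by (simp add: Rats_closure_real)
  then obtain q where q: "\<And>n. q n \<in> \<rat>" "q \<longlonglongrightarrow> c"
    unfolding closure_sequential by blast
  have "q n *\<^sub>R f n \<in> rational_steps" for n
    using f(1)[of n] q(1)[of n] by (auto elim!: Rats_cases intro: rational_steps_scaleR)
  then show ?thesis
    unfolding closure_sequential using f(2) q(2)
    by (intro exI[of _ "\<lambda>n. q n *\<^sub>R f n"]) (auto intro: tendsto_scaleR)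
qed

lemma closure_steps_approx:
  assumes "\<And>e. e > 0 \<Longrightarrow> \<exists>y\<in>closure rational_steps. norm (x - y) < e"
  shows "x \<in> closure rational_steps"
proof -
  have "x \<in> closure (closure rational_steps)"
    unfolding closure_approachable using assms by (metis dist_norm norm_minus_commute)
  then show ?thesis by simp
qed

lemma closure_steps_cbox_union:
  assumes "finite F" "\<And>B. B \<in> F \<Longrightarrow> \<exists>a\<in>\<rat>. \<exists>b\<in>\<rat>. B = {a<..<b}"
  shows "abs_L2 (indicat_real (\<Union>F)) \<in> closure rational_steps \<and> \<Union>F \<in> lmeasurable
    \<and> (\<forall>a\<in>\<rat>. \<forall>b\<in>\<rat>. abs_L2 (indicat_real (\<Union>F \<inter> {a<..<b})) \<in> closure rational_steps)"
  using assms
proof (induction F)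
  case empty
  have "abs_L2 (\<lambda>_. 0) \<in> rational_steps"
    using rational_steps_indicator[of 0 0] by (simp add: indicator_def[abs_def])
  then have "abs_L2 (\<lambda>_. 0) \<in> closure rational_steps"
    using closure_subset by blast
  then show ?case by (simp add: indicator_def)
next
  case (insert B F)
  obtain c d where B: "c \<in> \<rat>" "d \<in> \<rat>" "B = {c<..<d}"
    using insert.prems by blast
  have IH: "abs_L2 (indicat_real (\<Union>F)) \<in> closure rational_steps" "\<Union>F \<in> lmeasurable"
    "\<And>a b. a \<in> \<rat> \<Longrightarrow> b \<in> \<rat> \<Longrightarrow> abs_L2 (indicat_real (\<Union>F \<inter> {a<..<b})) \<in> closure rational_steps"
    using insert by auto
  have diff: "abs_L2 (indicat_real (S \<union> T)) = abs_L2 (indicat_real S) + abs_L2 (indicat_real T)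
      + (-1) *\<^sub>R abs_L2 (indicat_real (S \<inter> T))"
    if "S \<in> lmeasurable" "T \<in> lmeasurable" for S T :: "real set"
  proof -
    have "S \<inter> T \<in> lmeasurable" using that by blast
    note i = that[THEN square_integrable_indicator] square_integrable_indicator[OF this]
    have "indicat_real (S \<union> T) = (\<lambda>s. indicat_real S s + indicat_real T s + (-1) * indicat_real (S \<inter> T) s)"
      by (auto simp: indicator_def fun_eq_iff)
    then show ?thesis
      using i by (simp only: abs_L2_scaleR abs_L2_add square_integrable_add square_integrable_scale)
  qed
  have box: "abs_L2 (indicat_real {a<..<b}) \<in> closure rational_steps" if "a \<in> \<rat>" "b \<in> \<rat>" for a b
    using rational_steps_indicator[OF that] closure_subset by blast
  have "B \<in> lmeasurable" using B by simp
  show ?case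
  proof (intro conjI ballI)
    show "abs_L2 (indicat_real (\<Union>(insert B F))) \<in> closure rational_steps"
      using diff[OF IH(2) \<open>B \<in> lmeasurable\<close>] IH B box
      by (simp add: Un_commute closure_steps_add closure_steps_scaleR del: scaleR_minus1_left scaleR_minus_left)
    show "\<Union>(insert B F) \<in> lmeasurable"
      using \<open>B \<in> lmeasurable\<close> IH(2) by (simp add: fmeasurable.Un)
    fix a b :: real assume ab: "a \<in> \<rat>" "b \<in> \<rat>"
    have m: "max a c \<in> \<rat>" "min b d \<in> \<rat>" using ab B by (auto simp: max_def min_def)
    have BI: "B \<inter> {a<..<b} = {max a c<..<min b d}" using B by auto
    have e1: "\<Union>(insert B F) \<inter> {a<..<b} = (\<Union>F \<inter> {a<..<b}) \<union> (B \<inter> {a<..<b})" by auto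
    have e2: "(\<Union>F \<inter> {a<..<b}) \<inter> (B \<inter> {a<..<b}) = \<Union>F \<inter> {max a c<..<min b d}" using B by auto
    have "\<Union>F \<inter> {a<..<b} \<in> lmeasurable" "B \<inter> {a<..<b} \<in> lmeasurable"
      using IH(2) \<open>B \<in> lmeasurable\<close> by blast+
    from diff[OF this] show "abs_L2 (indicat_real (\<Union>(insert B F) \<inter> {a<..<b})) \<in> closure rational_steps"
      unfolding e1 e2 using IH(3)[OF ab] IH(3)[OF m] box[OF m] unfolding BI
      by (simp add: closure_steps_add closure_steps_scaleR del: scaleR_minus1_left scaleR_minus_left)
  qed
qed

lemma closure_steps_open:
  assumes "open T" "T \<in> lmeasurable"
  shows "abs_L2 (indicat_real T) \<in> closure rational_steps"
proof -
  define \<F> where "\<F> = {B. B \<subseteq> T \<and> (\<exists>a\<in>\<rat>. \<exists>b\<in>\<rat>. B = {a<..<b :: real})}"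
  have "\<F> \<subseteq> (\<lambda>(a, b). {a<..<b}) ` (\<rat> \<times> \<rat>)" by (auto simp: \<F>_def)
  then have cF: "countable \<F>"
    by (rule countable_subset) (auto intro: countable_rat)
  have UF: "\<Union>\<F> = T"
  proof (intro equalityI subsetI)
    fix s assume "s \<in> T"
    then obtain e where e: "e > 0" "ball s e \<subseteq> T"
      using \<open>open T\<close> open_contains_ball by blast
    obtain a b where "a \<in> \<rat>" "s - e < a" "a < s" "b \<in> \<rat>" "s < b" "b < s + e"
      using Rats_dense_in_real[of "s - e" s] Rats_dense_in_real[of s "s + e"] e(1) by auto
    moreover from this have "{a<..<b} \<subseteq> T"
      by (intro subset_trans[OF _ e(2)]) (auto simp: dist_real_def)
    ultimately have "{a<..<b} \<in> \<F>" "s \<in> {a<..<b}" unfolding \<F>_def by auto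
    then show "s \<in> \<Union>\<F>" by blast
  qed (auto simp: \<F>_def)
  have "{} \<in> \<F>" unfolding \<F>_def by (auto intro!: bexI[of _ 0])
  then obtain G where G: "\<F> = range (G :: nat \<Rightarrow> real set)"
    using cF by (metis empty_iff range_from_nat_into)
  define H where "H n = \<Union>(G ` {..n})" for n
  have GF: "G n \<in> \<F>" for n using G by auto
  have H: "abs_L2 (indicat_real (H n)) \<in> closure rational_steps" "H n \<in> lmeasurable" for n
    using closure_steps_cbox_union[of "G ` {..n}"] GF unfolding H_def \<F>_def by auto
  have HT: "H n \<subseteq> T" for n using GF unfolding H_def \<F>_def by blast
  have UH: "(\<Union>n. H n) = T" using UF G unfolding H_def by auto
  have dec: "decseq (\<lambda>n. T - H n)" by (auto simp: decseq_def H_def)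
  have "(\<lambda>n. measure lebesgue (T - H n)) \<longlonglongrightarrow> measure lebesgue (\<Inter>n. T - H n)"
  proof (rule Lim_measure_decseq[OF _ dec])
    show "range (\<lambda>n. T - H n) \<subseteq> sets lebesgue"
      using assms(2) H(2) by (auto simp: fmeasurable_def)
    show "emeasure lebesgue (T - H n) \<noteq> \<infinity>" for n
      using fmeasurable.Diff[OF assms(2) H(2)[of n]] by (auto simp: fmeasurable_def)
  qed
  moreover have "(\<Inter>n. T - H n) = {}" using UH by auto
  ultimately have lim: "(\<lambda>n. measure lebesgue (T - H n)) \<longlonglongrightarrow> 0"
    by (metis measure_empty)
  show ?thesis
  proof (rule closure_steps_approx)
    fix e :: real assume "e > 0"
    then obtain n where "measure lebesgue (T - H n) < e\<^sup>2"
      using LIMSEQ_D[OF lim, of "e\<^sup>2"] by (auto simp: abs_less_iff)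
    then have "(norm (abs_L2 (indicat_real T) - abs_L2 (indicat_real (H n))))\<^sup>2 < e\<^sup>2"
      using norm_indicator_diff[OF H(2) assms(2) HT] by simp
    then have "norm (abs_L2 (indicat_real T) - abs_L2 (indicat_real (H n))) < e"
      using \<open>e > 0\<close> by (intro power2_less_imp_less[of _ e]) auto
    then show "\<exists>y\<in>closure rational_steps. norm (abs_L2 (indicat_real T) - y) < e"
      using H(1) by blast
  qed
qed

lemma closure_steps_indicator:
  assumes S: "S \<in> lmeasurable"
  shows "abs_L2 (indicat_real S) \<in> closure rational_steps"
proof (rule closure_steps_approx)
  fix e :: real assume "e > 0"
  have Ss: "S \<in> sets lebesgue" using S by (simp add: fmeasurable_def)
  obtain T where T: "open T" "S \<subseteq> T" "T - S \<in> lmeasurable" "emeasure lebesgue (T - S) < ennreal (e\<^sup>2)"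
    using sets_lebesgue_outer_open[OF Ss, of "e\<^sup>2"] \<open>e > 0\<close> by auto
  have "T = S \<union> (T - S)" using T by auto
  then have Tm: "T \<in> lmeasurable" using fmeasurable.Un[OF S T(3)] by simp
  have "measure lebesgue (T - S) < e\<^sup>2"
    using T(3,4) by (subst (asm) emeasure_eq_measure2) (auto simp: ennreal_less_iff)
  then have "(norm (abs_L2 (indicat_real T) - abs_L2 (indicat_real S)))\<^sup>2 < e\<^sup>2"
    using norm_indicator_diff[OF S Tm T(2)] by simp
  then have "norm (abs_L2 (indicat_real S) - abs_L2 (indicat_real T)) < e"
    using \<open>e > 0\<close> by (intro power2_less_imp_less[of _ e]) (auto simp: norm_minus_commute)
  then show "\<exists>y\<in>closure rational_steps. norm (abs_L2 (indicat_real S) - y) < e"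
    using closure_steps_open[OF T(1) Tm] by blast
qed

lemma closure_steps_simple:
  assumes "simple_function lebesgue f" "square_integrable f"
  shows "abs_L2 f \<in> closure rational_steps"
proof -
  have fin: "finite (range f)" using simple_functionD(1)[OF assms(1)] by simp
  have lm: "f -` {v} \<in> lmeasurable" if "v \<noteq> 0" for v
  proof -
    have ms: "f -` {v} \<in> sets lebesgue"
      using simple_functionD(2)[OF assms(1), of "{v}"] by simp
    have "integrable lebesgue (\<lambda>s. indicat_real (f -` {v}) s)"
    proof (rule Bochner_Integration.integrable_bound)
      show "integrable lebesgue (\<lambda>s. (f s)\<^sup>2 / v\<^sup>2)"
        using assms(2) by (simp add: square_integrable_def)
      show "AE s in lebesgue. norm (indicat_real (f -` {v}) s) \<le> norm ((f s)\<^sup>2 / v\<^sup>2)"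
        using that by (intro AE_I2) (auto simp: indicator_def)
    qed (use ms in simp)
    then show ?thesis using ms by (simp add: integrable_indicator_iff fmeasurable_def)
  qed
  have sum: "square_integrable (\<lambda>s. \<Sum>v\<in>V. v * indicat_real (f -` {v}) s)
      \<and> abs_L2 (\<lambda>s. \<Sum>v\<in>V. v * indicat_real (f -` {v}) s) \<in> closure rational_steps"
    if "finite V" for V
    using that
  proof (induction V)
    case empty
    have "abs_L2 (\<lambda>_. 0) \<in> closure rational_steps"
      using closure_steps_indicator[of "{}"] by (simp add: indicator_def[abs_def])
    then show ?case by (simp add: square_integrable_0)
  next
    case (insert v V)
    have v: "square_integrable (\<lambda>s. v * indicat_real (f -` {v}) s)
      \<and> abs_L2 (\<lambda>s. v * indicat_real (f -` {v}) s) \<in> closure rational_steps"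
    proof (cases "v = 0")
      case True
      then show ?thesis
        using closure_steps_indicator[of "{}"]
        by (simp add: square_integrable_0 indicator_def[abs_def])
    next
      case False
      note i = square_integrable_indicator[OF lm[OF False]]
      show ?thesis
        using square_integrable_scale[OF i] abs_L2_scaleR[OF i, of v]
          closure_steps_scaleR[OF closure_steps_indicator[OF lm[OF False]], of v]
        by simp
    qed
    then show ?case
      using insert abs_L2_add[of "\<lambda>s. v * indicat_real (f -` {v}) s" "\<lambda>s. \<Sum>v\<in>V. v * indicat_real (f -` {v}) s"]
      by (metis (no_types, lifting) closure_steps_add square_integrable_add sum.insert ext)
  qed
  have "f = (\<lambda>s. \<Sum>v\<in>range f. v * indicat_real (f -` {v}) s)"
  proof
    fix s
    have "(\<Sum>v\<in>range f. v * indicat_real (f -` {v}) s) = (\<Sum>v\<in>range f. if v = f s then v else 0)"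
      by (intro sum.cong) (auto simp: indicator_def)
    then show "f s = (\<Sum>v\<in>range f. v * indicat_real (f -` {v}) s)"
      using fin by (simp add: sum.delta')
  qed
  then show ?thesis using sum[OF fin] by simp
qed

lemma closure_steps_UNIV: "closure rational_steps = UNIV"
proof (intro equalityI subsetI UNIV_I)
  fix x :: L2
  define f where "f = rep_L2 x"
  have f: "square_integrable f" "f \<in> borel_measurable lebesgue"
    using square_integrable_rep[of x] by (auto simp: f_def)
  obtain F where F: "\<And>i. simple_function lebesgue (F i)" "\<And>s. (\<lambda>i. F i s) \<longlonglongrightarrow> f s"
      "\<And>i s. norm (F i s) \<le> 2 * norm (f s)"
    using borel_measurable_implies_sequence_metric[OF f(2), of 0] by (auto simp: dist_norm)
  have Fm [measurable]: "F i \<in> borel_measurable lebesgue" for i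
    using F(1) by (rule borel_measurable_simple_function)
  have b2: "(F i s)\<^sup>2 \<le> 4 * (f s)\<^sup>2" for i s
    using power_mono[OF F(3)[of i s], of 2] by (simp add: power_mult_distrib)
  have Fs: "square_integrable (F i)" for i
    unfolding square_integrable_def
  proof
    show "integrable lebesgue (\<lambda>s. (F i s)\<^sup>2)"
      by (rule Bochner_Integration.integrable_bound[of _ "\<lambda>s. 4 * (f s)\<^sup>2"])
         (use f b2 in \<open>auto simp: square_integrable_def\<close>)
  qed simp
  have b3: "(f s - F i s)\<^sup>2 \<le> 10 * (f s)\<^sup>2" for i s
    using b2[of i s] sum_squares_bound[of "f s" "- F i s"]
    by (simp add: power2_diff)
  have "(\<lambda>i. \<integral>s. (f s - F i s)\<^sup>2 \<partial>lebesgue) \<longlonglongrightarrow> (\<integral>s. 0 \<partial>(lebesgue :: real measure))"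
  proof (rule integral_dominated_convergence[where w = "\<lambda>s. 10 * (f s)\<^sup>2"])
    show "integrable lebesgue (\<lambda>s. 10 * (f s)\<^sup>2)" using f by (simp add: square_integrable_def)
    show "AE s in lebesgue. (\<lambda>i. (f s - F i s)\<^sup>2) \<longlonglongrightarrow> 0"
    proof (rule AE_I2)
      fix s
      have "(\<lambda>i. (f s - F i s)\<^sup>2) \<longlonglongrightarrow> (f s - f s)\<^sup>2" by (intro tendsto_intros F)
      then show "(\<lambda>i. (f s - F i s)\<^sup>2) \<longlonglongrightarrow> 0" by simp
    qed
    show "AE s in lebesgue. norm ((f s - F i s)\<^sup>2) \<le> 10 * (f s)\<^sup>2" for i
      using b3 by simp
  qed (use f in auto)
  then have lim: "(\<lambda>i. (norm (x - abs_L2 (F i)))\<^sup>2) \<longlonglongrightarrow> 0"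
    using norm_abs_L2[OF square_integrable_diff[OF f(1) Fs]] abs_L2_diff[OF f(1) Fs]
    by (simp add: f_def)
  show "x \<in> closure rational_steps"
  proof (rule closure_steps_approx)
    fix e :: real assume "e > 0"
    then obtain i where "(norm (x - abs_L2 (F i)))\<^sup>2 < e\<^sup>2"
      using LIMSEQ_D[OF lim, of "e\<^sup>2"] by auto
    then have "norm (x - abs_L2 (F i)) < e"
      using \<open>e > 0\<close> by (intro power2_less_imp_less[of _ e]) auto
    then show "\<exists>y\<in>closure rational_steps. norm (x - y) < e"
      using closure_steps_simple[OF F(1) Fs] by blast
  qed
qed

instance L2 :: second_countable_topology
proof
  define \<B> where "\<B> = (\<lambda>(d, n :: nat). ball d (1 / Suc n)) ` (rational_steps \<times> UNIV)"
  have "topological_basis \<B>"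
  proof (rule topological_basisI)
    show "open B" if "B \<in> \<B>" for B using that by (auto simp: \<B>_def)
    fix U and x :: L2 assume "open U" "x \<in> U"
    then obtain e where e: "e > 0" "ball x e \<subseteq> U" using open_contains_ball by blast
    obtain n :: nat where n: "1 / Suc n < e / 2"
      using e(1) nat_approx_posE[of "e / 2"] by auto
    have "x \<in> closure rational_steps" by (simp add: closure_steps_UNIV)
    then obtain d where d: "d \<in> rational_steps" "dist d x < 1 / Suc n"
      unfolding closure_approachable by (metis of_nat_0_less_iff zero_less_Suc zero_less_divide_1_iff)
    have "ball d (1 / Suc n) \<subseteq> ball x e"
    proof
      fix y assume "y \<in> ball d (1 / Suc n)"
      then have "dist d y < 1 / Suc n" by simp
      then have "dist x y < e"
        using dist_triangle[of x y d] d(2) n by (simp add: dist_commute)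
      then show "y \<in> ball x e" by simp
    qed
    then show "\<exists>B\<in>\<B>. x \<in> B \<and> B \<subseteq> U"
      using d e(2) by (intro bexI[of _ "ball d (1 / Suc n)"]) (auto simp: \<B>_def)
  qed
  moreover have "countable \<B>"
    unfolding \<B>_def using countable_rational_steps by blast
  ultimately show "\<exists>B :: L2 set set. countable B \<and> open = generate_topology B"
    using topological_basis_imp_subbasis by blast
qed

section \<open>Operators on a Hilbert space given by a carrier and an inner product\<close>

text \<open>
  An unbounded operator is a partial function whose domain is its \<open>dom\<close>. The carrier \<open>V\<close> and the
  inner product \<open>ip\<close> are explicit because two Hilbert spaces of elements of \<open>L2\<close> occur, with
  different inner products.
\<close>

definition linear_op :: "'a::real_vector set \<Rightarrow> ('a \<rightharpoonup> 'a) \<Rightarrow> bool" where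
  "linear_op V T \<longleftrightarrow> subspace (dom T) \<and> dom T \<subseteq> V \<and> ran T \<subseteq> V \<and>
     (\<forall>x\<in>dom T. \<forall>y\<in>dom T. \<forall>a b.
        the (T (a *\<^sub>R x + b *\<^sub>R y)) = a *\<^sub>R the (T x) + b *\<^sub>R the (T y))"

definition densely_defined ::
  "'a::real_vector set \<Rightarrow> ('a \<Rightarrow> 'a \<Rightarrow> real) \<Rightarrow> ('a \<rightharpoonup> 'a) \<Rightarrow> bool" where
  "densely_defined V ip T \<longleftrightarrow> (\<forall>x\<in>V. \<forall>e>0. \<exists>y\<in>dom T. sqrt (ip (x - y) (x - y)) < e)"

text \<open>The last conjunct says that \<open>T\<close> and its adjoint have the same graph, hence the same domain.\<close>

definition self_adjoint ::
  "'a::real_vector set \<Rightarrow> ('a \<Rightarrow> 'a \<Rightarrow> real) \<Rightarrow> ('a \<rightharpoonup> 'a) \<Rightarrow> bool" where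
  "self_adjoint V ip T \<longleftrightarrow> linear_op V T \<and> densely_defined V ip T \<and>
     (\<forall>y z. T y = Some z \<longleftrightarrow> y \<in> V \<and> z \<in> V \<and> (\<forall>x\<in>dom T. ip (the (T x)) y = ip x z))"

definition positive_op :: "('a \<Rightarrow> 'a \<Rightarrow> real) \<Rightarrow> ('a \<rightharpoonup> 'a) \<Rightarrow> bool" where
  "positive_op ip T \<longleftrightarrow> (\<forall>x\<in>dom T. 0 \<le> ip (the (T x)) x)"

definition pos_sqrt ::
  "'a::real_vector set \<Rightarrow> ('a \<Rightarrow> 'a \<Rightarrow> real) \<Rightarrow> ('a \<rightharpoonup> 'a) \<Rightarrow> ('a \<rightharpoonup> 'a)" where
  "pos_sqrt V ip T = (THE S. self_adjoint V ip S \<and> positive_op ip S \<and> S \<circ>\<^sub>m S = T)"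

definition op_inverse :: "('a \<rightharpoonup> 'a) \<Rightarrow> ('a \<rightharpoonup> 'a)" where
  "op_inverse T = (\<lambda>y. if \<exists>x. T x = Some y then Some (THE x. T x = Some y) else None)"


section \<open>The operator \<open>\<A> = - \<partial>\<^sup>2\<close> on \<open>L\<^sup>2(0, L)\<close> and its square root\<close>

definition space_X :: "real \<Rightarrow> L2 set" where
  "space_X L = {x. AE s in lebesgue. s \<notin> {0<..<L} \<longrightarrow> rep_L2 x s = 0}"

definition abs_continuous_on :: "real \<Rightarrow> real \<Rightarrow> (real \<Rightarrow> real) \<Rightarrow> bool" where
  "abs_continuous_on a b f \<longleftrightarrow>
     (\<forall>e>0. \<exists>d>0. \<forall>D :: (real \<times> real) set.
        finite D \<and> (\<forall>(p, q)\<in>D. a \<le> p \<and> p \<le> q \<and> q \<le> b) \<and>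
        disjoint_family_on (\<lambda>(p, q). {p<..<q}) D \<and> (\<Sum>(p, q)\<in>D. q - p) < d \<longrightarrow>
        (\<Sum>(p, q)\<in>D. \<bar>f q - f p\<bar>) < e)"

definition ae_derivative :: "real \<Rightarrow> (real \<Rightarrow> real) \<Rightarrow> (real \<Rightarrow> real) \<Rightarrow> bool" where
  "ae_derivative L u v \<longleftrightarrow>
     (AE s in lebesgue_on {0<..<L}. (u has_real_derivative v s) (at s))"

text \<open>
  \<open>u\<close> is the absolutely continuous representative of \<open>x\<close>, and \<open>v\<close> that of \<open>\<partial>x\<close>. The second derivative
  \<open>\<partial>\<^sup>2x = - y\<close> is square-integrable because \<open>y\<close> is an element of \<open>L\<^sup>2(0, L)\<close>.
\<close>

definition neg_second_derivative :: "real \<Rightarrow> L2 \<Rightarrow> L2 \<Rightarrow> bool" where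
  "neg_second_derivative L x y \<longleftrightarrow> x \<in> space_X L \<and> y \<in> space_X L \<and>
     (\<exists>u v. (AE s in lebesgue_on {0<..<L}. rep_L2 x s = u s) \<and>
        abs_continuous_on 0 L u \<and> ae_derivative L u v \<and>
        abs_continuous_on 0 L v \<and> ae_derivative L v (\<lambda>s. - rep_L2 y s) \<and>
        u 0 = 0 \<and> u L = 0)"

definition op_A :: "real \<Rightarrow> L2 \<rightharpoonup> L2" where
  "op_A L = (\<lambda>x. if \<exists>y. neg_second_derivative L x y
     then Some (THE y. neg_second_derivative L x y) else None)"

definition sqrt_A :: "real \<Rightarrow> L2 \<rightharpoonup> L2" where
  "sqrt_A L = pos_sqrt (space_X L) inner (op_A L)"

definition op_J :: "real \<Rightarrow> L2 \<rightharpoonup> L2" where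
  "op_J L = op_inverse (sqrt_A L)"


section \<open>The Hilbert space \<open>\<X>\<^sub>1\<^sub>/\<^sub>2\<close>\<close>

definition space_half :: "real \<Rightarrow> L2 set" where
  "space_half L = dom (sqrt_A L)"

definition inner_half :: "real \<Rightarrow> L2 \<Rightarrow> L2 \<Rightarrow> real" where
  "inner_half L x y = inner (the (sqrt_A L x)) (the (sqrt_A L y))"

definition norm_half :: "real \<Rightarrow> L2 \<Rightarrow> real" where
  "norm_half L x = sqrt (inner_half L x x)"

definition bounded_ops_half :: "real \<Rightarrow> (L2 \<rightharpoonup> L2) set" where
  "bounded_ops_half L = {T. linear_op (space_half L) T \<and> dom T = space_half L \<and>
     (\<exists>B. \<forall>x\<in>space_half L. norm_half L (the (T x)) \<le> B * norm_half L x)}"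

definition phi :: "real \<Rightarrow> nat \<Rightarrow> L2" where
  "phi L n = abs_L2 (\<lambda>s. if s \<in> {0<..<L}
     then sqrt (2 * L) / (real n * pi) * sin (real n * pi / L * s) else 0)"

text \<open>Convergence of \<open>\<Sum>n\<ge>1. g n\<close> to \<open>y\<close> in the norm of \<open>\<X>\<^sub>1\<^sub>/\<^sub>2\<close>.\<close>

definition sums_half :: "real \<Rightarrow> (nat \<Rightarrow> L2) \<Rightarrow> L2 \<Rightarrow> bool" where
  "sums_half L g y \<longleftrightarrow> y \<in> space_half L \<and>
     (\<lambda>N. norm_half L ((\<Sum>n=1..N. g n) - y)) \<longlonglongrightarrow> 0"

definition spectral_op :: "real \<Rightarrow> (nat \<Rightarrow> real) \<Rightarrow> L2 \<rightharpoonup> L2" where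
  "spectral_op L f = (\<lambda>x.
     if x \<in> space_half L \<and> (\<exists>y. sums_half L (\<lambda>n. (f n * inner_half L x (phi L n)) *\<^sub>R phi L n) y)
     then Some (THE y. sums_half L (\<lambda>n. (f n * inner_half L x (phi L n)) *\<^sub>R phi L n) y)
     else None)"

definition op_M :: "real \<Rightarrow> real \<Rightarrow> L2 \<rightharpoonup> L2" where
  "op_M L \<mu> = pos_sqrt (space_half L) (inner_half L)
     (\<lambda>x. if x \<in> space_half L then Some (the (op_inverse (op_A L) x) + \<mu>\<^sup>2 *\<^sub>R x) else None)"

definition op_K :: "real \<Rightarrow> real \<Rightarrow> L2 \<rightharpoonup> L2" where
  "op_K L \<mu> = pos_sqrt (space_half L) (inner_half L) (op_M L \<mu>)"


section \<open>The control problems\<close>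

text \<open>
  \<open>\<W>[0, t] = L\<^sup>2([0, t]; \<X>\<^sub>1\<^sub>/\<^sub>2)\<close>. As \<open>\<A>\<^sup>1\<^sup>/\<^sup>2\<close> is an isometry of \<open>\<X>\<^sub>1\<^sub>/\<^sub>2\<close> onto the separable space \<open>\<X>\<close>,
  measurability of \<open>w\<close> with respect to the norm topology of \<open>\<X>\<^sub>1\<^sub>/\<^sub>2\<close> is measurability of \<open>\<A>\<^sup>1\<^sup>/\<^sup>2 w\<close>.
\<close>

definition controls :: "real \<Rightarrow> real \<Rightarrow> (real \<Rightarrow> L2) set" where
  "controls L t = {w. (\<forall>s\<in>{0..t}. w s \<in> space_half L) \<and>
     (\<lambda>s. the (sqrt_A L (w s))) \<in> borel_measurable (lebesgue_on {0..t}) \<and>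
     integrable (lebesgue_on {0..t}) (\<lambda>s. (norm_half L (w s))\<^sup>2)}"

text \<open>
  The embedding of \<open>\<X>\<^sub>1\<^sub>/\<^sub>2\<close> into \<open>\<X>\<close> is bounded, so the Bochner integral of a control in \<open>\<X>\<^sub>1\<^sub>/\<^sub>2\<close> is its
  Bochner integral in \<open>L2\<close>.
\<close>

definition trajectory :: "L2 \<Rightarrow> (real \<Rightarrow> L2) \<Rightarrow> real \<Rightarrow> L2" where
  "trajectory x w s = x + (\<integral>\<sigma>. w \<sigma> \<partial>lebesgue_on {0..s})"

definition sqnorm_J :: "real \<Rightarrow> real \<Rightarrow> L2 \<Rightarrow> real" where
  "sqnorm_J L \<mu> w = (norm_half L (the (op_J L w)))\<^sup>2 + \<mu>\<^sup>2 * (norm_half L w)\<^sup>2"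

definition payoff ::
  "real \<Rightarrow> real \<Rightarrow> real \<Rightarrow> real \<Rightarrow> (L2 \<Rightarrow> ereal) \<Rightarrow> real \<Rightarrow> L2 \<Rightarrow> (real \<Rightarrow> L2) \<Rightarrow> ereal" where
  "payoff L \<kappa> \<mu> M \<psi> t x w =
     ereal (\<integral>s. \<kappa> / 2 * (norm_half L (trajectory x w s))\<^sup>2 - M / 2 * sqnorm_J L \<mu> (w s)
              \<partial>lebesgue_on {0..t})
     + \<psi> (trajectory x w t)"

definition value_fn ::
  "real \<Rightarrow> real \<Rightarrow> real \<Rightarrow> real \<Rightarrow> (L2 \<Rightarrow> ereal) \<Rightarrow> real \<Rightarrow> L2 \<Rightarrow> ereal" where
  "value_fn L \<kappa> \<mu> M \<psi> t x = (SUP w\<in>controls L t. payoff L \<kappa> \<mu> M \<psi> t x w)"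

definition psi_c :: "real \<Rightarrow> real \<Rightarrow> real \<Rightarrow> L2 \<Rightarrow> L2 \<Rightarrow> ereal" where
  "psi_c L \<mu> c x z = ereal (- c / 2 * (norm_half L (the (op_K L \<mu> (x - z))))\<^sup>2)"

definition psi_inf :: "real \<Rightarrow> real \<Rightarrow> L2 \<Rightarrow> L2 \<Rightarrow> ereal" where
  "psi_inf L \<mu> x z = (if norm_half L (the (op_K L \<mu> (x - z))) = 0 then 0 else - \<infinity>)"

definition W_c :: "real \<Rightarrow> real \<Rightarrow> real \<Rightarrow> real \<Rightarrow> real \<Rightarrow> real \<Rightarrow> L2 \<Rightarrow> L2 \<Rightarrow> ereal" where
  "W_c L \<kappa> m \<mu> c t x z = value_fn L \<kappa> \<mu> m (\<lambda>y. psi_c L \<mu> c y z) t x"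

definition W_inf :: "real \<Rightarrow> real \<Rightarrow> real \<Rightarrow> real \<Rightarrow> real \<Rightarrow> L2 \<Rightarrow> L2 \<Rightarrow> ereal" where
  "W_inf L \<kappa> m \<mu> t x z = value_fn L \<kappa> \<mu> m (\<lambda>y. psi_inf L \<mu> y z) t x"

definition W_bar :: "real \<Rightarrow> real \<Rightarrow> real \<Rightarrow> real \<Rightarrow> real \<Rightarrow> L2 \<Rightarrow> ereal" where
  "W_bar L \<kappa> m_low \<mu> t x = value_fn L \<kappa> \<mu> m_low (\<lambda>_. 0) t x"

definition t_bar :: "real \<Rightarrow> real \<Rightarrow> real \<Rightarrow> real" where
  "t_bar \<kappa> m \<mu> = \<mu> * sqrt (2 * m / \<kappa>)"

definition c_bar :: "real \<Rightarrow> real \<Rightarrow> real" where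
  "c_bar \<kappa> m = sqrt (m * \<kappa>) * tan (sqrt 2)"


section \<open>The explicit quadratic forms\<close>

definition lam :: "real \<Rightarrow> nat \<Rightarrow> real" where
  "lam L n = (real n * pi / L)\<^sup>2"

definition lam_mu :: "real \<Rightarrow> real \<Rightarrow> nat \<Rightarrow> real" where
  "lam_mu L \<mu> n = lam L n / (1 + \<mu>\<^sup>2 * lam L n)"

definition alpha :: "real \<Rightarrow> real \<Rightarrow> real \<Rightarrow> real \<Rightarrow> nat \<Rightarrow> real" where
  "alpha L \<kappa> m \<mu> n = sqrt (lam_mu L \<mu> n / (m * \<kappa>))"

definition omega :: "real \<Rightarrow> real \<Rightarrow> real \<Rightarrow> real \<Rightarrow> nat \<Rightarrow> real" where
  "omega L \<kappa> m \<mu> n = sqrt (\<kappa> / m * lam_mu L \<mu> n)"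

definition theta :: "real \<Rightarrow> real \<Rightarrow> real \<Rightarrow> real" where
  "theta \<kappa> m c = arctan (sqrt (m * \<kappa>) / c)"

definition p_c :: "real \<Rightarrow> real \<Rightarrow> real \<Rightarrow> real \<Rightarrow> real \<Rightarrow> real \<Rightarrow> nat \<Rightarrow> real" where
  "p_c L \<kappa> m \<mu> c t n =
     - (1 / alpha L \<kappa> m \<mu> n) * (1 / tan (omega L \<kappa> m \<mu> n * t + theta \<kappa> m c))"

definition q_c :: "real \<Rightarrow> real \<Rightarrow> real \<Rightarrow> real \<Rightarrow> real \<Rightarrow> real \<Rightarrow> nat \<Rightarrow> real" where
  "q_c L \<kappa> m \<mu> c t n =
     1 / alpha L \<kappa> m \<mu> n * sqrt (1 / (1 + (sqrt (m * \<kappa>) / c)\<^sup>2))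
     * (1 / sin (omega L \<kappa> m \<mu> n * t + theta \<kappa> m c))"

definition r_c :: "real \<Rightarrow> real \<Rightarrow> real \<Rightarrow> real \<Rightarrow> real \<Rightarrow> real \<Rightarrow> nat \<Rightarrow> real" where
  "r_c L \<kappa> m \<mu> c t n =
     - (1 / alpha L \<kappa> m \<mu> n) * (1 / (1 + (sqrt (m * \<kappa>) / c)\<^sup>2))
     * (sqrt (m * \<kappa>) / c + 1 / tan (omega L \<kappa> m \<mu> n * t + theta \<kappa> m c))"

definition p_inf :: "real \<Rightarrow> real \<Rightarrow> real \<Rightarrow> real \<Rightarrow> real \<Rightarrow> nat \<Rightarrow> real" where
  "p_inf L \<kappa> m \<mu> t n = - (1 / alpha L \<kappa> m \<mu> n) * (1 / tan (omega L \<kappa> m \<mu> n * t))"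

definition q_inf :: "real \<Rightarrow> real \<Rightarrow> real \<Rightarrow> real \<Rightarrow> real \<Rightarrow> nat \<Rightarrow> real" where
  "q_inf L \<kappa> m \<mu> t n = 1 / alpha L \<kappa> m \<mu> n * (1 / sin (omega L \<kappa> m \<mu> n * t))"

definition r_inf :: "real \<Rightarrow> real \<Rightarrow> real \<Rightarrow> real \<Rightarrow> real \<Rightarrow> nat \<Rightarrow> real" where
  "r_inf L \<kappa> m \<mu> t n = - (1 / alpha L \<kappa> m \<mu> n) * (1 / tan (omega L \<kappa> m \<mu> n * t))"

definition quad_form ::
  "real \<Rightarrow> (L2 \<rightharpoonup> L2) \<Rightarrow> (L2 \<rightharpoonup> L2) \<Rightarrow> (L2 \<rightharpoonup> L2) \<Rightarrow> L2 \<Rightarrow> L2 \<Rightarrow> real" where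
  "quad_form L P Q R x z = 1 / 2 * inner_half L x (the (P x)) + inner_half L x (the (Q z))
     + 1 / 2 * inner_half L z (the (R z))"

definition W_breve_c :: "real \<Rightarrow> real \<Rightarrow> real \<Rightarrow> real \<Rightarrow> real \<Rightarrow> real \<Rightarrow> L2 \<Rightarrow> L2 \<Rightarrow> real" where
  "W_breve_c L \<kappa> m \<mu> c t x z = quad_form L (spectral_op L (p_c L \<kappa> m \<mu> c t))
     (spectral_op L (q_c L \<kappa> m \<mu> c t)) (spectral_op L (r_c L \<kappa> m \<mu> c t)) x z"

definition W_breve_inf :: "real \<Rightarrow> real \<Rightarrow> real \<Rightarrow> real \<Rightarrow> real \<Rightarrow> L2 \<Rightarrow> L2 \<Rightarrow> real" where
  "W_breve_inf L \<kappa> m \<mu> t x z = quad_form L (spectral_op L (p_inf L \<kappa> m \<mu> t))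
     (spectral_op L (q_inf L \<kappa> m \<mu> t)) (spectral_op L (r_inf L \<kappa> m \<mu> t)) x z"

end

theory Submission
  imports Defs
begin

text \<open>
  In the sine basis all operators are diagonal and the control problem decouples into scalar
  linear-quadratic problems, one for each mode. The square roots are identified by uniqueness: a
  positive self-adjoint square root of a diagonal operator fixes the eigenvectors. For a single
  mode the Riccati solution turns the payoff plus the increment of the explicit quadratic form into
  minus a square, which bounds \<open>W\<^sup>c\<close> from above; the harmonic oscillation with the optimal boundary
  values attains the bound. Here \<open>\<omega> t < \<surd>2 < \<pi>/2\<close>, so no conjugate point is met. The supremum over
  all controls is approached by steering finitely many modes optimally and the remaining ones by a
  constant control, which needs no measurability argument for the full optimal control. Finally
  \<open>W\<^sup>\<infinity> \<le> W\<^sup>c\<close>, and the explicit forms converge as \<open>c\<close> tends to infinity by dominated convergence of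
  the series.
\<close>

text \<open>Decoupling leaves infinitely many scalar problems, so the explicit coefficients need one
  positive lower bound for all denominators \<open>sin (\<omega> t + \<theta>)\<close>. The
  constants are made for this: \<open>t_bar\<close> keeps \<open>\<omega> t\<close> below
  \<open>sqrt 2\<close> in every mode, the fourth root \<open>op_K\<close> makes the angle \<theta>
  independent of the mode, and \<open>c_bar\<close> keeps it below \<open>pi / 2 - sqrt 2\<close>.
  All phases then lie where the sine increases. For finite \<open>c\<close> the bound is
  \<open>sin \<theta>\<close>; it degenerates as \<open>c\<close> grows and is then replaced by the
  sine of the slowest phase, which is positive because \<open>t > 0\<close>. On the analytic side,
  the operator \<A> is given through absolutely continuous representatives, so its diagonal form has
  to be earned: integration by parts yields the eigenvalue relation, and solvability for every
  right-hand side yields the exact domain. The norm of \<open>space_half\<close> is not the norm of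
  the type \<open>L2\<close>; its Hilbert space theory is therefore carried by coordinates, and
  controls are moved by \<open>sqrt_A\<close> to \<open>L2\<close>, where the Bochner integral is
  available.\<close>

abbreviation (input) leb :: "real \<Rightarrow> real measure" where
  "leb t \<equiv> lebesgue_on {0..t}"

section \<open>Absolutely continuous functions\<close>

text \<open>The gauge integral makes this direct: intervals tagged in \<open>N\<close> are forced
  into an open set of small measure, where absolute continuity bounds the increments of
  \<open>f\<close>; at all other tags differentiability gives the straddle estimate. Integrability
  of \<open>g\<close> comes out as a result.\<close>

lemma abs_continuous_has_integral:
  fixes f g :: "real \<Rightarrow> real"
  assumes ab: "a \<le> b" and ac: "abs_continuous_on a b f" and N: "negligible N"
    and der: "\<And>s. s \<in> {a..b} - N \<Longrightarrow> (f has_real_derivative g s) (at s within {a..b})"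
  shows "(g has_integral (f b - f a)) {a..b}"
proof -
  \<comment> \<open>With the value 0 on \<open>N\<close>, a term of the Riemann sum tagged in
    \<open>N\<close> reduces to an increment of \<open>f\<close>.\<close>
  define g' where "g' s = (if s \<in> N then 0 else g s)" for s
  have "(g' has_integral (f b - f a)) {a..b}"
    unfolding has_integral_real
  proof (intro allI impI)
    fix e :: real assume "e > 0"
    define e1 where "e1 = e / (2 * (b - a + 1))"
    have e1: "e1 > 0" "e1 * (b - a) < e / 2"
      using \<open>e > 0\<close> ab by (auto simp: e1_def field_simps)
    obtain d where "d > 0" and d: "\<And>D. finite D \<and> (\<forall>(p, q)\<in>D. a \<le> p \<and> p \<le> q \<and> q \<le> b) \<and>
        disjoint_family_on (\<lambda>(p, q). {p<..<q}) D \<and> (\<Sum>(p, q)\<in>D. q - p) < d \<Longrightarrow>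
        (\<Sum>(p, q)\<in>D. \<bar>f q - f p\<bar>) < e / 2"
      using ac[unfolded abs_continuous_on_def, rule_format, of "e / 2"] \<open>e > 0\<close> by auto
    have Ns: "N \<in> sets lebesgue" "emeasure lebesgue N = 0"
      using N by (auto simp: negligible_iff_null_sets null_sets_def)
    obtain G where G: "open G" "N \<subseteq> G" "G - N \<in> lmeasurable" "emeasure lebesgue (G - N) < ennreal d"
      using sets_lebesgue_outer_open[OF Ns(1) \<open>d > 0\<close>] by blast
    have Gm: "G \<in> sets lebesgue" using G(1) by simp
    have "emeasure lebesgue G = emeasure lebesgue (G - N)"
      using emeasure_Diff_null_set[of N lebesgue G] Ns Gm by (auto simp: null_sets_def)
    then have Gd: "emeasure lebesgue G < ennreal d" using G(4) by simp
    have "\<exists>r>0. \<forall>y\<in>{a..b}. \<bar>y - s\<bar> < r \<longrightarrow> \<bar>f y - f s - g s * (y - s)\<bar> \<le> e1 * \<bar>y - s\<bar>"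
      if "s \<in> {a..b} - N" for s
      using der[OF that] e1(1)
      unfolding has_field_derivative_def has_derivative_within_alt by auto
    then obtain r where r: "\<And>s. s \<in> {a..b} - N \<Longrightarrow> r s > 0"
      "\<And>s y. s \<in> {a..b} - N \<Longrightarrow> y \<in> {a..b} \<Longrightarrow> \<bar>y - s\<bar> < r s \<Longrightarrow>
          \<bar>f y - f s - g s * (y - s)\<bar> \<le> e1 * \<bar>y - s\<bar>"
      by metis
    \<comment> \<open>The last case meets no tag of a division of \<open>{a..b}\<close>; it only
      makes \<open>\<gamma>\<close> a gauge on the whole line.\<close>
    define \<gamma> where "\<gamma> s = (if s \<in> N then G else if s \<in> {a..b} then ball s (r s) else ball s 1)" for s
    have "gauge \<gamma>"
      unfolding gauge_def \<gamma>_def using G r(1) by auto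
    moreover have "norm ((\<Sum>(x, k)\<in>D. measure lborel k *\<^sub>R g' x) - (f b - f a)) < e"
      if D: "D tagged_division_of {a..b}" and fine: "\<gamma> fine D" for D
    proof -
      note TD = tagged_division_ofD[OF D]
      have finD: "finite D" using TD(1) .
      have K: "\<exists>p q. K = {p..q} \<and> a \<le> p \<and> p \<le> x \<and> x \<le> q \<and> q \<le> b \<and> Inf K = p \<and> Sup K = q \<and> measure lborel K = q - p"
        if xK: "(x, K) \<in> D" for x K
      proof -
        obtain p q where pq: "K = cbox p q" using TD(4)[OF xK] by blast
        have "x \<in> K" "K \<subseteq> {a..b}" using TD(2,3)[OF xK] by auto
        then show ?thesis
          using pq by (intro exI[of _ p] exI[of _ q]) auto
      qed
      have Kle: "a \<le> Inf K \<and> Inf K \<le> x \<and> x \<le> Sup K \<and> Sup K \<le> b" if "(x, K) \<in> D" for x K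
        using K[OF that] by metis
      define D1 where "D1 = {(x, K) \<in> D. x \<in> N}"
      define D2 where "D2 = {(x, K) \<in> D. x \<notin> N}"
      \<comment> \<open>Degenerate intervals contribute no increment. Without them, disjoint
        interiors show that \<open>h\<close> below, which forgets the tag, is injective.\<close>
      define D1' where "D1' = {(x, K) \<in> D. x \<in> N \<and> Inf K < Sup K}"
      have split: "D = D1 \<union> D2" "D1 \<inter> D2 = {}" "finite D1" "finite D2" "finite D1'" "D1' \<subseteq> D1"
        using finD by (auto simp: D1_def D2_def D1'_def intro: finite_subset[OF _ finD])
      let ?t = "\<lambda>(x, K). measure lborel K *\<^sub>R g' x - (f (Sup K) - f (Inf K))"
      have "(\<Sum>(x, k)\<in>D. measure lborel k *\<^sub>R g' x) - (f b - f a) = sum ?t D"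
        unfolding additive_tagged_division_1[OF ab D, of f, symmetric]
        by (simp add: sum_subtractf case_prod_beta)
      also have "\<dots> = sum ?t D1 + sum ?t D2"
        unfolding split(1) using split by (intro sum.union_disjoint) auto
      finally have eq: "(\<Sum>(x, k)\<in>D. measure lborel k *\<^sub>R g' x) - (f b - f a) = sum ?t D1 + sum ?t D2" .
      have "norm (sum ?t D2) \<le> (\<Sum>(x, K)\<in>D2. e1 * (Sup K - Inf K))"
      proof (rule sum_norm_le, clarify)
        fix x K assume xK: "(x, K) \<in> D2"
        then have xD: "(x, K) \<in> D" "x \<notin> N" by (auto simp: D2_def)
        from K[OF xD(1)] obtain p q where pq: "K = {p..q}" "a \<le> p" "p \<le> x" "x \<le> q" "q \<le> b"
          "Inf K = p" "Sup K = q" "measure lborel K = q - p" by blast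
        have x: "x \<in> {a..b} - N" using pq xD by auto
        have "K \<subseteq> \<gamma> x" using fine xD(1) by (auto simp: fine_def)
        moreover have "p \<in> K" "q \<in> K" using pq by auto
        ultimately have "p \<in> ball x (r x)" "q \<in> ball x (r x)"
          using x unfolding \<gamma>_def by auto
        then have "\<bar>f p - f x - g x * (p - x)\<bar> \<le> e1 * \<bar>p - x\<bar>" "\<bar>f q - f x - g x * (q - x)\<bar> \<le> e1 * \<bar>q - x\<bar>"
          using pq r(2)[OF x, of p] r(2)[OF x, of q] by (auto simp: dist_real_def)
        moreover have "\<bar>p - x\<bar> = x - p" "\<bar>q - x\<bar> = q - x" using pq by auto
        ultimately have "\<bar>(q - p) * g x - (f q - f p)\<bar> \<le> e1 * (x - p) + e1 * (q - x)"
          by (simp only:) (simp add: algebra_simps abs_le_iff)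
        then show "norm (measure lborel K *\<^sub>R g' x - (f (Sup K) - f (Inf K))) \<le> e1 * (Sup K - Inf K)"
          using pq xD(2) by (simp add: g'_def algebra_simps)
      qed
      also have "\<dots> \<le> (\<Sum>(x, K)\<in>D. e1 * (Sup K - Inf K))"
        using Kle e1(1) by (intro sum_mono2 finD) (force simp: split(1) intro!: mult_nonneg_nonneg)+
      also have "\<dots> = e1 * (b - a)"
        unfolding additive_tagged_division_1[OF ab D, of "\<lambda>x. x", symmetric]
        by (simp add: sum_distrib_left case_prod_beta)
      finally have D2: "norm (sum ?t D2) < e / 2" using e1 by simp
      define h where "h = (\<lambda>(x :: real, K :: real set). (Inf K, Sup K))"
      have inj: "inj_on h D1'"
      proof (rule inj_onI, clarify)
        fix x K y M assume A: "(x, K) \<in> D1'" "(y, M) \<in> D1'" "h (x, K) = h (y, M)"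
        then have B: "(x, K) \<in> D" "(y, M) \<in> D" by (auto simp: D1'_def)
        have "K = M" using K[OF B(1)] K[OF B(2)] A(3) by (auto simp: h_def)
        moreover have "interior K = {Inf K<..<Sup K}"
          using K[OF B(1)] by (metis interior_atLeastAtMost_real)
        moreover have "{Inf K<..<Sup K} \<noteq> {}"
          using A(1) by (simp add: D1'_def)
        ultimately show "x = y \<and> K = M"
          using TD(5)[OF B] by auto
      qed
      have disj: "disjoint_family_on (\<lambda>(p, q). {p<..<q}) (h ` D1')"
      proof (unfold disjoint_family_on_def, intro ballI impI)
        fix i j assume "i \<in> h ` D1'" "j \<in> h ` D1'" and ne: "i \<noteq> j"
        then obtain x K y M where A: "(x, K) \<in> D1'" "(y, M) \<in> D1'"
            "i = (Inf K, Sup K)" "j = (Inf M, Sup M)"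
          by (auto simp: h_def)
        then have B: "(x, K) \<in> D" "(y, M) \<in> D" by (auto simp: D1'_def)
        have "(x, K) \<noteq> (y, M)" using A ne by auto
        then have "interior K \<inter> interior M = {}" using TD(5)[OF B] by auto
        moreover have "interior K = {Inf K<..<Sup K}" "interior M = {Inf M<..<Sup M}"
          using K[OF B(1)] K[OF B(2)] by (metis interior_atLeastAtMost_real)+
        ultimately show "(\<lambda>(p, q). {p<..<q}) i \<inter> (\<lambda>(p, q). {p<..<q}) j = {}"
          using A by simp
      qed
      have bnd: "\<forall>(p, q)\<in>h ` D1'. a \<le> p \<and> p \<le> q \<and> q \<le> b"
        using Kle by (force simp: D1'_def h_def)
      have sub: "(\<Union>(p, q)\<in>h ` D1'. {p<..<q}) \<subseteq> G"
      proof (clarify)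
        fix s p q x K assume A: "(x, K) \<in> D1'" "(p, q) = h (x, K)" "s \<in> {p<..<q}"
        then have B: "(x, K) \<in> D" "x \<in> N" by (auto simp: D1'_def)
        have "K \<subseteq> \<gamma> x" using fine B(1) by (auto simp: fine_def)
        then have "K \<subseteq> G" using B(2) by (simp add: \<gamma>_def)
        moreover have "K = {Inf K..Sup K}" using K[OF B(1)] by metis
        moreover have "s \<in> {Inf K..Sup K}" using A by (simp add: h_def)
        ultimately show "s \<in> G" by (metis subsetD)
      qed
      \<comment> \<open>Disjointness turns the total length into the measure of a union inside
        \<open>G\<close>, hence less than \<open>d\<close>, as absolute continuity requires.\<close>
      have "(\<Sum>(p, q)\<in>h ` D1'. q - p) = (\<Sum>i\<in>h ` D1'. measure lebesgue ((\<lambda>(p, q). {p<..<q}) i))"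
        using bnd by (intro sum.cong) auto
      also have "\<dots> = measure lebesgue (\<Union>(p, q)\<in>h ` D1'. {p<..<q})"
      proof (rule measure_finite_Union[symmetric, OF _ _ disj])
        show "emeasure lebesgue ((\<lambda>(p, q). {p<..<q}) i) \<noteq> \<infinity>" if "i \<in> h ` D1'" for i
          using bnd that by auto
      qed (use split(5) in auto)
      finally have "ennreal (\<Sum>(p, q)\<in>h ` D1'. q - p) = ennreal (measure lebesgue (\<Union>(p, q)\<in>h ` D1'. {p<..<q}))"
        by simp
      also have "\<dots> \<le> emeasure lebesgue (\<Union>(p, q)\<in>h ` D1'. {p<..<q})"
        by (simp add: measure_def ennreal_enn2real_if)
      also have "\<dots> \<le> emeasure lebesgue G"
        using sub Gm by (rule emeasure_mono)
      finally have "(\<Sum>(p, q)\<in>h ` D1'. q - p) < d"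
        using Gd \<open>d > 0\<close> by (meson ennreal_less_iff ennreal_lessI le_less_trans not_le ennreal_leI)
      then have "(\<Sum>(p, q)\<in>h ` D1'. \<bar>f q - f p\<bar>) < e / 2"
        using split(5) bnd disj by (intro d) auto
      then have s1: "(\<Sum>(x, K)\<in>D1'. \<bar>f (Sup K) - f (Inf K)\<bar>) < e / 2"
        by (subst (asm) sum.reindex[OF inj]) (simp add: h_def case_prod_beta o_def)
      have "norm (sum ?t D1) \<le> (\<Sum>(x, K)\<in>D1. \<bar>f (Sup K) - f (Inf K)\<bar>)"
        by (rule sum_norm_le) (auto simp: D1_def g'_def)
      also have "\<dots> = (\<Sum>(x, K)\<in>D1'. \<bar>f (Sup K) - f (Inf K)\<bar>)"
      proof (rule sum.mono_neutral_right[OF split(3,6)], clarify)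
        fix x K assume "(x, K) \<in> D1" "(x, K) \<notin> D1'"
        then have "Inf K = Sup K" using Kle[of x K] by (auto simp: D1_def D1'_def)
        then show "\<bar>f (Sup K) - f (Inf K)\<bar> = 0" by simp
      qed
      finally have "norm (sum ?t D1) < e / 2" using s1 by simp
      then show ?thesis
        unfolding eq using D2 norm_triangle_ineq[of "sum ?t D1" "sum ?t D2"] by linarith
    qed
    ultimately show "\<exists>\<gamma>. gauge \<gamma> \<and> (\<forall>D. D tagged_division_of {a..b} \<and> \<gamma> fine D \<longrightarrow>
        norm ((\<Sum>(x, k)\<in>D. measure lborel k *\<^sub>R g' x) - (f b - f a)) < e)"
      by (intro exI[of _ \<gamma>] conjI allI impI) simp_all
  qed
  then show ?thesis
    by (rule has_integral_spike[OF N, rotated]) (simp add: g'_def)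
qed

section \<open>Permanence properties of absolute continuity\<close>

lemma abs_continuous_on_imp_continuous_on:
  assumes "abs_continuous_on a b f"
  shows "continuous_on {a..b} f"
proof (rule continuous_onI)
  fix x e :: real assume x: "x \<in> {a..b}" and e: "e > 0"
  then obtain d where d: "d > 0" "\<And>D. finite D \<and> (\<forall>(p, q)\<in>D. a \<le> p \<and> p \<le> q \<and> q \<le> b) \<and>
      disjoint_family_on (\<lambda>(p, q). {p<..<q}) D \<and> (\<Sum>(p, q)\<in>D. q - p) < d \<Longrightarrow>
      (\<Sum>(p, q)\<in>D. \<bar>f q - f p\<bar>) < e"
    using assms[unfolded abs_continuous_on_def, rule_format, of e] by auto
  have "dist (f y) (f x) \<le> e" if "y \<in> {a..b}" "dist y x < d" for y
    using d(2)[of "{(min x y, max x y)}"] that x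
    by (cases "x \<le> y") (auto simp: dist_real_def disjoint_family_on_def min_def max_def abs_minus_commute)
  then show "\<exists>d>0. \<forall>x'\<in>{a..b}. dist x' x < d \<longrightarrow> dist (f x') (f x) \<le> e"
    using d(1) by blast
qed

text \<open>One epsilon-delta argument for all closure properties: sums, products, negation and
  Lipschitz functions below each need only an estimate of increments.\<close>

lemma abs_continuous_on_dominated:
  assumes f: "abs_continuous_on a b f" and g: "abs_continuous_on a b g" and C: "C \<ge> 0"
    and h: "\<And>p q. a \<le> p \<Longrightarrow> p \<le> q \<Longrightarrow> q \<le> b \<Longrightarrow> \<bar>h q - h p\<bar> \<le> C * (\<bar>f q - f p\<bar> + \<bar>g q - g p\<bar>)"
  shows "abs_continuous_on a b h"
  unfolding abs_continuous_on_def
proof (intro allI impI)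
  fix e :: real assume e: "e > 0"
  define e' where "e' = e / (2 * (C + 1))"
  have e': "e' > 0" "2 * C * e' < e" using e C by (auto simp: e'_def field_simps)
  let ?P = "\<lambda>D d. finite D \<and> (\<forall>(p, q)\<in>D. a \<le> p \<and> p \<le> q \<and> q \<le> b) \<and>
      disjoint_family_on (\<lambda>(p, q). {p<..<q}) D \<and> (\<Sum>(p, q)\<in>D. q - p) < d"
  obtain d1 where d1: "d1 > 0" "\<And>D. ?P D d1 \<Longrightarrow> (\<Sum>(p, q)\<in>D. \<bar>f q - f p\<bar>) < e'"
    using f[unfolded abs_continuous_on_def, rule_format, OF e'(1)] by auto
  obtain d2 where d2: "d2 > 0" "\<And>D. ?P D d2 \<Longrightarrow> (\<Sum>(p, q)\<in>D. \<bar>g q - g p\<bar>) < e'"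
    using g[unfolded abs_continuous_on_def, rule_format, OF e'(1)] by auto
  have "(\<Sum>(p, q)\<in>D. \<bar>h q - h p\<bar>) < e" if D: "?P D (min d1 d2)" for D
  proof -
    have "(\<Sum>(p, q)\<in>D. \<bar>h q - h p\<bar>) \<le> (\<Sum>(p, q)\<in>D. C * (\<bar>f q - f p\<bar> + \<bar>g q - g p\<bar>))"
      using D h by (intro sum_mono) auto
    also have "\<dots> = C * ((\<Sum>(p, q)\<in>D. \<bar>f q - f p\<bar>) + (\<Sum>(p, q)\<in>D. \<bar>g q - g p\<bar>))"
      by (simp add: sum_distrib_left sum.distrib[symmetric] case_prod_beta)
    also have "\<dots> \<le> C * (e' + e')"
      using D C d1(2)[of D] d2(2)[of D] by (intro mult_left_mono add_mono) auto
    finally show ?thesis using e' by simp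
  qed
  then show "\<exists>d>0. \<forall>D. ?P D d \<longrightarrow> (\<Sum>(p, q)\<in>D. \<bar>h q - h p\<bar>) < e"
    using d1(1) d2(1) by (intro exI[of _ "min d1 d2"]) simp
qed

lemma abs_continuous_on_id: "abs_continuous_on a b (\<lambda>x. x)"
  unfolding abs_continuous_on_def
proof (intro allI impI)
  fix e :: real assume "e > 0"
  have "(\<Sum>(p, q)\<in>D. \<bar>q - p\<bar>) = (\<Sum>(p, q)\<in>D. q - p)"
    if "\<forall>(p, q)\<in>D. a \<le> p \<and> p \<le> q \<and> q \<le> b" for D
    using that by (intro sum.cong) auto
  then show "\<exists>d>0. \<forall>D. finite D \<and> (\<forall>(p, q)\<in>D. a \<le> p \<and> p \<le> q \<and> q \<le> b) \<and>
      disjoint_family_on (\<lambda>(p, q). {p<..<q}) D \<and> (\<Sum>(p, q)\<in>D. q - p) < d \<longrightarrow>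
      (\<Sum>(p, q)\<in>D. \<bar>q - p\<bar>) < e"
    using \<open>e > 0\<close> by auto
qed

lemma abs_continuous_on_add:
  assumes "abs_continuous_on a b f" "abs_continuous_on a b g"
  shows "abs_continuous_on a b (\<lambda>x. f x + g x)"
  by (rule abs_continuous_on_dominated[OF assms, of 1]) auto

lemma abs_continuous_on_mult:
  assumes f: "abs_continuous_on a b f" and g: "abs_continuous_on a b g"
  shows "abs_continuous_on a b (\<lambda>x. f x * g x)"
proof -
  have "bounded (f ` {a..b})" "bounded (g ` {a..b})"
    using assms[THEN abs_continuous_on_imp_continuous_on]
    by (auto intro!: compact_imp_bounded compact_continuous_image)
  then obtain B1 B2 where B: "\<And>x. x \<in> {a..b} \<Longrightarrow> \<bar>f x\<bar> \<le> B1" "\<And>x. x \<in> {a..b} \<Longrightarrow> \<bar>g x\<bar> \<le> B2"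
    unfolding bounded_iff by (metis image_eqI real_norm_def)
  show ?thesis
  proof (rule abs_continuous_on_dominated[OF assms, of "\<bar>B1\<bar> + \<bar>B2\<bar>"])
    fix p q assume pq: "a \<le> p" "p \<le> q" "q \<le> b"
    have "f q * g q - f p * g p = f q * (g q - g p) + g p * (f q - f p)" by (simp add: algebra_simps)
    then have "\<bar>f q * g q - f p * g p\<bar> \<le> \<bar>f q\<bar> * \<bar>g q - g p\<bar> + \<bar>g p\<bar> * \<bar>f q - f p\<bar>"
      using abs_triangle_ineq[of "f q * (g q - g p)" "g p * (f q - f p)"] by (simp add: abs_mult)
    also have "\<dots> \<le> (\<bar>B1\<bar> + \<bar>B2\<bar>) * \<bar>g q - g p\<bar> + (\<bar>B1\<bar> + \<bar>B2\<bar>) * \<bar>f q - f p\<bar>"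
      using B(1)[of q] B(2)[of p] pq by (intro add_mono mult_right_mono) auto
    finally show "\<bar>f q * g q - f p * g p\<bar> \<le> (\<bar>B1\<bar> + \<bar>B2\<bar>) * (\<bar>f q - f p\<bar> + \<bar>g q - g p\<bar>)"
      by (simp add: algebra_simps)
  qed auto
qed

lemma abs_continuous_on_Lipschitz:
  assumes "\<And>p q. a \<le> p \<Longrightarrow> p \<le> q \<Longrightarrow> q \<le> b \<Longrightarrow> \<bar>f q - f p\<bar> \<le> C * (q - p)" "C \<ge> 0"
  shows "abs_continuous_on a b f"
  by (rule abs_continuous_on_dominated[OF abs_continuous_on_id abs_continuous_on_id, of C])
     (use assms in \<open>force intro: order_trans[OF _ mult_left_mono]\<close>)+

lemma abs_continuous_on_C1:
  assumes d: "\<And>x. x \<in> {a..b} \<Longrightarrow> (f has_real_derivative f' x) (at x within {a..b})"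
    and c: "continuous_on {a..b} f'"
  shows "abs_continuous_on a b f"
proof -
  have "bounded (f' ` {a..b})"
    using c by (auto intro!: compact_imp_bounded compact_continuous_image)
  then obtain B where B: "\<And>x. x \<in> {a..b} \<Longrightarrow> \<bar>f' x\<bar> \<le> B"
    unfolding bounded_iff by (metis image_eqI real_norm_def)
  show ?thesis
  proof (rule abs_continuous_on_Lipschitz[of _ _ _ "\<bar>B\<bar>"])
    fix p q assume pq: "a \<le> p" "p \<le> q" "q \<le> b"
    have "norm (f q - f p) \<le> \<bar>B\<bar> * norm (q - p)"
      by (rule field_differentiable_bound[of "{a..b}" f f'])
         (use d B pq in \<open>force intro: order_trans[OF _ abs_ge_self]\<close>)+
    then show "\<bar>f q - f p\<bar> \<le> \<bar>B\<bar> * (q - p)" using pq by simp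
  qed simp
qed

lemma abs_continuous_on_uminus:
  assumes "abs_continuous_on a b f"
  shows "abs_continuous_on a b (\<lambda>x. - f x)"
  by (rule abs_continuous_on_dominated[OF assms assms, of 1]) (auto simp: abs_minus_commute)

lemma abs_continuous_on_const: "abs_continuous_on a b (\<lambda>x. c)"
  by (rule abs_continuous_on_Lipschitz[of _ _ _ 0]) auto

text \<open>Lebesgue differentiation on the line. Averages over \<open>[x, x + h]\<close> give the
  right derivative off a null set; the left derivative is the right one of the reflected function,
  whose exceptional set is reflected back.\<close>

lemma indefinite_integral_ae_derivative:
  fixes f :: "real \<Rightarrow> real"
  assumes f: "integrable (lebesgue_on {a..b}) f"
  obtains N where "negligible N"
    "\<And>s. s \<in> {a<..<b} - N \<Longrightarrow>
       ((\<lambda>x. \<integral>s. f s \<partial>lebesgue_on {a..x}) has_real_derivative f s) (at s)"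
proof -
  define f0 where "f0 x = (if x \<in> {a..b} then f x else 0)" for x
  define F where "F x = (\<integral>s. f s \<partial>lebesgue_on {a..x})" for x
  have "f integrable_on {a..b}"
    using integrable_on_lebesgue_on[OF f] by simp
  then have f0: "f0 integrable_on UNIV"
    unfolding f0_def by (simp only: Henstock_Kurzweil_Integration.integrable_restrict_UNIV)
  then have int: "f0 integrable_on cbox c d" for c d
    by (rule integrable_on_subcbox) simp
  have F: "F x = integral {a..x} f0" if "x \<in> {a..b}" for x
  proof -
    have "integrable (lebesgue_on {a..x}) f"
      using integrable_subinterval[OF f, of a x] that by auto
    then have "F x = integral {a..x} f"
      unfolding F_def by (intro lebesgue_integral_eq_integral) auto
    also have "\<dots> = integral {a..x} f0"
      using that by (intro Henstock_Kurzweil_Integration.integral_cong) (auto simp: f0_def)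
    finally show ?thesis .
  qed
  have diff: "F d - F c = integral {c..d} f0" if "a \<le> c" "c \<le> d" "d \<le> b" for c d
    using F[of c] F[of d] that int[of a d]
      Henstock_Kurzweil_Integration.integral_combine[of a c d f0] by auto
  obtain N1 where N1: "negligible N1" "\<And>x e. \<lbrakk>x \<notin> N1; 0 < e\<rbrakk> \<Longrightarrow> \<exists>d>0. \<forall>h. 0 < h \<and> h < d \<longrightarrow>
      norm (integral (cbox x (x + h *\<^sub>R One)) f0 /\<^sub>R h ^ DIM(real) - f0 x) < e"
    using integrable_ccontinuous_explicit[of f0] int by blast
  define g0 where "g0 x = f0 (- x)" for x
  have "g0 integrable_on cbox c d" for c d
    unfolding g0_def using int[of "- d" "- c"] Henstock_Kurzweil_Integration.integrable_reflect_real[where f = f0 and a = "- d" and b = "- c"] by simp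
  then obtain N2 where N2: "negligible N2" "\<And>x e. \<lbrakk>x \<notin> N2; 0 < e\<rbrakk> \<Longrightarrow> \<exists>d>0. \<forall>h. 0 < h \<and> h < d \<longrightarrow>
      norm (integral (cbox x (x + h *\<^sub>R One)) g0 /\<^sub>R h ^ DIM(real) - g0 x) < e"
    using integrable_ccontinuous_explicit[of g0] by blast
  show thesis
  proof (rule that[of "N1 \<union> uminus ` N2"])
    show "negligible (N1 \<union> uminus ` N2)"
    proof (rule negligible_Un[OF N1(1)])
      have "uminus differentiable_on N2"
        using linear_uminus by (rule linear_imp_differentiable_on)
      then show "negligible (uminus ` N2)"
        using N2(1) by (intro negligible_differentiable_image_negligible) auto
    qed
    fix s assume s: "s \<in> {a<..<b} - (N1 \<union> uminus ` N2)"
    then have s': "s \<notin> N1" "- s \<notin> N2" "a < s" "s < b"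
      by (auto, metis add.inverse_inverse image_eqI)
    have "(F has_real_derivative f s) (at s)"
      unfolding DERIV_def LIM_eq
    proof (intro allI impI)
      fix e :: real assume e: "e > 0"
      obtain d1 where d1: "d1 > 0" "\<And>h. 0 < h \<Longrightarrow> h < d1 \<Longrightarrow> \<bar>integral {s..s + h} f0 / h - f s\<bar> < e"
        using N1(2)[OF s'(1) e] s' by (auto simp: f0_def divide_inverse mult.commute)
      obtain d2 where d2: "d2 > 0" "\<And>h. 0 < h \<Longrightarrow> h < d2 \<Longrightarrow> \<bar>integral {- s..- s + h} g0 / h - f s\<bar> < e"
        using N2(2)[OF s'(2) e] s' by (auto simp: f0_def g0_def divide_inverse mult.commute)
      have refl: "integral {- s..- s + h} g0 = integral {s - h..s} f0" for h
        unfolding g0_def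
        using Henstock_Kurzweil_Integration.integral_reflect_real[where f = f0 and a = "s - h" and b = s] by simp
      define d where "d = Min {d1, d2, b - s, s - a}"
      have d: "d > 0" "d \<le> d1" "d \<le> d2" "d \<le> b - s" "d \<le> s - a"
        using d1(1) d2(1) s' by (auto simp: d_def)
      have "\<bar>(F (s + h) - F s) / h - f s\<bar> < e" if h: "h \<noteq> 0" "\<bar>h\<bar> < d" for h
      proof (cases "h > 0")
        case True
        then show ?thesis using d1(2)[of h] diff[of s "s + h"] d h s' by auto
      next
        case False
        then have "(F (s + h) - F s) / h = integral {s + h..s} f0 / (- h)"
          using diff[of "s + h" s] d h s' by (auto simp: field_simps)
        then show ?thesis using d2(2)[of "- h"] refl[of "- h"] d h s' False by auto
      qed
      then show "\<exists>d>0. \<forall>h. h \<noteq> 0 \<and> norm (h - 0) < d \<longrightarrow> norm ((F (s + h) - F s) / h - f s) < e"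
        using d(1) by auto
    qed
    then show "((\<lambda>x. \<integral>s. f s \<partial>lebesgue_on {a..x}) has_real_derivative f s) (at s)"
      by (simp add: F_def[abs_def])
  qed
qed

text \<open>Truncate at height \<open>n\<close>: the excess \<open>h n\<close> of the absolute value
  over \<open>n\<close> has small integral by dominated convergence, and the bounded remainder
  contributes at most \<open>n\<close> times the total length.\<close>

lemma abs_continuous_on_indefinite_integral:
  fixes f :: "real \<Rightarrow> real"
  assumes f: "integrable (lebesgue_on {a..b}) f"
  shows "abs_continuous_on a b (\<lambda>x. \<integral>s. f s \<partial>lebesgue_on {a..x})"
  unfolding abs_continuous_on_def
proof (intro allI impI)
  fix e :: real assume e: "e > 0"
  define f0 where "f0 x = (if x \<in> {a..b} then f x else 0)" for x
  define F where "F x = (\<integral>s. f s \<partial>lebesgue_on {a..x})" for x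
  have f0: "integrable lebesgue f0"
    unfolding f0_def using f by (subst Lebesgue_Measure.integrable_restrict_UNIV) auto
  have f0m [measurable]: "f0 \<in> borel_measurable lebesgue" using f0 by simp
  have ind: "integrable lebesgue (\<lambda>x. indicator S x * f0 x)" if "S \<in> sets lebesgue" for S
    using integrable_mult_indicator[OF that f0] by simp
  have F: "F x = (\<integral>s. indicator {a..x} s * f0 s \<partial>lebesgue)" if "x \<in> {a..b}" for x
  proof -
    have "F x = (\<integral>s. indicator {a..x} s *\<^sub>R f s \<partial>lebesgue)"
      unfolding F_def by (intro integral_restrict_space) auto
    also have "\<dots> = (\<integral>s. indicator {a..x} s * f0 s \<partial>lebesgue)"
      using that by (intro Bochner_Integration.integral_cong) (auto simp: f0_def indicator_def)
    finally show ?thesis .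
  qed
  have diff: "\<bar>F q - F p\<bar> \<le> (\<integral>s. indicator {p<..<q} s * \<bar>f0 s\<bar> \<partial>lebesgue)" if "a \<le> p" "p \<le> q" "q \<le> b" for p q
  proof -
    have "F q - F p = (\<integral>s. indicator {a..q} s * f0 s - indicator {a..p} s * f0 s \<partial>lebesgue)"
      using that F by (subst Bochner_Integration.integral_diff) (auto intro!: ind)
    also have "\<dots> = (\<integral>s. indicator {p<..<q} s * f0 s \<partial>lebesgue)"
    proof (rule integral_cong_AE)
      have "AE s in lebesgue. s \<noteq> q"
        by (rule AE_I[where N = "{q}"]) auto
      then show "AE s in lebesgue. indicator {a..q} s * f0 s - indicator {a..p} s * f0 s =
          indicator {p<..<q} s * f0 s"
        by eventually_elim (use that in \<open>auto simp: indicator_def\<close>)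
    qed (intro borel_measurable_diff borel_measurable_integrable[OF ind]; simp)+
    also have "\<bar>\<dots>\<bar> \<le> (\<integral>s. \<bar>indicator {p<..<q} s * f0 s\<bar> \<partial>lebesgue)"
      by (rule integral_abs_bound)
    finally show ?thesis by (simp add: abs_mult)
  qed
  define h where "h n s = \<bar>f0 s\<bar> - min \<bar>f0 s\<bar> (real n)" for n s
  have hm [measurable]: "h n \<in> borel_measurable lebesgue" for n
    unfolding h_def[abs_def] by measurable
  have h0: "0 \<le> h n s" "h n s \<le> \<bar>f0 s\<bar>" for n s by (auto simp: h_def)
  have hint: "integrable lebesgue (h n)" for n
    by (rule Bochner_Integration.integrable_bound[OF integrable_abs[OF f0]]) (use h0 in auto)
  have "(\<lambda>n. \<integral>s. h n s \<partial>lebesgue) \<longlonglongrightarrow> (\<integral>s. 0 \<partial>(lebesgue :: real measure))"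
  proof (rule integral_dominated_convergence[where w = "\<lambda>s. \<bar>f0 s\<bar>"])
    show "AE s in lebesgue. (\<lambda>n. h n s) \<longlonglongrightarrow> 0"
    proof (rule AE_I2)
      fix s
      obtain n0 :: nat where "\<bar>f0 s\<bar> \<le> real n0" using real_arch_simple by blast
      then have "\<forall>n\<ge>n0. h n s = 0" by (auto simp: h_def min_def)
      then show "(\<lambda>n. h n s) \<longlonglongrightarrow> 0"
        by (intro tendsto_eventually) (auto simp: eventually_sequentially)
    qed
  qed (use f0 h0 in auto)
  then have "eventually (\<lambda>n. (\<integral>s. h n s \<partial>lebesgue) < e / 2) sequentially"
    using e by (intro order_tendstoD(2)[of _ 0]) auto
  then obtain n where n: "(\<integral>s. h n s \<partial>lebesgue) < e / 2"
    by (auto simp: eventually_sequentially)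
  define d where "d = e / (2 * (real n + 1))"
  have d: "d > 0" "real n * d < e / 2" using e by (auto simp: d_def field_simps)
  have "(\<Sum>(p, q)\<in>D. \<bar>F q - F p\<bar>) < e"
    if D: "finite D" "\<forall>(p, q)\<in>D. a \<le> p \<and> p \<le> q \<and> q \<le> b"
        "disjoint_family_on (\<lambda>(p, q). {p<..<q}) D" "(\<Sum>(p, q)\<in>D. q - p) < d" for D
  proof -
    let ?I = "\<lambda>i s. indicat_real ((\<lambda>(p, q). {p<..<q}) i) s"
    have indI: "integrable lebesgue (?I i)" if "i \<in> D" for i
      using D(2) that by (auto intro!: integrable_real_indicator simp: split_beta)
    have hi: "integrable lebesgue (\<lambda>s. ?I i s * h n s)" for i
      using integrable_mult_indicator[OF _ hint[of n], of "(\<lambda>(p, q). {p<..<q}) i"] by (simp add: split_beta)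
    have "(\<Sum>(p, q)\<in>D. \<bar>F q - F p\<bar>) \<le> (\<Sum>i\<in>D. \<integral>s. ?I i s * \<bar>f0 s\<bar> \<partial>lebesgue)"
      using D(2) diff by (intro sum_mono) auto
    also have "\<dots> \<le> (\<Sum>i\<in>D. \<integral>s. ?I i s * h n s + real n * ?I i s \<partial>lebesgue)"
    proof (intro sum_mono integral_mono)
      fix i assume "i \<in> D"
      show "integrable lebesgue (\<lambda>s. ?I i s * \<bar>f0 s\<bar>)"
        using integrable_mult_indicator[OF _ integrable_abs[OF f0], of "(\<lambda>(p, q). {p<..<q}) i"]
        by (simp add: split_beta)
      show "integrable lebesgue (\<lambda>s. ?I i s * h n s + real n * ?I i s)"
        using hi indI[OF \<open>i \<in> D\<close>] by auto
      show "?I i s * \<bar>f0 s\<bar> \<le> ?I i s * h n s + real n * ?I i s" for s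
        by (auto simp: h_def indicator_def)
    qed
    also have "\<dots> = (\<Sum>i\<in>D. \<integral>s. ?I i s * h n s \<partial>lebesgue) + real n * (\<Sum>i\<in>D. \<integral>s. ?I i s \<partial>lebesgue)"
      using hi indI by (simp add: sum.distrib sum_distrib_left)
    also have "(\<Sum>i\<in>D. \<integral>s. ?I i s \<partial>lebesgue) = (\<Sum>(p, q)\<in>D. q - p)"
      using D(2) by (intro sum.cong) auto
    also have "(\<Sum>i\<in>D. \<integral>s. ?I i s * h n s \<partial>lebesgue) = (\<integral>s. (\<Sum>i\<in>D. ?I i s * h n s) \<partial>lebesgue)"
      using hi by (simp add: Bochner_Integration.integral_sum)
    also have "\<dots> \<le> (\<integral>s. h n s \<partial>lebesgue)"
    proof (rule integral_mono)
      fix s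
      have "(\<Sum>i\<in>D. ?I i s) = indicator (\<Union>i\<in>D. (\<lambda>(p, q). {p<..<q}) i) s"
        by (subst indicator_UN_disjoint[OF D(1,3)]) simp
      also have "\<dots> \<le> (1::real)" by (simp add: indicator_def)
      finally show "(\<Sum>i\<in>D. ?I i s * h n s) \<le> h n s"
        unfolding sum_distrib_right[symmetric] using h0(1)[of n s] by (simp add: mult_left_le_one_le sum_nonneg)
    qed (use hi hint in auto)
    also have "(\<integral>s. h n s \<partial>lebesgue) + real n * (\<Sum>(p, q)\<in>D. q - p) < e / 2 + e / 2"
      using n d(2) mult_left_mono[OF less_imp_le[OF D(4)], of "real n"] by linarith
    finally show ?thesis by simp
  qed
  then show "\<exists>d>0. \<forall>D. finite D \<and> (\<forall>(p, q)\<in>D. a \<le> p \<and> p \<le> q \<and> q \<le> b) \<and>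
      disjoint_family_on (\<lambda>(p, q). {p<..<q}) D \<and> (\<Sum>(p, q)\<in>D. q - p) < d \<longrightarrow>
      (\<Sum>(p, q)\<in>D. \<bar>(\<integral>s. f s \<partial>lebesgue_on {a..q}) - (\<integral>s. f s \<partial>lebesgue_on {a..p})\<bar>) < e"
    using d(1) unfolding F_def by blast
qed

section \<open>Weak solutions of \<open>- \<partial>\<^sup>2x = y\<close>\<close>

lemma inner_abs_L2:
  assumes "square_integrable f" "square_integrable g"
  shows "inner (abs_L2 f) (abs_L2 g) = (\<integral>s. f s * g s \<partial>lebesgue)"
  using assms by (intro inner_L2.abs_eq) (auto simp: L2_eq_def eq_onp_def)

lemma L2_eqI:
  assumes "AE s in lebesgue. rep_L2 x s = rep_L2 y s"
  shows "x = y"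
  using abs_L2_eq_iff[OF square_integrable_rep[of x] square_integrable_rep[of y]] assms by simp

lemma integrable_square_integrable:
  assumes "square_integrable f" "S \<in> lmeasurable"
  shows "integrable (lebesgue_on S) f"
proof -
  have "integrable lebesgue (\<lambda>s. indicator S s * f s)"
    using square_integrable_mult[OF square_integrable_indicator[OF assms(2)] assms(1)] .
  then show ?thesis
    using assms(2) integrable_restrict_space[of S lebesgue f] by (simp add: fmeasurableD)
qed

lemma square_integrable_restrict:
  assumes "S \<in> sets lebesgue" "f \<in> borel_measurable (lebesgue_on S)"
    "integrable (lebesgue_on S) (\<lambda>s. (f s)\<^sup>2)"
  shows "square_integrable (\<lambda>s. if s \<in> S then f s else 0)"
proof -
  have "(\<lambda>s. if s \<in> S then f s else 0) \<in> borel_measurable lebesgue"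
    using borel_measurable_if_I[OF assms(2,1)] .
  moreover have "(if s \<in> S then f s else 0)\<^sup>2 = (if s \<in> S then (f s)\<^sup>2 else 0)" for s
    by simp
  ultimately show ?thesis
    using assms Lebesgue_Measure.integrable_restrict_UNIV[OF assms(1), of "\<lambda>s. (f s)\<^sup>2"]
    by (simp add: square_integrable_def)
qed

definition emb :: "real \<Rightarrow> (real \<Rightarrow> real) \<Rightarrow> L2" where
  "emb L g = abs_L2 (\<lambda>s. if s \<in> {0<..<L} then g s else 0)"

lemma square_integrable_continuous:
  fixes g :: "real \<Rightarrow> real"
  assumes "continuous_on {0..L} g"
  shows "square_integrable (\<lambda>s. if s \<in> {0<..<L} then g s else 0)"
proof (rule square_integrable_restrict)
  show "g \<in> borel_measurable (lebesgue_on {0<..<L})"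
    by (intro continuous_imp_measurable_on_sets_lebesgue continuous_on_subset[OF assms]) auto
  have "integrable (leb L) (\<lambda>s. (g s)\<^sup>2)"
    using assms by (intro continuous_imp_integrable_real continuous_intros)
  then have "set_integrable lebesgue {0..L} (\<lambda>s. (g s)\<^sup>2)"
    by (simp add: set_integrable_def integrable_restrict_space)
  then have "set_integrable lebesgue {0<..<L} (\<lambda>s. (g s)\<^sup>2)"
    by (rule set_integrable_subset) auto
  then show "integrable (lebesgue_on {0<..<L}) (\<lambda>s. (g s)\<^sup>2)"
    by (simp add: set_integrable_def integrable_restrict_space)
qed simp

lemma AE_lebesgue_not_eq: "AE s in lebesgue. s \<noteq> (c :: real)"
  by (rule AE_I[where N = "{c}"]) auto

lemma integral_lebesgue_on_point:
  fixes f :: "real \<Rightarrow> 'a :: {banach, second_countable_topology}"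
  shows "(\<integral>s. f s \<partial>lebesgue_on {a..a}) = 0"
proof -
  have "(\<integral>s. f s \<partial>lebesgue_on {a..a}) = (\<integral>s. indicator {a..a} s *\<^sub>R f s \<partial>lebesgue)"
    by (rule integral_restrict_space) simp
  also have "\<dots> = 0"
    by (rule integral_eq_zero_AE, use AE_lebesgue_not_eq[of a] in eventually_elim) (simp add: indicator_def)
  finally show ?thesis .
qed

lemma AE_lebesgue_on_iff:
  assumes "S \<in> sets lebesgue"
  shows "(AE s in lebesgue_on S. P s) \<longleftrightarrow> (AE s in lebesgue. s \<in> S \<longrightarrow> P s)"
  using assms by (subst AE_restrict_space_iff) auto

lemma AE_lebesgue_on_Ioo:
  "(AE s in lebesgue_on {0<..<L :: real}. P s) \<longleftrightarrow> (AE s in lebesgue. 0 < s \<and> s < L \<longrightarrow> P s)"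
  by (subst AE_lebesgue_on_iff) auto

lemma rep_emb:
  assumes "continuous_on {0..L} g"
  shows "AE s in lebesgue. rep_L2 (emb L g) s = (if s \<in> {0<..<L} then g s else 0)"
  unfolding emb_def by (rule rep_abs_L2[OF square_integrable_continuous[OF assms]])

lemma emb_in_space_X:
  assumes "continuous_on {0..L} g"
  shows "emb L g \<in> space_X L"
  using rep_emb[OF assms] unfolding space_X_def by (auto elim: AE_mp)

lemma integrable_rep_mult:
  assumes "continuous_on {0..L} g"
  shows "integrable (leb L) (\<lambda>s. rep_L2 x s * g s)"
proof -
  have g: "g \<in> borel_measurable (leb L)"
    using assms by (intro continuous_imp_measurable_on_sets_lebesgue) auto
  have "integrable (leb L) (\<lambda>s. (g s)\<^sup>2)"
    using assms by (intro continuous_imp_integrable_real continuous_intros)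
  from square_integrable_restrict[OF _ g this]
  have "integrable lebesgue (\<lambda>s. rep_L2 x s * (if s \<in> {0..L} then g s else 0))"
    by (intro square_integrable_mult square_integrable_rep) simp
  also have "(\<lambda>s. rep_L2 x s * (if s \<in> {0..L} then g s else 0)) =
      (\<lambda>s. if s \<in> {0..L} then rep_L2 x s * g s else 0)" by auto
  finally show ?thesis
    by (subst (asm) Lebesgue_Measure.integrable_restrict_UNIV) auto
qed

lemma inner_emb:
  assumes "continuous_on {0..L} g"
  shows "inner x (emb L g) = (\<integral>s. rep_L2 x s * g s \<partial>leb L)"
proof -
  have "inner x (emb L g) = (\<integral>s. rep_L2 x s * (if s \<in> {0<..<L} then g s else 0) \<partial>lebesgue)"
    unfolding emb_def
    using inner_abs_L2[OF square_integrable_rep[of x] square_integrable_continuous[OF assms]] by simp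
  also have "\<dots> = (\<integral>s. indicator {0..L} s *\<^sub>R (rep_L2 x s * g s) \<partial>lebesgue)"
  proof (rule integral_cong_AE)
    show "(\<lambda>s. rep_L2 x s * (if s \<in> {0<..<L} then g s else 0)) \<in> borel_measurable lebesgue"
      using square_integrable_continuous[OF assms]
      by (intro borel_measurable_times rep_L2_measurable) (simp add: square_integrable_def)
    have "integrable lebesgue (\<lambda>s. indicator {0..L} s *\<^sub>R (rep_L2 x s * g s))"
      using integrable_rep_mult[OF assms, of x] by (simp add: integrable_restrict_space)
    then show "(\<lambda>s. indicator {0..L} s *\<^sub>R (rep_L2 x s * g s)) \<in> borel_measurable lebesgue"
      by (rule borel_measurable_integrable)
    show "AE s in lebesgue. rep_L2 x s * (if s \<in> {0<..<L} then g s else 0) =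
        indicator {0..L} s *\<^sub>R (rep_L2 x s * g s)"
      using AE_lebesgue_not_eq[of 0] AE_lebesgue_not_eq[of L]
      by eventually_elim (auto simp: indicator_def)
  qed
  also have "\<dots> = (\<integral>s. rep_L2 x s * g s \<partial>leb L)"
    by (subst integral_restrict_space) auto
  finally show ?thesis .
qed

lemma space_X_zero_outside:
  assumes "x \<in> space_X L"
  shows "AE s in lebesgue. s \<notin> {0<..<L} \<longrightarrow> rep_L2 x s = 0"
  using assms by (simp add: space_X_def)

lemma AE_lebesgue_iff_negligible: "(AE s in lebesgue. P s) \<longleftrightarrow> negligible {s. \<not> P s}"
  unfolding eventually_ae_filter negligible_iff_null_sets
  by (auto intro: null_sets_completion_subset)

text \<open>By continuity a disagreement would persist on a nonempty open set, and such a set is not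
  negligible.\<close>

lemma continuous_AE_eq:
  fixes f g :: "real \<Rightarrow> real"
  assumes "continuous_on {0..L} f" "continuous_on {0..L} g"
    and ae: "AE s in lebesgue_on {0<..<L}. f s = g s" and s: "s \<in> {0<..<L}"
  shows "f s = g s"
proof (rule ccontr)
  assume ne: "f s \<noteq> g s"
  define S where "S = {0<..<L} \<inter> (\<lambda>s. f s - g s) -` (- {0})"
  have "continuous_on {0<..<L} (\<lambda>s. f s - g s)"
    using assms(1,2) by (intro continuous_intros) (auto elim: continuous_on_subset)
  then have "open S"
    unfolding S_def by (rule continuous_open_preimage) auto
  moreover have "S \<noteq> {}" using ne s by (auto simp: S_def)
  moreover have "negligible S"
    using ae unfolding AE_lebesgue_on_Ioo AE_lebesgue_iff_negligible
    by (rule negligible_subset) (auto simp: S_def)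
  ultimately show False using open_not_negligible by blast
qed

text \<open>Two integrations by parts in one stroke: \<open>F = v sin - u (sin)'\<close> has
  derivative \<open>k^2 u sin - y sin\<close> almost everywhere, and it vanishes at both ends
  because \<open>u\<close> and the sine do.\<close>

lemma neg_second_derivative_inner_sin:
  fixes n :: nat
  assumes L: "L > 0" and xy: "neg_second_derivative L x y"
  defines "k \<equiv> real n * pi / L"
  shows "inner y (emb L (\<lambda>s. sin (k * s))) = k\<^sup>2 * inner x (emb L (\<lambda>s. sin (k * s)))"
proof -
  obtain u v where uv: "AE s in lebesgue_on {0<..<L}. rep_L2 x s = u s"
    "abs_continuous_on 0 L u" "ae_derivative L u v"
    "abs_continuous_on 0 L v" "ae_derivative L v (\<lambda>s. - rep_L2 y s)" "u 0 = 0" "u L = 0"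
    using xy unfolding neg_second_derivative_def by blast
  define N where "N = {s. \<not> (s \<in> {0<..<L} \<longrightarrow> (u has_real_derivative v s) (at s))} \<union>
    {s. \<not> (s \<in> {0<..<L} \<longrightarrow> (v has_real_derivative - rep_L2 y s) (at s))} \<union> {0, L}"
  have N: "negligible N"
    unfolding N_def using uv(3,5) unfolding ae_derivative_def
      AE_lebesgue_on_Ioo AE_lebesgue_iff_negligible by (intro negligible_Un) auto
  define F where "F s = v s * sin (k * s) + - (u s * (k * cos (k * s)))" for s
  let ?h = "\<lambda>s. k\<^sup>2 * (rep_L2 x s * sin (k * s)) - rep_L2 y s * sin (k * s)"
  let ?g = "\<lambda>s. k\<^sup>2 * (u s * sin (k * s)) - rep_L2 y s * sin (k * s)"
  have "abs_continuous_on 0 L F"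
    unfolding F_def[abs_def]
    by (intro abs_continuous_on_add abs_continuous_on_uminus abs_continuous_on_mult uv
        abs_continuous_on_C1[where f' = "\<lambda>s. k * cos (k * s)"]
        abs_continuous_on_C1[where f' = "\<lambda>s. - (k * (k * sin (k * s)))"])
       (auto intro!: derivative_eq_intros continuous_intros)
  then have "(?g has_integral (F L - F 0)) {0..L}"
  proof (rule abs_continuous_has_integral[rotated, OF _ N])
    fix s assume "s \<in> {0..L} - N"
    then have "(u has_real_derivative v s) (at s)" "(v has_real_derivative - rep_L2 y s) (at s)"
      by (auto simp: N_def)
    then have "(F has_real_derivative ?g s) (at s)"
      unfolding F_def[abs_def]
      by (auto intro!: derivative_eq_intros simp: algebra_simps power2_eq_square)
    then show "(F has_real_derivative ?g s) (at s within {0..L})"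
      by (rule has_field_derivative_at_within)
  qed (use L in simp)
  moreover have "sin (k * L) = 0" using L by (simp add: k_def)
  ultimately have "(?g has_integral 0) {0..L}"
    using uv by (simp add: F_def)
  then have 1: "(?h has_integral 0) {0..L}"
  proof (rule has_integral_spike[rotated 2])
    show "negligible ({s. \<not> (s \<in> {0<..<L} \<longrightarrow> rep_L2 x s = u s)} \<union> {0, L})"
      using uv(1) unfolding AE_lebesgue_on_Ioo AE_lebesgue_iff_negligible
      by (intro negligible_Un) auto
  qed auto
  have c: "continuous_on {0..L} (\<lambda>s. sin (k * s))" by (intro continuous_intros)
  have i: "integrable (leb L) (\<lambda>s. k\<^sup>2 * (rep_L2 x s * sin (k * s)))"
    "integrable (leb L) (\<lambda>s. rep_L2 y s * sin (k * s))"
    using integrable_rep_mult[OF c] by auto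
  have "(?h has_integral
      integral\<^sup>L (leb L) ?h) {0..L}"
    using i by (intro has_integral_integral_lebesgue_on) auto
  with 1 have "integral\<^sup>L (leb L) ?h = 0"
    using has_integral_unique by blast
  then show ?thesis
    using i by (simp add: inner_emb[OF c])
qed

text \<open>Makes \<open>op_A\<close> single-valued. Comparing derivatives at a point needs equality
  near that point, so at each stage, from \<open>x\<close> to \<open>u\<close> and from
  \<open>u\<close> to \<open>v\<close>, continuity upgrades equality almost everywhere to equality
  on the open interval.\<close>

lemma neg_second_derivative_unique:
  assumes "neg_second_derivative L x y" "neg_second_derivative L x y'"
  shows "y = y'"
proof -
  obtain u v where uv: "AE s in lebesgue_on {0<..<L}. rep_L2 x s = u s"
    "abs_continuous_on 0 L u" "ae_derivative L u v"
    "abs_continuous_on 0 L v" "ae_derivative L v (\<lambda>s. - rep_L2 y s)"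
    using assms(1) unfolding neg_second_derivative_def by blast
  obtain u' v' where uv': "AE s in lebesgue_on {0<..<L}. rep_L2 x s = u' s"
    "abs_continuous_on 0 L u'" "ae_derivative L u' v'"
    "abs_continuous_on 0 L v'" "ae_derivative L v' (\<lambda>s. - rep_L2 y' s)"
    using assms(2) unfolding neg_second_derivative_def by blast
  have deriv_eq: "AE s in lebesgue_on {0<..<L}. w s = w' s"
    if w: "ae_derivative L f w" "ae_derivative L f' w'" and eq: "\<And>s. s \<in> {0<..<L} \<Longrightarrow> f s = f' s" for f f' w w'
  proof -
    have "AE s in lebesgue_on {0<..<L}. s \<in> {0<..<L}" by (intro AE_I2) simp
    with w show ?thesis unfolding ae_derivative_def
    proof eventually_elim
      case (elim s)
      have "eventually (\<lambda>s. f s = f' s) (nhds s)"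
        using elim(3) eq by (intro eventually_nhds_in_open[THEN eventually_mono, of "{0<..<L}"]) auto
      then have "(f has_real_derivative w' s) (at s)"
        using elim(2) by (simp add: DERIV_cong_ev)
      with elim(1) show ?case by (rule DERIV_unique)
    qed
  qed
  have "AE s in lebesgue_on {0<..<L}. u s = u' s"
    using uv(1) uv'(1) by eventually_elim simp
  then have "\<And>s. s \<in> {0<..<L} \<Longrightarrow> u s = u' s"
    using uv(2) uv'(2) by (intro continuous_AE_eq[of L u u']) (auto intro: abs_continuous_on_imp_continuous_on)
  then have "AE s in lebesgue_on {0<..<L}. v s = v' s"
    using uv(3) uv'(3) deriv_eq by blast
  then have "\<And>s. s \<in> {0<..<L} \<Longrightarrow> v s = v' s"
    using uv(4) uv'(4) by (intro continuous_AE_eq[of L v v']) (auto intro: abs_continuous_on_imp_continuous_on)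
  then have "AE s in lebesgue_on {0<..<L}. - rep_L2 y s = - rep_L2 y' s"
    using uv(5) uv'(5) deriv_eq by blast
  then have "AE s in lebesgue. s \<in> {0<..<L} \<longrightarrow> rep_L2 y s = rep_L2 y' s"
    by (simp add: AE_lebesgue_on_iff)
  moreover have "y \<in> space_X L" "y' \<in> space_X L"
    using assms by (auto simp: neg_second_derivative_def)
  note this[THEN space_X_zero_outside]
  ultimately have "AE s in lebesgue. rep_L2 y s = rep_L2 y' s"
    by eventually_elim metis
  then show ?thesis by (rule L2_eqI)
qed

text \<open>Two indefinite integrals solve the equation with value 0 at the left end; a linear
  correction, invisible to the second derivative, restores the value 0 at \<open>L\<close>. This
  surjectivity later fixes the domain of \<open>op_A\<close>.\<close>

lemma neg_second_derivative_exists: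
  assumes L: "L > 0" and y: "y \<in> space_X L"
  shows "\<exists>x. neg_second_derivative L x y"
proof -
  have iy: "integrable (leb L) (\<lambda>s. - rep_L2 y s)"
    using integrable_square_integrable[OF square_integrable_rep, of "{0..L}" y] by simp
  define v0 where "v0 x = (\<integral>s. - rep_L2 y s \<partial>leb x)" for x
  have acv0: "abs_continuous_on 0 L v0"
    unfolding v0_def[abs_def] by (rule abs_continuous_on_indefinite_integral[OF iy])
  have iv: "integrable (leb L) v0"
    using abs_continuous_on_imp_continuous_on[OF acv0] by (rule continuous_imp_integrable_real)
  define u0 where "u0 x = (\<integral>s. v0 s \<partial>leb x)" for x
  have acu0: "abs_continuous_on 0 L u0"
    unfolding u0_def[abs_def] by (rule abs_continuous_on_indefinite_integral[OF iv])
  define c where "c = - u0 L / L"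
  define u where "u s = u0 s + c * s" for s
  define v where "v s = v0 s + c" for s
  obtain N1 where N1: "negligible N1" "\<And>s. s \<in> {0<..<L} - N1 \<Longrightarrow> (v0 has_real_derivative - rep_L2 y s) (at s)"
    using indefinite_integral_ae_derivative[OF iy] unfolding v0_def[abs_def] by blast
  obtain N2 where N2: "negligible N2" "\<And>s. s \<in> {0<..<L} - N2 \<Longrightarrow> (u0 has_real_derivative v0 s) (at s)"
    using indefinite_integral_ae_derivative[OF iv] unfolding u0_def[abs_def] by blast
  have "(v has_real_derivative - rep_L2 y s) (at s)" if "s \<in> {0<..<L} - N1" for s
    unfolding v_def[abs_def] using N1(2)[OF that] by (auto intro!: derivative_eq_intros)
  then have dv: "ae_derivative L v (\<lambda>s. - rep_L2 y s)"
    unfolding ae_derivative_def AE_lebesgue_on_Ioo AE_lebesgue_iff_negligible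
    by (intro negligible_subset[OF N1(1)]) auto
  have "(u has_real_derivative v s) (at s)" if "s \<in> {0<..<L} - N2" for s
    unfolding u_def[abs_def] v_def using N2(2)[OF that] by (auto intro!: derivative_eq_intros)
  then have du: "ae_derivative L u v"
    unfolding ae_derivative_def AE_lebesgue_on_Ioo AE_lebesgue_iff_negligible
    by (intro negligible_subset[OF N2(1)]) auto
  have acu: "abs_continuous_on 0 L u" unfolding u_def[abs_def]
    by (intro abs_continuous_on_add acu0 abs_continuous_on_mult abs_continuous_on_const abs_continuous_on_id)
  have acv: "abs_continuous_on 0 L v" unfolding v_def[abs_def]
    by (intro abs_continuous_on_add acv0 abs_continuous_on_const)
  have "u0 0 = 0"
    unfolding u0_def by (rule integral_lebesgue_on_point)
  then have "u 0 = 0" "u L = 0" using L by (auto simp: u_def c_def)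
  note cu = abs_continuous_on_imp_continuous_on[OF acu]
  have "AE s in lebesgue_on {0<..<L}. rep_L2 (emb L u) s = u s"
    unfolding AE_lebesgue_on_Ioo using rep_emb[OF cu] by (auto elim: AE_mp)
  then have "neg_second_derivative L (emb L u) y"
    unfolding neg_second_derivative_def
    using emb_in_space_X[OF cu] y acu du acv dv \<open>u 0 = 0\<close> \<open>u L = 0\<close> by blast
  then show ?thesis ..
qed

lemma op_A_eq_Some_iff: "op_A L x = Some y \<longleftrightarrow> neg_second_derivative L x y"
  unfolding op_A_def using neg_second_derivative_unique[of L x]
  by (auto intro: the_equality[symmetric] theI2)

section \<open>Diagonal operators in a Hilbert basis\<close>

text \<open>Completeness and totality are encoded as Riesz-Fischer and Parseval, that is, purely in
  coordinates. Thus no topology on \<open>V\<close> is presupposed, and the same theory covers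
  \<open>space_X\<close> and \<open>space_half\<close>, whose inner products differ on one
  type.\<close>

locale hilbert_basis =
  fixes V :: "'a::real_vector set" and ip :: "'a \<Rightarrow> 'a \<Rightarrow> real" and e :: "nat \<Rightarrow> 'a"
  assumes subspace_V: "subspace V"
    and ip_commute: "x \<in> V \<Longrightarrow> y \<in> V \<Longrightarrow> ip x y = ip y x"
    and ip_add: "x \<in> V \<Longrightarrow> y \<in> V \<Longrightarrow> z \<in> V \<Longrightarrow> ip (x + y) z = ip x z + ip y z"
    and ip_scaleR: "x \<in> V \<Longrightarrow> y \<in> V \<Longrightarrow> ip (r *\<^sub>R x) y = r * ip x y"
    and basis_in: "e k \<in> V"
    and orthonormal: "ip (e j) (e k) = (if j = k then 1 else 0)"
    and definite: "x \<in> V \<Longrightarrow> ip x x = 0 \<Longrightarrow> x = 0"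
    and parseval: "x \<in> V \<Longrightarrow> (\<lambda>k. (ip x (e k))\<^sup>2) sums ip x x"
    and riesz_fischer: "summable (\<lambda>k. (a k)\<^sup>2) \<Longrightarrow> \<exists>x\<in>V. \<forall>k. ip x (e k) = a k"
begin

abbreviation coord :: "'a \<Rightarrow> nat \<Rightarrow> real" where
  "coord x k \<equiv> ip x (e k)"

abbreviation (input) sq :: "'a \<Rightarrow> real" where
  "sq x \<equiv> ip x x"

abbreviation (input) psum :: "'a \<Rightarrow> nat \<Rightarrow> 'a" where
  "psum x n \<equiv> \<Sum>k<n. coord x k *\<^sub>R e k"

lemma V_closed [simp]:
  "0 \<in> V" "x \<in> V \<Longrightarrow> y \<in> V \<Longrightarrow> x + y \<in> V" "x \<in> V \<Longrightarrow> y \<in> V \<Longrightarrow> x - y \<in> V" "x \<in> V \<Longrightarrow> r *\<^sub>R x \<in> V"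
  using subspace_V by (auto simp: subspace_0 subspace_add subspace_diff subspace_scale)

declare basis_in [simp]

lemma ip_diff: "x \<in> V \<Longrightarrow> y \<in> V \<Longrightarrow> z \<in> V \<Longrightarrow> ip (x - y) z = ip x z - ip y z"
  using ip_add[of x "(-1) *\<^sub>R y" z] ip_scaleR[of y z "-1"] V_closed(4)[of y "-1"] by simp

lemma ip_0 [simp]: "x \<in> V \<Longrightarrow> ip 0 x = 0"
  using ip_scaleR[of 0 x 0] by simp

lemma ip_right:
  assumes "x \<in> V" "y \<in> V" "z \<in> V"
  shows "ip x (y + z) = ip x y + ip x z" "ip x (y - z) = ip x y - ip x z" "ip x (r *\<^sub>R y) = r * ip x y"
  using assms by (simp_all add: ip_commute[of x] ip_add ip_diff ip_scaleR)

lemma ip_nonneg: "x \<in> V \<Longrightarrow> 0 \<le> ip x x"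
  using parseval[of x] sums_le[of "\<lambda>_. 0" "\<lambda>k. (coord x k)\<^sup>2"] by auto

lemma coord_eqI:
  assumes "x \<in> V" "y \<in> V" "\<And>k. coord x k = coord y k"
  shows "x = y"
proof -
  have "(\<lambda>k. (coord (x - y) k)\<^sup>2) sums ip (x - y) (x - y)"
    using assms by (intro parseval) auto
  moreover have "(\<lambda>k. (coord (x - y) k)\<^sup>2) = (\<lambda>_. 0)"
    using assms by (simp add: ip_diff)
  ultimately have "ip (x - y) (x - y) = 0"
    using sums_unique2[OF _ sums_zero] by metis
  then have "x - y = 0" using assms by (intro definite) auto
  then show ?thesis by simp
qed

lemma parseval_ip:
  assumes "x \<in> V" "y \<in> V"
  shows "(\<lambda>k. coord x k * coord y k) sums ip x y"
proof -
  have "(\<lambda>k. ((coord (x + y) k)\<^sup>2 - (coord (x - y) k)\<^sup>2) / 4) sums ((ip (x + y) (x + y) - ip (x - y) (x - y)) / 4)"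
    using assms by (intro sums_divide sums_diff parseval) auto
  also have "(\<lambda>k. ((coord (x + y) k)\<^sup>2 - (coord (x - y) k)\<^sup>2) / 4) = (\<lambda>k. coord x k * coord y k)"
    using assms by (simp add: ip_add ip_diff power2_eq_square algebra_simps)
  also have "(ip (x + y) (x + y) - ip (x - y) (x - y)) / 4 = ip x y"
    using assms ip_commute[of y x] by (simp add: ip_add ip_diff ip_right)
  finally show ?thesis .
qed

lemma coord_summable: "x \<in> V \<Longrightarrow> summable (\<lambda>k. (coord x k)\<^sup>2)"
  using parseval sums_summable by blast

lemma coord_sq_le:
  assumes "x \<in> V"
  shows "(coord x k)\<^sup>2 \<le> ip x x"
  using sum_le_suminf[OF coord_summable[OF assms], of "{k}"] sums_unique[OF parseval[OF assms]] by simp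

definition vec :: "(nat \<Rightarrow> real) \<Rightarrow> 'a" where
  "vec a = (THE x. x \<in> V \<and> (\<forall>k. coord x k = a k))"

lemma vec:
  assumes "summable (\<lambda>k. (a k)\<^sup>2)"
  shows "vec a \<in> V" "coord (vec a) k = a k"
proof -
  obtain x where "x \<in> V" "\<forall>k. coord x k = a k" using riesz_fischer[OF assms] by blast
  then have "vec a = x"
    unfolding vec_def by (intro the_equality) (auto intro!: coord_eqI)
  then show "vec a \<in> V" "coord (vec a) k = a k" using \<open>x \<in> V\<close> \<open>\<forall>k. coord x k = a k\<close> by auto
qed

lemma coord_sum:
  "(\<Sum>k<n. a k *\<^sub>R e k) \<in> V \<and> coord (\<Sum>k<n. a k *\<^sub>R e k) j = (if j < n then a j else 0)"
  by (induction n) (auto simp: ip_add ip_scaleR orthonormal less_Suc_eq)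

lemma partial_sum_residual:
  assumes "x \<in> V"
  shows "sq (psum x n - x) = sq x - (\<Sum>k<n. (coord x k)\<^sup>2)"
proof -
  let ?s = "\<Sum>k<n. coord x k *\<^sub>R e k"
  have s: "?s \<in> V" using coord_sum[where a = "coord x"] by blast
  have "(\<lambda>k. (coord x k)\<^sup>2 - (if k \<in> {..<n} then (coord x k)\<^sup>2 else 0)) sums (sq x - (\<Sum>k<n. (coord x k)\<^sup>2))"
    by (intro sums_diff parseval assms sums_If_finite_set) auto
  moreover have "(\<lambda>k. (coord x k)\<^sup>2 - (if k \<in> {..<n} then (coord x k)\<^sup>2 else 0)) = (\<lambda>k. (coord (?s - x) k)\<^sup>2)"
    using coord_sum[where a = "coord x"] s assms by (auto simp: ip_diff)
  ultimately have "(\<lambda>k. (coord (?s - x) k)\<^sup>2) sums (sq x - (\<Sum>k<n. (coord x k)\<^sup>2))" by simp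
  then show ?thesis
    using parseval[of "?s - x"] s assms sums_unique2 V_closed(3) by blast
qed

lemma partial_sum_tendsto:
  assumes "x \<in> V"
  shows "(\<lambda>n. sq (psum x n - x)) \<longlonglongrightarrow> 0"
proof -
  have "(\<lambda>n. sq x - (\<Sum>k<n. (coord x k)\<^sup>2)) \<longlonglongrightarrow> ip x x - ip x x"
    using parseval[OF assms] unfolding sums_def by (intro tendsto_intros)
  then show ?thesis by (simp add: partial_sum_residual[OF assms])
qed

text \<open>The domain is maximal: every vector whose scaled coordinates are square-summable. This
  is what makes the operator self-adjoint and not merely symmetric when \<open>\<tau>\<close> is
  unbounded.\<close>

definition diag :: "(nat \<Rightarrow> real) \<Rightarrow> ('a \<rightharpoonup> 'a)" where
  "diag \<tau> x = (if x \<in> V \<and> summable (\<lambda>k. (\<tau> k * coord x k)\<^sup>2)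
     then Some (vec (\<lambda>k. \<tau> k * coord x k)) else None)"

lemma diag_eq_Some_iff:
  "diag \<tau> x = Some y \<longleftrightarrow> x \<in> V \<and> y \<in> V \<and> (\<forall>k. coord y k = \<tau> k * coord x k)"
proof
  assume "diag \<tau> x = Some y"
  then show "x \<in> V \<and> y \<in> V \<and> (\<forall>k. coord y k = \<tau> k * coord x k)"
    unfolding diag_def using vec by (auto split: if_splits)
next
  assume *: "x \<in> V \<and> y \<in> V \<and> (\<forall>k. coord y k = \<tau> k * coord x k)"
  then have s: "summable (\<lambda>k. (\<tau> k * coord x k)\<^sup>2)"
    using coord_summable[of y] by simp
  then have "vec (\<lambda>k. \<tau> k * coord x k) = y"
    using * vec[OF s] by (intro coord_eqI) auto
  then show "diag \<tau> x = Some y" using * s by (simp add: diag_def)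
qed

lemma dom_diag: "x \<in> dom (diag \<tau>) \<longleftrightarrow> x \<in> V \<and> summable (\<lambda>k. (\<tau> k * coord x k)\<^sup>2)"
  by (auto simp: diag_def dom_def)

lemma the_diag:
  assumes "x \<in> dom (diag \<tau>)"
  shows "the (diag \<tau> x) \<in> V" "coord (the (diag \<tau> x)) k = \<tau> k * coord x k"
  using assms diag_eq_Some_iff[of \<tau> x "the (diag \<tau> x)"] by auto

lemma summable_square_add:
  fixes a b :: "nat \<Rightarrow> real"
  assumes "summable (\<lambda>k. (a k)\<^sup>2)" "summable (\<lambda>k. (b k)\<^sup>2)"
  shows "summable (\<lambda>k. (a k + b k)\<^sup>2)"
proof (rule summable_comparison_test'[where N = 0])
  show "summable (\<lambda>k. 2 * (a k)\<^sup>2 + 2 * (b k)\<^sup>2)"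
    using assms by (intro summable_add summable_mult)
  fix k
  have "(a k + b k)\<^sup>2 \<le> 2 * (a k)\<^sup>2 + 2 * (b k)\<^sup>2"
    using zero_le_power2[of "a k - b k"] by (simp add: power2_eq_square algebra_simps)
  then show "norm ((a k + b k)\<^sup>2) \<le> 2 * (a k)\<^sup>2 + 2 * (b k)\<^sup>2" by simp
qed

lemma linear_op_diag: "linear_op V (diag \<tau>)"
  unfolding linear_op_def
proof (intro conjI ballI allI)
  have add: "x + y \<in> dom (diag \<tau>)" if "x \<in> dom (diag \<tau>)" "y \<in> dom (diag \<tau>)" for x y
    using that summable_square_add[of "\<lambda>k. \<tau> k * coord x k" "\<lambda>k. \<tau> k * coord y k"]
    by (auto simp: dom_diag ip_add distrib_left)
  have scale: "r *\<^sub>R x \<in> dom (diag \<tau>)" if "x \<in> dom (diag \<tau>)" for r x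
  proof -
    have "(\<lambda>k. (\<tau> k * coord (r *\<^sub>R x) k)\<^sup>2) = (\<lambda>k. r\<^sup>2 * (\<tau> k * coord x k)\<^sup>2)"
      using that by (auto simp: dom_diag ip_scaleR power_mult_distrib)
    then show ?thesis using that by (simp add: dom_diag summable_mult)
  qed
  show "subspace (dom (diag \<tau>))"
    by (intro subspaceI add scale) (simp_all add: dom_diag)
  show "dom (diag \<tau>) \<subseteq> V" using dom_diag by blast
  show "ran (diag \<tau>) \<subseteq> V" by (auto simp: ran_def diag_eq_Some_iff)
  fix x y a b assume xy: "x \<in> dom (diag \<tau>)" "y \<in> dom (diag \<tau>)"
  then have D: "a *\<^sub>R x + b *\<^sub>R y \<in> dom (diag \<tau>)" by (intro add scale)
  have V: "x \<in> V" "y \<in> V" using xy by (simp_all add: dom_diag)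
  show "the (diag \<tau> (a *\<^sub>R x + b *\<^sub>R y)) = a *\<^sub>R the (diag \<tau> x) + b *\<^sub>R the (diag \<tau> y)"
    using the_diag[OF D] the_diag[OF xy(1)] the_diag[OF xy(2)] V
    by (intro coord_eqI) (simp_all add: ip_add ip_scaleR distrib_left mult_ac)
qed

lemma basis_sum_in_dom: "(\<Sum>k<n. a k *\<^sub>R e k) \<in> dom (diag \<tau>)"
proof -
  have "summable (\<lambda>k. (\<tau> k * (if k < n then a k else 0))\<^sup>2)"
    by (rule summable_finite[of "{..<n}"]) auto
  then show ?thesis using coord_sum[where n = n and a = a] by (auto simp: dom_diag)
qed

lemma diag_basis: "diag \<tau> (e j) = Some (\<tau> j *\<^sub>R e j)"
  by (simp add: diag_eq_Some_iff ip_scaleR orthonormal)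

lemma densely_defined_diag: "densely_defined V ip (diag \<tau>)"
  unfolding densely_defined_def
proof (intro ballI allI impI)
  fix x and d :: real assume x: "x \<in> V" and d: "d > 0"
  have "eventually (\<lambda>n. sq (psum x n - x) < d\<^sup>2) sequentially"
    using d by (intro order_tendstoD(2)[OF partial_sum_tendsto[OF x]]) auto
  then obtain n where n: "sq (psum x n - x) < d\<^sup>2"
    by (auto simp: eventually_sequentially)
  let ?s = "\<Sum>k<n. coord x k *\<^sub>R e k"
  have s: "?s \<in> V" using coord_sum[where a = "coord x"] by blast
  have "ip (x - ?s) (x - ?s) = ip (?s - x) (?s - x)"
    using s x by (simp add: ip_diff ip_right)
  then have "sqrt (ip (x - ?s) (x - ?s)) < d"
    using n d by (metis real_sqrt_less_iff real_sqrt_unique less_imp_le)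
  then show "\<exists>y\<in>dom (diag \<tau>). sqrt (ip (x - y) (x - y)) < d"
    by (intro bexI[of _ ?s] basis_sum_in_dom)
qed

lemma diag_symmetric:
  assumes "diag \<tau> x = Some x'" "diag \<tau> y = Some y'"
  shows "ip x' y = ip x y'"
proof -
  have *: "x \<in> V" "x' \<in> V" "y \<in> V" "y' \<in> V" "\<And>k. coord x' k = \<tau> k * coord x k" "\<And>k. coord y' k = \<tau> k * coord y k"
    using assms by (auto simp: diag_eq_Some_iff)
  have "(\<lambda>k. coord x' k * coord y k) sums ip x' y" "(\<lambda>k. coord x k * coord y' k) sums ip x y'"
    using parseval_ip[OF *(2,3)] parseval_ip[OF *(1,4)] .
  moreover have "(\<lambda>k. coord x' k * coord y k) = (\<lambda>k. coord x k * coord y' k)"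
    using * by (auto simp: mult_ac)
  ultimately show ?thesis using sums_unique2 by metis
qed

text \<open>Testing the adjoint relation on the basis vectors alone already determines every
  coordinate of \<open>z\<close>; the maximal domain then contains \<open>y\<close>.\<close>

lemma self_adjoint_diag: "self_adjoint V ip (diag \<tau>)"
  unfolding self_adjoint_def
proof (intro conjI linear_op_diag densely_defined_diag allI iffI)
  fix y z assume yz: "diag \<tau> y = Some z"
  then show "y \<in> V" "z \<in> V" by (auto simp: diag_eq_Some_iff)
  show "\<forall>x\<in>dom (diag \<tau>). ip (the (diag \<tau> x)) y = ip x z"
    using diag_symmetric[OF _ yz] by auto
next
  fix y z assume *: "y \<in> V \<and> z \<in> V \<and> (\<forall>x\<in>dom (diag \<tau>). ip (the (diag \<tau> x)) y = ip x z)"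
  have "coord z k = \<tau> k * coord y k" for k
  proof -
    have "ip (the (diag \<tau> (e k))) y = ip (e k) z" using * diag_basis[of \<tau> k] by blast
    then show ?thesis using * by (simp add: diag_basis ip_scaleR ip_commute[of "e k"])
  qed
  then show "diag \<tau> y = Some z" using * by (simp add: diag_eq_Some_iff)
qed

lemma positive_op_diag:
  assumes "\<And>k. 0 \<le> \<tau> k"
  shows "positive_op ip (diag \<tau>)"
  unfolding positive_op_def
proof
  fix x assume x: "x \<in> dom (diag \<tau>)"
  note t = the_diag[OF x]
  have xV: "x \<in> V" using x by (simp add: dom_diag)
  have 1: "(\<lambda>k. \<tau> k * coord x k * coord x k) sums ip (the (diag \<tau> x)) x"
    using parseval_ip[OF t(1) xV] by (simp add: t(2))
  have "0 \<le> \<tau> k * coord x k * coord x k" for k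
    using assms[of k] by (simp add: mult.assoc)
  then show "0 \<le> ip (the (diag \<tau> x)) x"
    by (rule sums_le[OF _ sums_zero 1])
qed

lemma diag_comp_diag: "diag \<sigma> \<circ>\<^sub>m diag \<sigma> = diag (\<lambda>k. (\<sigma> k)\<^sup>2)"
proof
  fix x
  have "(diag \<sigma> \<circ>\<^sub>m diag \<sigma>) x = Some z \<longleftrightarrow> diag (\<lambda>k. (\<sigma> k)\<^sup>2) x = Some z" for z
  proof
    assume "(diag \<sigma> \<circ>\<^sub>m diag \<sigma>) x = Some z"
    then show "diag (\<lambda>k. (\<sigma> k)\<^sup>2) x = Some z"
      unfolding map_comp_Some_iff by (auto simp: diag_eq_Some_iff power2_eq_square)
  next
    assume z: "diag (\<lambda>k. (\<sigma> k)\<^sup>2) x = Some z"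
    then have *: "x \<in> V" "z \<in> V" "\<And>k. coord z k = (\<sigma> k)\<^sup>2 * coord x k"
      by (auto simp: diag_eq_Some_iff)
    \<comment> \<open>The domain of the square must be shown to lie in that of the root. Here
      \<open>(\<sigma> k * coord x k)^2\<close> is the product of the coordinates of
      \<open>x\<close> and \<open>z\<close>, two square-summable sequences.\<close>
    have "summable (\<lambda>k. coord x k * coord z k)"
      using parseval_ip[OF *(1,2)] by (rule sums_summable)
    also have "(\<lambda>k. coord x k * coord z k) = (\<lambda>k. (\<sigma> k * coord x k)\<^sup>2)"
      by (simp add: *(3) power2_eq_square mult_ac)
    finally have "x \<in> dom (diag \<sigma>)" using * by (simp add: dom_diag)
    then obtain y where y: "diag \<sigma> x = Some y" by blast
    then have "diag \<sigma> y = Some z" using * by (auto simp: diag_eq_Some_iff power2_eq_square)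
    with y show "(diag \<sigma> \<circ>\<^sub>m diag \<sigma>) x = Some z" by simp
  qed
  then show "(diag \<sigma> \<circ>\<^sub>m diag \<sigma>) x = diag (\<lambda>k. (\<sigma> k)\<^sup>2) x"
    by (metis not_Some_eq)
qed

text \<open>
  On an eigenvector \<open>e\<close> with eigenvalue \<open>\<sigma>\<^sup>2\<close> of the square, \<open>v = S e - \<sigma> e\<close> satisfies \<open>S v = - \<sigma> v\<close>,
  which positivity of \<open>S\<close> excludes unless \<open>v = 0\<close>. Hence any positive square root agrees with the
  diagonal one on the basis, and self-adjointness determines it from there.
\<close>

lemma pos_sqrt_unique:
  assumes S: "self_adjoint V ip S" "positive_op ip S" "S \<circ>\<^sub>m S = diag (\<lambda>k. (\<sigma> k)\<^sup>2)"
    and \<sigma>: "\<And>k. 0 < \<sigma> k"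
  shows "S = diag \<sigma>"
proof -
  have lin: "linear_op V S" using S(1) by (simp add: self_adjoint_def)
  have adj: "S y = Some z \<longleftrightarrow> y \<in> V \<and> z \<in> V \<and> (\<forall>x\<in>dom S. ip (the (S x)) y = ip x z)" for y z
    using S(1) by (simp add: self_adjoint_def)
  have basis: "S (e k) = Some (\<sigma> k *\<^sub>R e k)" for k
  proof -
    have "(S \<circ>\<^sub>m S) (e k) = Some ((\<sigma> k)\<^sup>2 *\<^sub>R e k)" by (simp add: S(3) diag_basis)
    then obtain f where f: "S (e k) = Some f" "S f = Some ((\<sigma> k)\<^sup>2 *\<^sub>R e k)"
      unfolding map_comp_Some_iff by blast
    then have fV: "f \<in> V" using adj by blast
    define v where "v = 1 *\<^sub>R f + (- \<sigma> k) *\<^sub>R e k"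
    have vV: "v \<in> V" unfolding v_def using fV by simp
    have dom: "f \<in> dom S" "e k \<in> dom S" using f by auto
    then have "v \<in> dom S"
      unfolding v_def using lin by (intro subspace_add subspace_scale) (auto simp: linear_op_def)
    have "the (S v) = 1 *\<^sub>R the (S f) + (- \<sigma> k) *\<^sub>R the (S (e k))"
      unfolding v_def using lin dom unfolding linear_op_def by blast
    also have "\<dots> = (- \<sigma> k) *\<^sub>R v"
      using f by (simp add: v_def algebra_simps power2_eq_square)
    finally have "0 \<le> ip ((- \<sigma> k) *\<^sub>R v) v"
      using S(2) \<open>v \<in> dom S\<close> unfolding positive_op_def by metis
    then have "\<sigma> k * ip v v \<le> 0" using vV ip_scaleR[of v v "- \<sigma> k"] by simp
    then have "ip v v = 0"
      using \<sigma>[of k] ip_nonneg[OF vV] by (metis antisym mult_le_0_iff not_le)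
    then have "v = 0" using vV definite by blast
    then show ?thesis using f(1) by (simp add: v_def)
  qed
  have sub: "diag \<sigma> y = Some z" if "S y = Some z" for y z
  proof -
    have yz: "y \<in> V" "z \<in> V" "\<forall>x\<in>dom S. ip (the (S x)) y = ip x z" using that adj by blast+
    have "coord z k = \<sigma> k * coord y k" for k
    proof -
      have "ip (the (S (e k))) y = ip (e k) z" using yz(3) basis[of k] by blast
      then show ?thesis using yz by (simp add: basis ip_scaleR ip_commute[of "e k"])
    qed
    then show ?thesis using yz by (simp add: diag_eq_Some_iff)
  qed
  \<comment> \<open>Self-adjoint operators have no proper symmetric extension:
    \<open>diag \<sigma>\<close> extends \<open>S\<close> symmetrically, so its pairs satisfy the
    adjoint relation of \<open>S\<close>, which is the graph of \<open>S\<close>.\<close>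
  have "S y = Some z" if yz: "diag \<sigma> y = Some z" for y z
    unfolding adj using diag_symmetric[OF sub yz] yz by (auto simp: diag_eq_Some_iff)
  then have "S y = Some z \<longleftrightarrow> diag \<sigma> y = Some z" for y z using sub by blast
  then show ?thesis by (intro ext) (metis not_Some_eq)
qed

lemma pos_sqrt_diag:
  assumes "\<And>k. 0 < \<sigma> k"
  shows "pos_sqrt V ip (diag (\<lambda>k. (\<sigma> k)\<^sup>2)) = diag \<sigma>"
  unfolding pos_sqrt_def
  using assms by (intro the_equality)
    (auto intro: less_imp_le self_adjoint_diag positive_op_diag diag_comp_diag pos_sqrt_unique)

lemma op_inverse_diag:
  assumes "\<And>k. \<sigma> k \<noteq> 0"
  shows "op_inverse (diag \<sigma>) = diag (\<lambda>k. 1 / \<sigma> k)"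
proof
  fix y
  have *: "diag \<sigma> x = Some y \<longleftrightarrow> diag (\<lambda>k. 1 / \<sigma> k) y = Some x" for x
    using assms by (auto simp: diag_eq_Some_iff)
  then show "op_inverse (diag \<sigma>) y = diag (\<lambda>k. 1 / \<sigma> k) y"
    unfolding op_inverse_def * by (cases "diag (\<lambda>k. 1 / \<sigma> k) y") auto
qed

lemma summable_bounded_mult:
  fixes f a :: "nat \<Rightarrow> real"
  assumes "\<And>k. \<bar>f k\<bar> \<le> B" "summable (\<lambda>k. (a k)\<^sup>2)"
  shows "summable (\<lambda>k. (f k * a k)\<^sup>2)"
proof (rule summable_comparison_test'[where N = 0])
  show "summable (\<lambda>k. B\<^sup>2 * (a k)\<^sup>2)" using assms by (intro summable_mult)
  show "norm ((f k * a k)\<^sup>2) \<le> B\<^sup>2 * (a k)\<^sup>2" for k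
    using power_mono[OF assms(1)[of k], of 2] by (simp add: power_mult_distrib mult_right_mono)
qed

lemma dom_diag_bounded:
  assumes "\<And>k. \<bar>f k\<bar> \<le> B"
  shows "dom (diag f) = V"
  by (intro equalityI subsetI) (simp_all add: dom_diag summable_bounded_mult[OF assms] coord_summable)

lemma diag_bounded:
  assumes "\<And>k. \<bar>f k\<bar> \<le> B" "x \<in> V"
  shows "ip (the (diag f x)) (the (diag f x)) \<le> B\<^sup>2 * ip x x"
proof -
  have x: "x \<in> dom (diag f)" using assms dom_diag_bounded by blast
  have 1: "(\<lambda>k. (f k * coord x k)\<^sup>2) sums ip (the (diag f x)) (the (diag f x))"
    using parseval[OF the_diag(1)[OF x]] by (simp add: the_diag(2)[OF x])
  have 2: "(\<lambda>k. B\<^sup>2 * (coord x k)\<^sup>2) sums (B\<^sup>2 * ip x x)"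
    by (intro sums_mult parseval assms)
  have "(f k * coord x k)\<^sup>2 \<le> B\<^sup>2 * (coord x k)\<^sup>2" for k
    using power_mono[OF assms(1)[of k], of 2] by (simp add: power_mult_distrib mult_right_mono)
  then show ?thesis by (rule sums_le[OF _ 1 2])
qed

text \<open>Links norm convergence, as in \<open>sums_half\<close>, to coordinates. Each coordinate
  is bounded by the norm and is eventually constant along the partial sums, so the limit has the
  prescribed coordinates; the converse is convergence of the expansion of \<open>y\<close>.\<close>

lemma partial_sums_iff_diag:
  assumes "x \<in> V" "y \<in> V"
  shows "(\<lambda>n. sqrt (sq ((\<Sum>k<n. (f k * coord x k) *\<^sub>R e k) - y))) \<longlonglongrightarrow> 0
    \<longleftrightarrow> diag f x = Some y" (is "?lim \<longleftrightarrow> _")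
proof
  let ?s = "\<lambda>n. \<Sum>k<n. (f k * coord x k) *\<^sub>R e k"
  have s: "?s n \<in> V" "coord (?s n) j = (if j < n then f j * coord x j else 0)" for n j
    using coord_sum[where n = n and a = "\<lambda>k. f k * coord x k" for n] by auto
  assume lim: ?lim
  have "coord y j = f j * coord x j" for j
  proof -
    have "(\<lambda>n. \<bar>coord (?s n - y) j\<bar>) \<longlonglongrightarrow> 0"
    proof (rule tendsto_sandwich[OF _ _ tendsto_const lim])
      show "eventually (\<lambda>n. \<bar>coord (?s n - y) j\<bar> \<le> sqrt (ip (?s n - y) (?s n - y))) sequentially"
        using coord_sq_le[of "?s _ - y" j] s assms by (auto intro!: always_eventually real_le_rsqrt)
    qed auto
    moreover have "eventually (\<lambda>n. \<bar>coord (?s n - y) j\<bar> = \<bar>f j * coord x j - coord y j\<bar>) sequentially"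
      using eventually_gt_at_top[of j] by eventually_elim (use s assms in \<open>simp add: ip_diff\<close>)
    ultimately have "(\<lambda>n::nat. \<bar>f j * coord x j - coord y j\<bar>) \<longlonglongrightarrow> 0"
      using tendsto_cong by force
    then show ?thesis by (simp add: LIMSEQ_const_iff)
  qed
  then show "diag f x = Some y" using assms by (simp add: diag_eq_Some_iff)
next
  assume "diag f x = Some y"
  then have "\<And>k. coord y k = f k * coord x k" by (simp add: diag_eq_Some_iff)
  then show ?lim
    using tendsto_real_sqrt[OF partial_sum_tendsto[OF assms(2)]] by simp
qed

text \<open>With this inner product \<open>diag \<sigma>\<close> is an isometry of its domain onto
  \<open>V\<close>, so the basis is pulled back. The lower bound \<open>d\<close> makes the inverse
  bounded, which yields a preimage for every vector of \<open>V\<close>. With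
  \<open>\<sigma> = freq L\<close> this produces \<open>space_half\<close>.\<close>

lemma hilbert_basis_dom_diag:
  assumes d: "0 < d" and \<sigma>: "\<And>k. d \<le> \<sigma> k"
  shows "hilbert_basis (dom (diag \<sigma>)) (\<lambda>x y. ip (the (diag \<sigma> x)) (the (diag \<sigma> y))) (\<lambda>k. (1 / \<sigma> k) *\<^sub>R e k)"
proof -
  have pos: "0 < \<sigma> k" for k using d \<sigma>[of k] by linarith
  have lin: "subspace (dom (diag \<sigma>))" "\<And>x y a b. x \<in> dom (diag \<sigma>) \<Longrightarrow> y \<in> dom (diag \<sigma>) \<Longrightarrow>
      the (diag \<sigma> (a *\<^sub>R x + b *\<^sub>R y)) = a *\<^sub>R the (diag \<sigma> x) + b *\<^sub>R the (diag \<sigma> y)"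
    using linear_op_diag[of \<sigma>] unfolding linear_op_def by blast+
  have bD: "(1 / \<sigma> k) *\<^sub>R e k \<in> dom (diag \<sigma>)" and b: "the (diag \<sigma> ((1 / \<sigma> k) *\<^sub>R e k)) = e k" for k
  proof -
    have "diag \<sigma> ((1 / \<sigma> k) *\<^sub>R e k) = Some (e k)"
      using pos[of k] by (auto simp: diag_eq_Some_iff ip_scaleR orthonormal)
    then show "(1 / \<sigma> k) *\<^sub>R e k \<in> dom (diag \<sigma>)" "the (diag \<sigma> ((1 / \<sigma> k) *\<^sub>R e k)) = e k" by auto
  qed
  show ?thesis
  proof (unfold_locales, goal_cases)
    case 1 show ?case by (fact lin(1))
  next
    case (2 x y) then show ?case by (intro ip_commute the_diag)
  next
    case (3 x y z) then show ?case using lin(2)[of x y 1 1] by (simp add: ip_add the_diag)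
  next
    case (4 x y r) then show ?case using lin(2)[of x x r 0] by (simp add: ip_scaleR the_diag)
  next
    case 5 show ?case by (fact bD)
  next
    case 6 show ?case by (simp add: b orthonormal)
  next
    case (7 x)
    then have "the (diag \<sigma> x) = 0" by (intro definite the_diag)
    then have "\<sigma> k * coord x k = 0" for k using the_diag(2)[OF 7(1), of k] by simp
    then have "coord x k = coord 0 k" for k using pos[of k] by (metis basis_in ip_0 mult_eq_0_iff less_irrefl)
    then show ?case using 7(1) by (intro coord_eqI) (auto simp: dom_diag)
  next
    case (8 x) then show ?case using parseval[OF the_diag(1)] by (simp add: b)
  next
    case (9 a)
    have "summable (\<lambda>k. (1 / \<sigma> k * a k)\<^sup>2)"
      using pos \<sigma> d 9 by (intro summable_bounded_mult[of _ "1 / d"]) (auto simp: abs_of_pos intro!: frac_le)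
    note v = vec[OF this]
    have "diag \<sigma> (vec (\<lambda>k. 1 / \<sigma> k * a k)) = Some (vec a)"
      using v vec[OF 9] pos by (auto simp: diag_eq_Some_iff less_imp_neq[symmetric])
    then show ?case
      using vec[OF 9] by (intro bexI[of _ "vec (\<lambda>k. 1 / \<sigma> k * a k)"]) (auto simp: b)
  qed
qed

end

section \<open>The sine basis diagonalises \<open>\<A>\<close>\<close>

lemma bessel:
  fixes e :: "nat \<Rightarrow> 'a::real_inner"
  assumes on: "\<And>j k. inner (e j) (e k) = (if j = k then 1 else 0)"
  shows "(\<Sum>k<n. (inner x (e k))\<^sup>2) \<le> (norm x)\<^sup>2"
proof -
  let ?s = "\<Sum>k<n. inner x (e k) *\<^sub>R e k"
  have "inner ?s (e j) = (if j < n then inner x (e j) else 0)" for j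
    by (induction n) (auto simp: inner_add_left on less_Suc_eq)
  then have "inner ?s ?s = (\<Sum>k<n. (inner x (e k))\<^sup>2)"
    by (simp add: inner_sum_right power2_eq_square)
  moreover have "inner x ?s = (\<Sum>k<n. (inner x (e k))\<^sup>2)"
    by (simp add: inner_sum_right power2_eq_square)
  moreover have "0 \<le> inner (x - ?s) (x - ?s)" by simp
  ultimately show ?thesis by (simp add: inner_diff inner_commute[of ?s x] power2_norm_eq_inner)
qed

lemma bessel_summable:
  fixes e :: "nat \<Rightarrow> 'a::real_inner"
  assumes on: "\<And>j k. inner (e j) (e k) = (if j = k then 1 else 0)"
  shows "summable (\<lambda>k. (inner x (e k))\<^sup>2)"
  by (rule summableI_nonneg_bounded[OF _ bessel[OF on]]) auto

text \<open>Squared distances of partial sums are differences of partial sums of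
  \<open>(a k)^2\<close>, so the vector series is Cauchy and its limit stays in the closed
  \<open>V\<close>. Parseval follows because totality identifies \<open>x\<close> with the limit
  built from its own coefficients.\<close>

lemma hilbert_basisI:
  fixes V :: "'a::{real_inner, complete_space} set" and e :: "nat \<Rightarrow> 'a"
  assumes V: "subspace V" "closed V" and e: "\<And>k. e k \<in> V"
    and on: "\<And>j k. inner (e j) (e k) = (if j = k then 1 else 0)"
    and total: "\<And>x. x \<in> V \<Longrightarrow> (\<And>k. inner x (e k) = 0) \<Longrightarrow> x = 0"
  shows "hilbert_basis V inner e"
proof -
  have limit: "\<exists>x\<in>V. (\<forall>k. inner x (e k) = a k) \<and> (\<lambda>k. (a k)\<^sup>2) sums inner x x"
    if a: "summable (\<lambda>k. (a k)\<^sup>2)" for a :: "nat \<Rightarrow> real"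
  proof -
    define s where "s n = (\<Sum>k<n. a k *\<^sub>R e k)" for n
    define A where "A n = (\<Sum>k<n. (a k)\<^sup>2)" for n
    have sV: "s n \<in> V" for n
      unfolding s_def using V(1) e by (intro subspace_sum subspace_scale)
    have se: "inner (s n) (e j) = (if j < n then a j else 0)" for n j
      unfolding s_def by (induction n) (auto simp: inner_add_left on less_Suc_eq)
    have ss: "inner (s m) (s n) = A (min m n)" for m n
    proof -
      have "inner (s m) (s n) = (\<Sum>k<n. a k * inner (s m) (e k))"
        by (simp add: s_def[of n] inner_sum_right)
      also have "\<dots> = (\<Sum>k<n. if k < m then (a k)\<^sup>2 else 0)"
        by (intro sum.cong) (auto simp: se power2_eq_square)
      also have "\<dots> = A (min m n)"
        unfolding A_def by (rule sum.mono_neutral_cong_right) auto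
      finally show ?thesis .
    qed
    have norm_s: "(norm (s m - s n))\<^sup>2 = \<bar>A m - A n\<bar>" for m n
    proof -
      have mono: "A i \<le> A j" if "i \<le> j" for i j
        unfolding A_def using that by (intro sum_mono2) auto
      have "(norm (s m - s n))\<^sup>2 = A m + A n - 2 * A (min m n)"
        unfolding power2_norm_eq_inner by (simp add: inner_diff ss min.commute)
      then show ?thesis using mono[of m n] mono[of n m] by (cases "m \<le> n") (auto simp: min_def)
    qed
    have "Cauchy A"
      unfolding A_def[abs_def] using a by (simp add: Cauchy_convergent_iff summable_iff_convergent)
    have "Cauchy s"
    proof (rule CauchyI)
      fix d :: real assume "d > 0"
      then obtain M where M: "\<And>m n. m \<ge> M \<Longrightarrow> n \<ge> M \<Longrightarrow> norm (A m - A n) < d\<^sup>2"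
        using CauchyD[OF \<open>Cauchy A\<close>, of "d\<^sup>2"] by auto
      have "norm (s m - s n) < d" if "m \<ge> M" "n \<ge> M" for m n
        using M[OF that] norm_s[of m n] \<open>d > 0\<close> by (intro power2_less_imp_less[of _ d]) auto
      then show "\<exists>M. \<forall>m\<ge>M. \<forall>n\<ge>M. norm (s m - s n) < d" by blast
    qed
    then obtain x where x: "s \<longlonglongrightarrow> x" by (auto simp: Cauchy_convergent_iff convergent_def)
    have "x \<in> V" using closed_sequentially[OF V(2)] sV x by blast
    moreover have "inner x (e k) = a k" for k
    proof (rule LIMSEQ_unique)
      show "(\<lambda>n. inner (s n) (e k)) \<longlonglongrightarrow> inner x (e k)" using x by (intro tendsto_intros)
      show "(\<lambda>n. inner (s n) (e k)) \<longlonglongrightarrow> a k"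
        by (rule tendsto_eventually) (auto simp: se eventually_sequentially intro!: exI[of _ "Suc k"])
    qed
    moreover have "(\<lambda>n. inner (s n) (s n)) \<longlonglongrightarrow> inner x x" using x by (intro tendsto_intros)
    then have "(\<lambda>k. (a k)\<^sup>2) sums inner x x" by (simp add: ss sums_def A_def)
    ultimately show ?thesis by blast
  qed
  have pars: "(\<lambda>k. (inner x (e k))\<^sup>2) sums inner x x" if x: "x \<in> V" for x
  proof -
    have "summable (\<lambda>k. (inner x (e k))\<^sup>2)" by (rule bessel_summable[OF on])
    from limit[OF this] obtain y where y: "y \<in> V" "\<And>k. inner y (e k) = inner x (e k)"
      "(\<lambda>k. (inner x (e k))\<^sup>2) sums inner y y" by blast
    have "x - y = 0"
      using x y V(1) by (intro total) (auto simp: inner_diff_left subspace_diff)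
    then show ?thesis using y(3) by simp
  qed
  show ?thesis
  proof (unfold_locales, goal_cases)
    case 2 show ?case by (rule inner_commute)
  next
    case 3 show ?case by (rule inner_add_left)
  next
    case 8 then show ?case by (rule pars)
  next
    case 9 then show ?case using limit by blast
  qed (use V(1) e on in auto)
qed

definition outer_part :: "real \<Rightarrow> L2 \<Rightarrow> L2" where
  "outer_part L z = abs_L2 (\<lambda>s. if s \<in> - {0<..<L} then rep_L2 z s else 0)"

text \<open>Tested against its own outer part, \<open>x\<close> reveals its mass outside the
  interval. As an intersection of kernels of continuous functionals, the space is a closed
  subspace.\<close>

lemma space_X_eq: "space_X L = (\<Inter>z. {x. inner x (outer_part L z) = 0})"
proof -
  have si: "square_integrable (\<lambda>s. if s \<in> - {0<..<L} then rep_L2 z s else 0)" for z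
  proof (rule square_integrable_restrict)
    show "rep_L2 z \<in> borel_measurable (lebesgue_on (- {0<..<L}))"
      by (rule measurable_restrict_space1) simp
    have "integrable lebesgue (\<lambda>s. indicator (- {0<..<L}) s *\<^sub>R (rep_L2 z s)\<^sup>2)"
      using square_integrable_rep[of z] by (intro integrable_mult_indicator) (auto simp: square_integrable_def)
    then show "integrable (lebesgue_on (- {0<..<L})) (\<lambda>s. (rep_L2 z s)\<^sup>2)"
      by (simp add: integrable_restrict_space)
  qed simp
  have ip: "inner x (outer_part L z) = (\<integral>s. rep_L2 x s * (if s \<in> - {0<..<L} then rep_L2 z s else 0) \<partial>lebesgue)" for x z
    unfolding outer_part_def using inner_abs_L2[OF square_integrable_rep[of x] si[of z]] by simp
  have 1: "inner x (outer_part L z) = 0" if "x \<in> space_X L" for x z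
    unfolding ip using space_X_zero_outside[OF that]
    by (intro integral_eq_zero_AE) (auto elim: AE_mp)
  have 2: "x \<in> space_X L" if "inner x (outer_part L x) = 0" for x
  proof -
    have "(\<integral>s. rep_L2 x s * (if s \<in> - {0<..<L} then rep_L2 x s else 0) \<partial>lebesgue) = 0 \<longleftrightarrow>
       (AE s in lebesgue. rep_L2 x s * (if s \<in> - {0<..<L} then rep_L2 x s else 0) = 0)"
      by (intro integral_nonneg_eq_0_iff_AE square_integrable_mult square_integrable_rep si) auto
    then have "AE s in lebesgue. rep_L2 x s * (if s \<in> - {0<..<L} then rep_L2 x s else 0) = 0"
      using that by (simp add: ip)
    then show ?thesis unfolding space_X_def by (auto elim: AE_mp)
  qed
  show ?thesis using 1 2 by blast
qed

lemma subspace_space_X: "subspace (space_X L)"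
  unfolding space_X_eq by (intro subspace_Inter) (auto simp: subspace_def inner_add_left)

lemma closed_space_X: "closed (space_X L)"
  unfolding space_X_eq by (intro closed_INT ballI closed_Collect_eq continuous_intros)

lemma emb_eqI:
  assumes "continuous_on {0..L} g" "x \<in> space_X L" "AE s in lebesgue. s \<in> {0<..<L} \<longrightarrow> rep_L2 x s = g s"
  shows "x = emb L g"
  by (rule L2_eqI, use rep_emb[OF assms(1)] space_X_zero_outside[OF assms(2)] assms(3) in eventually_elim) auto

lemma scaleR_emb:
  assumes "continuous_on {0..L} g"
  shows "c *\<^sub>R emb L g = emb L (\<lambda>s. c * g s)"
  unfolding emb_def abs_L2_scaleR[OF square_integrable_continuous[OF assms]]
  by (intro arg_cong[where f = abs_L2]) auto

lemma emb_zero: "emb L (\<lambda>_. 0) = 0"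
  using scaleR_emb[of L "\<lambda>_. 0" 0] by simp

lemma neg_second_derivative_sin:
  fixes n :: nat
  assumes L: "L > 0"
  defines "k \<equiv> real n * pi / L"
  shows "neg_second_derivative L (emb L (\<lambda>s. sin (k * s))) (emb L (\<lambda>s. k\<^sup>2 * sin (k * s)))"
proof -
  have c: "continuous_on {0..L} (\<lambda>s. sin (k * s))" "continuous_on {0..L} (\<lambda>s. k\<^sup>2 * sin (k * s))"
    by (auto intro!: continuous_intros)
  have "AE s in lebesgue_on {0<..<L}. rep_L2 (emb L (\<lambda>s. sin (k * s))) s = sin (k * s)"
    unfolding AE_lebesgue_on_Ioo using rep_emb[OF c(1)] by (auto elim: AE_mp)
  moreover have "abs_continuous_on 0 L (\<lambda>s. sin (k * s))"
    by (rule abs_continuous_on_C1[where f' = "\<lambda>s. k * cos (k * s)"])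
       (auto intro!: derivative_eq_intros continuous_intros)
  moreover have "ae_derivative L (\<lambda>s. sin (k * s)) (\<lambda>s. k * cos (k * s))"
    unfolding ae_derivative_def by (intro AE_I2) (auto intro!: derivative_eq_intros)
  moreover have "abs_continuous_on 0 L (\<lambda>s. k * cos (k * s))"
    by (rule abs_continuous_on_C1[where f' = "\<lambda>s. - (k * (k * sin (k * s)))"])
       (auto intro!: derivative_eq_intros continuous_intros)
  moreover have "ae_derivative L (\<lambda>s. k * cos (k * s)) (\<lambda>s. - rep_L2 (emb L (\<lambda>s. k\<^sup>2 * sin (k * s))) s)"
    unfolding ae_derivative_def AE_lebesgue_on_Ioo
    using rep_emb[OF c(2)]
    by eventually_elim (auto intro!: derivative_eq_intros simp: power2_eq_square)
  moreover have "sin (k * L) = 0" using L by (simp add: k_def)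
  ultimately show ?thesis
    unfolding neg_second_derivative_def
    by (intro conjI emb_in_space_X c exI[of _ "\<lambda>s. sin (k * s)"] exI[of _ "\<lambda>s. k * cos (k * s)"]) auto
qed

text \<open>Orthogonality needs no product formula: the sines are eigenfunctions for different
  eigenvalues, and \<open>neg_second_derivative_inner_sin\<close> moves the operator from one factor
  to the other. Only the normalisation uses an antiderivative.\<close>

lemma inner_sin_sin:
  fixes m n :: nat
  assumes L: "L > 0" and mn: "m \<ge> 1" "n \<ge> 1"
  shows "inner (emb L (\<lambda>s. sin (real m * pi / L * s))) (emb L (\<lambda>s. sin (real n * pi / L * s))) =
    (if m = n then L / 2 else 0)"
proof -
  define k where "k = real n * pi / L"
  define j where "j = real m * pi / L"
  let ?ek = "emb L (\<lambda>s. sin (k * s))" and ?ej = "emb L (\<lambda>s. sin (j * s))"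
  have pos: "k > 0" "j > 0" using L mn by (auto simp: k_def j_def)
  have c: "continuous_on {0..L} (\<lambda>s. sin (k * s))" "continuous_on {0..L} (\<lambda>s. sin (j * s))"
    by (auto intro!: continuous_intros)
  show ?thesis
  proof (cases "m = n")
    case False
    have "j\<^sup>2 * inner ?ej ?ek =
        k\<^sup>2 * inner ?ej ?ek"
      using neg_second_derivative_inner_sin[OF L neg_second_derivative_sin[OF L, of m], of n]
      unfolding j_def[symmetric] k_def[symmetric] scaleR_emb[OF c(2), symmetric] by simp
    moreover have "j\<^sup>2 \<noteq> k\<^sup>2"
      using pos False L by (auto simp: j_def k_def power2_eq_iff)
    ultimately show ?thesis using False by (simp add: j_def k_def)
  next
    case True
    have "inner ?ek ?ek =
        (\<integral>s. rep_L2 ?ek s * sin (k * s) \<partial>leb L)"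
      by (rule inner_emb[OF c(1)])
    also have "\<dots> = (\<integral>s. sin (k * s) * sin (k * s) \<partial>leb L)"
    proof (rule integral_cong_AE)
      show "(\<lambda>s. rep_L2 ?ek s * sin (k * s)) \<in> borel_measurable (leb L)"
        using integrable_rep_mult[OF c(1)] by (rule borel_measurable_integrable)
      show "(\<lambda>s. sin (k * s) * sin (k * s)) \<in> borel_measurable (leb L)"
        by (intro continuous_imp_measurable_on_sets_lebesgue continuous_intros) auto
      show "AE s in leb L. rep_L2 ?ek s * sin (k * s) = sin (k * s) * sin (k * s)"
        unfolding AE_lebesgue_on_iff[of "{0..L}", simplified]
        using rep_emb[OF c(1)] AE_lebesgue_not_eq[of 0] AE_lebesgue_not_eq[of L]
        by eventually_elim auto
    qed
    also have "\<dots> = integral {0..L} (\<lambda>s. sin (k * s) * sin (k * s))"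
      by (intro lebesgue_integral_eq_integral continuous_imp_integrable_real continuous_intros) auto
    also have "\<dots> = L / 2"
    proof (rule integral_unique)
      define r where "r = 1 / (2 * k)"
      have r: "r * k = 1 / 2" using pos by (simp add: r_def)
      have "((\<lambda>s. sin (k * s) * sin (k * s)) has_integral
          (L / 2 - r * (sin (k * L) * cos (k * L))) - (0 / 2 - r * (sin (k * 0) * cos (k * 0)))) {0..L}"
      proof (rule fundamental_theorem_of_calculus)
        fix s
        have "((\<lambda>s. s / 2 - r * (sin (k * s) * cos (k * s))) has_real_derivative
            1 / 2 - r * ((cos (k * s) * k) * cos (k * s) + sin (k * s) * (- sin (k * s) * k))) (at s within {0..L})"
          by (auto intro!: derivative_eq_intros)
        also have "1 / 2 - r * ((cos (k * s) * k) * cos (k * s) + sin (k * s) * (- sin (k * s) * k)) =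
            1 / 2 - (r * k) * ((cos (k * s))\<^sup>2 - (sin (k * s))\<^sup>2)"
          by (simp add: algebra_simps power2_eq_square)
        also have "\<dots> = sin (k * s) * sin (k * s)"
          unfolding r cos_squared_eq by (simp add: power2_eq_square field_simps)
        finally show "((\<lambda>s. s / 2 - r * (sin (k * s) * cos (k * s))) has_vector_derivative sin (k * s) * sin (k * s)) (at s within {0..L})"
          by (simp only: has_real_derivative_iff_has_vector_derivative)
      qed (use L in simp)
      moreover have "sin (k * L) = 0" using L by (simp add: k_def)
      ultimately show "((\<lambda>s. sin (k * s) * sin (k * s)) has_integral L / 2) {0..L}" by simp
    qed
    finally show ?thesis using True by (simp add: k_def)
  qed
qed

text \<open>
  A continuous function orthogonal to all sines is orthogonal to \<open>sin x\<close> times any polynomial in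
  \<open>cos x\<close>, and polynomials in \<open>cos x\<close> are uniformly dense on \<open>[0, \<pi>]\<close>.
\<close>

lemma continuous_orthogonal_sin_zero:
  fixes u :: "real \<Rightarrow> real"
  assumes L: "L > 0" and u: "continuous_on {0..L} u"
    and orth: "\<And>n::nat. (\<integral>s. u s * sin (real n * (pi / L) * s) \<partial>leb L) = 0"
    and s: "s \<in> {0<..<L}"
  shows "u s = 0"
proof -
  define c where "c = pi / L"
  have c: "c > 0" using L by (simp add: c_def)
  have int: "integrable (leb L) f" if "continuous_on {0..L} f" for f :: "real \<Rightarrow> real"
    using that by (rule continuous_imp_integrable_real)
  let ?M = "leb L"
  \<comment> \<open>A factor \<open>cos y\<close> turns \<open>sin (n y)\<close> into the mean of
    \<open>sin ((n + 1) y)\<close> and \<open>sin ((n - 1) y)\<close>, so the induction over the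
    polynomial has to range over all frequencies.\<close>
  have pol: "(\<integral>s. u s * sin (real n * c * s) * poly p (cos (c * s)) \<partial>?M) = 0" for p n
  proof (induction p arbitrary: n)
    case 0 then show ?case by simp
  next
    case (pCons a p)
    show ?case
    proof (cases n)
      case 0 then show ?thesis by simp
    next
      case (Suc m)
      have i: "integrable ?M (\<lambda>s. u s * sin (real j * c * s) * poly q (cos (c * s)))" for j q
        by (intro int continuous_intros u)
      have i0: "integrable ?M (\<lambda>s. u s * sin (real j * c * s))" for j
        by (intro int continuous_intros u)
      have trig: "sin (real n * c * s) * cos (c * s) = (sin (real (Suc n) * c * s) + sin (real m * c * s)) / 2" for s
        using sin_add[of "real n * c * s" "c * s"] sin_diff[of "real n * c * s" "c * s"]
        by (simp add: Suc algebra_simps)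
      have "u s * sin (real n * c * s) * poly (pCons a p) (cos (c * s)) = a * (u s * sin (real n * c * s)) +
          (1 / 2) * (u s * sin (real (Suc n) * c * s) * poly p (cos (c * s)) + u s * sin (real m * c * s) * poly p (cos (c * s)))" for s
      proof -
        have "u s * sin (real n * c * s) * poly (pCons a p) (cos (c * s)) = a * (u s * sin (real n * c * s)) +
            u s * (sin (real n * c * s) * cos (c * s)) * poly p (cos (c * s))"
          by (simp add: algebra_simps)
        then show ?thesis unfolding trig by (simp add: algebra_simps)
      qed
      then show ?thesis
        using pCons.IH orth i i0 by (simp add: c_def del: poly_pCons of_nat_Suc)
    qed
  qed
  define A where "A = (\<integral>s. (u s)\<^sup>2 * sin (c * s) \<partial>?M)"
  define B where "B = (\<integral>s. \<bar>u s\<bar> \<partial>?M)"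
  have "B \<ge> 0" unfolding B_def by (rule Bochner_Integration.integral_nonneg) simp
  \<comment> \<open>The polynomial part integrates to zero against \<open>u sin\<close>, so one
    factor \<open>u\<close> of \<open>A\<close> can be replaced by the approximation error, which is
    below \<open>d\<close>.\<close>
  have le: "\<bar>A\<bar> \<le> d * B" if d: "d > 0" for d
  proof -
    have "\<exists>g. (\<exists>p. g = (\<lambda>s. poly p (cos (c * s)))) \<and> (\<forall>s\<in>{0..L}. \<bar>u s - g s\<bar> < d)"
    proof (rule Stone_Weierstrass_HOL)
      show "\<exists>p. (\<lambda>s. a) = (\<lambda>s. poly p (cos (c * s)))" for a by (rule exI[of _ "[:a:]"]) simp
      show "continuous_on {0..L} g" if "\<exists>p. g = (\<lambda>s. poly p (cos (c * s)))" for g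
        using that by (auto intro!: continuous_intros)
      show "\<exists>p. (\<lambda>s. f s + g s) = (\<lambda>s. poly p (cos (c * s)))"
        if "(\<exists>p. f = (\<lambda>s. poly p (cos (c * s)))) \<and> (\<exists>p. g = (\<lambda>s. poly p (cos (c * s))))" for f g
        using that by (metis poly_add)
      show "\<exists>p. (\<lambda>s. f s * g s) = (\<lambda>s. poly p (cos (c * s)))"
        if "(\<exists>p. f = (\<lambda>s. poly p (cos (c * s)))) \<and> (\<exists>p. g = (\<lambda>s. poly p (cos (c * s))))" for f g
        using that by (metis poly_mult)
      show "\<exists>f. (\<exists>p. f = (\<lambda>s. poly p (cos (c * s)))) \<and> f x \<noteq> f y" if xy: "x \<in> {0..L} \<and> y \<in> {0..L} \<and> x \<noteq> y" for x y
      proof -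
        have "c * x \<in> {0..pi}" "c * y \<in> {0..pi}" using xy L by (auto simp: c_def field_simps)
        then have "cos (c * x) \<noteq> cos (c * y)"
          using xy c cos_inj_pi[of "c * x" "c * y"] by auto
        moreover have "(\<lambda>s. cos (c * s)) = (\<lambda>s. poly [:0, 1:] (cos (c * s)))" by simp
        ultimately show ?thesis by blast
      qed
    qed (use u d in auto)
    then obtain p where p: "\<And>s. s \<in> {0..L} \<Longrightarrow> \<bar>u s - poly p (cos (c * s))\<bar> < d" by blast
    have i: "integrable ?M (\<lambda>s. (u s)\<^sup>2 * sin (c * s))"
      "integrable ?M (\<lambda>s. u s * sin (c * s) * poly p (cos (c * s)))"
      "integrable ?M (\<lambda>s. d * \<bar>u s\<bar>)"
      by (intro int continuous_intros u)+
    have "A = (\<integral>s. (u s)\<^sup>2 * sin (c * s) \<partial>?M) - (\<integral>s. u s * sin (c * s) * poly p (cos (c * s)) \<partial>?M)"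
      using pol[of 1 p] by (simp add: A_def)
    also have "\<dots> = (\<integral>s. (u s)\<^sup>2 * sin (c * s) - u s * sin (c * s) * poly p (cos (c * s)) \<partial>?M)"
      using i by simp
    finally have A_eq: "A = (\<integral>s. (u s)\<^sup>2 * sin (c * s) - u s * sin (c * s) * poly p (cos (c * s)) \<partial>?M)" .
    have "\<bar>A\<bar> \<le> (\<integral>s. \<bar>(u s)\<^sup>2 * sin (c * s) - u s * sin (c * s) * poly p (cos (c * s))\<bar> \<partial>?M)"
      unfolding A_eq by (rule integral_abs_bound)
    also have "\<dots> \<le> (\<integral>s. d * \<bar>u s\<bar> \<partial>?M)"
    proof (rule integral_mono)
      fix s assume "s \<in> space ?M"
      then have s: "s \<in> {0..L}" by simp
      have "\<bar>(u s)\<^sup>2 * sin (c * s) - u s * sin (c * s) * poly p (cos (c * s))\<bar> =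
          \<bar>sin (c * s)\<bar> * (\<bar>u s - poly p (cos (c * s))\<bar> * \<bar>u s\<bar>)"
        by (simp add: abs_mult[symmetric] power2_eq_square algebra_simps)
      also have "\<dots> \<le> 1 * (d * \<bar>u s\<bar>)"
        using p[OF s] d by (intro mult_mono mult_right_mono) auto
      finally show "\<bar>(u s)\<^sup>2 * sin (c * s) - u s * sin (c * s) * poly p (cos (c * s))\<bar> \<le> d * \<bar>u s\<bar>" by simp
    qed (use i in auto)
    also have "\<dots> = d * B" by (simp add: B_def)
    finally show ?thesis .
  qed
  have "A = 0"
  proof (rule ccontr)
    assume "A \<noteq> 0"
    with le[of "\<bar>A\<bar> / (2 * (B + 1))"] \<open>B \<ge> 0\<close> have "B * \<bar>A\<bar> + 2 * \<bar>A\<bar> \<le> 0"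
      by (simp add: field_simps)
    moreover have "0 \<le> B * \<bar>A\<bar>" "0 < \<bar>A\<bar>" using \<open>B \<ge> 0\<close> \<open>A \<noteq> 0\<close> by auto
    ultimately show False by linarith
  qed
  have nn: "0 \<le> (u s)\<^sup>2 * sin (c * s)" if "s \<in> {0..L}" for s
    using that L by (intro mult_nonneg_nonneg sin_ge_zero) (auto simp: c_def field_simps)
  have "((\<lambda>s. (u s)\<^sup>2 * sin (c * s)) has_integral A) {0..L}"
    unfolding A_def by (intro has_integral_integral_lebesgue_on int continuous_intros u) auto
  moreover have "continuous_on {0..L} (\<lambda>s. (u s)\<^sup>2 * sin (c * s))"
    by (intro continuous_intros u)
  ultimately have "(u s)\<^sup>2 * sin (c * s) = 0"
    unfolding \<open>A = 0\<close>
    using has_integral_0_cbox_imp_0[of 0 L "\<lambda>s. (u s)\<^sup>2 * sin (c * s)" s] nn s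
    by auto
  moreover have "sin (c * s) > 0"
    using s L by (intro sin_gt_zero) (auto simp: c_def field_simps)
  ultimately show "u s = 0" by simp
qed

text \<open>Normalised in \<open>space_X\<close>, whereas \<open>phi\<close> is normalised in
  \<open>space_half\<close>. Index \<open>k\<close> carries frequency \<open>Suc k\<close>;
  \<open>freq\<close>, \<open>mode\<close> and \<open>lam_inv\<close> use the same zero-based
  index.\<close>

definition sine_basis :: "real \<Rightarrow> nat \<Rightarrow> L2" where
  "sine_basis L k = emb L (\<lambda>s. sqrt (2 / L) * sin (real (Suc k) * pi / L * s))"

lemma sine_basis_eq: "sine_basis L k = sqrt (2 / L) *\<^sub>R emb L (\<lambda>s. sin (real (Suc k) * pi / L * s))"
  unfolding sine_basis_def by (rule scaleR_emb[symmetric]) (intro continuous_intros)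

text \<open>The inverse of \<A> regularises: \<open>f\<close> is the image of some \<open>x\<close>,
  and \<open>x\<close> inherits orthogonality to all sines because the eigenvalues are nonzero.
  Having a continuous representative, \<open>x\<close> vanishes by the density argument, and so does
  \<open>f\<close>.\<close>

lemma sine_total:
  assumes L: "L > 0" and f: "f \<in> space_X L" and orth: "\<And>k. inner f (sine_basis L k) = 0"
  shows "f = 0"
proof -
  obtain x where x: "neg_second_derivative L x f" using neg_second_derivative_exists[OF L f] by blast
  then obtain u v where uv: "x \<in> space_X L" "AE s in lebesgue_on {0<..<L}. rep_L2 x s = u s" "abs_continuous_on 0 L u"
    unfolding neg_second_derivative_def by blast
  have c: "continuous_on {0..L} (\<lambda>s. sin (k * s))" for k :: real by (intro continuous_intros)
  note cu = abs_continuous_on_imp_continuous_on[OF uv(3)]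
  have ixk: "inner x (emb L (\<lambda>s. sin (real n * pi / L * s))) = 0" for n
  proof (cases n)
    case 0 then show ?thesis by (simp add: emb_zero)
  next
    case (Suc k)
    have "inner f (emb L (\<lambda>s. sin (real n * pi / L * s))) = 0"
      using orth[of k] L by (simp add: sine_basis_eq Suc)
    then show ?thesis
      using neg_second_derivative_inner_sin[OF L x, of n] L Suc by simp
  qed
  have "u s = 0" if "s \<in> {0<..<L}" for s
  proof (rule continuous_orthogonal_sin_zero[OF L cu _ that])
    fix n :: nat
    have "(\<integral>s. u s * sin (real n * pi / L * s) \<partial>leb L) =
        (\<integral>s. rep_L2 x s * sin (real n * pi / L * s) \<partial>leb L)"
    proof (rule integral_cong_AE)
      show "(\<lambda>s. rep_L2 x s * sin (real n * pi / L * s)) \<in> borel_measurable (leb L)"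
        using integrable_rep_mult[OF c] by (rule borel_measurable_integrable)
      show "(\<lambda>s. u s * sin (real n * pi / L * s)) \<in> borel_measurable (leb L)"
        by (intro continuous_imp_measurable_on_sets_lebesgue continuous_intros cu) auto
      show "AE s in leb L. u s * sin (real n * pi / L * s) = rep_L2 x s * sin (real n * pi / L * s)"
        using uv(2)[unfolded AE_lebesgue_on_Ioo] AE_lebesgue_not_eq[of 0] AE_lebesgue_not_eq[of L]
        unfolding AE_lebesgue_on_iff[of "{0..L}", simplified]
        by eventually_elim auto
    qed
    also have "\<dots> = 0" using ixk[of n] inner_emb[OF c[of "real n * pi / L"], of x] by simp
    finally show "(\<integral>s. u s * sin (real n * (pi / L) * s) \<partial>leb L) = 0" by simp
  qed
  then have "x = emb L (\<lambda>_. 0)"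
    using uv(2)[unfolded AE_lebesgue_on_Ioo]
    by (intro emb_eqI uv) (auto elim: AE_mp)
  then have "x = 0" by (simp add: emb_zero)
  moreover have "neg_second_derivative L 0 0"
    using neg_second_derivative_sin[OF L, of 0] by (simp add: emb_zero)
  ultimately show "f = 0" using x neg_second_derivative_unique by blast
qed

lemma hilbert_basis_sine:
  assumes "L > 0"
  shows "hilbert_basis (space_X L) inner (sine_basis L)"
proof (rule hilbert_basisI[OF subspace_space_X closed_space_X])
  show "sine_basis L k \<in> space_X L" for k
    unfolding sine_basis_def by (intro emb_in_space_X continuous_intros)
  show "inner (sine_basis L j) (sine_basis L k) = (if j = k then 1 else 0)" for j k
  proof -
    have "sqrt (2 / L) * (sqrt (2 / L) * (L / 2)) = 1"
      using assms by (simp add: mult.assoc[symmetric])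
    then show ?thesis
      using inner_sin_sin[OF assms, of "Suc j" "Suc k"] by (simp add: sine_basis_eq del: of_nat_Suc)
  qed
qed (use sine_total[OF assms] in blast)

text \<open>Testing against sines puts the graph of \<open>op_A\<close> inside the diagonal one. For
  the converse, solve the equation for the diagonal image: the solution has the same image, hence
  the same coordinates, as the eigenvalues are nonzero.\<close>

lemma op_A_diag:
  assumes L: "L > 0"
  shows "op_A L = hilbert_basis.diag (space_X L) inner (sine_basis L) (\<lambda>k. lam L (Suc k))"
proof
  interpret X: hilbert_basis "space_X L" inner "sine_basis L" by (rule hilbert_basis_sine[OF L])
  fix x
  have 1: "X.diag (\<lambda>k. lam L (Suc k)) x = Some y" if "op_A L x = Some y" for x y
  proof -
    have xy: "neg_second_derivative L x y" using that by (simp add: op_A_eq_Some_iff)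
    then have "inner y (sine_basis L k) = lam L (Suc k) * inner x (sine_basis L k)" for k
      using neg_second_derivative_inner_sin[OF L xy, of "Suc k"]
      by (simp add: sine_basis_eq lam_def del: of_nat_Suc)
    then show ?thesis
      using xy by (simp add: X.diag_eq_Some_iff neg_second_derivative_def)
  qed
  have 2: "op_A L x = Some y" if xy: "X.diag (\<lambda>k. lam L (Suc k)) x = Some y" for y
  proof -
    have V: "x \<in> space_X L" "y \<in> space_X L" using xy by (auto simp: X.diag_eq_Some_iff)
    obtain x' where x': "op_A L x' = Some y"
      using neg_second_derivative_exists[OF L V(2)] by (auto simp: op_A_eq_Some_iff)
    have "x' = x"
    proof (rule X.coord_eqI)
      show "x' \<in> space_X L" using 1[OF x'] by (simp add: X.diag_eq_Some_iff)
      have "lam L (Suc k) \<noteq> 0" for k using L by (simp add: lam_def)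
      then show "inner x' (sine_basis L k) = inner x (sine_basis L k)" for k
        using 1[OF x'] xy by (auto simp: X.diag_eq_Some_iff)
    qed (fact V)
    then show ?thesis using x' by simp
  qed
  show "op_A L x = X.diag (\<lambda>k. lam L (Suc k)) x"
    using 1[of x] 2 by (metis not_Some_eq)
qed

section \<open>Coordinates in \<open>\<X>\<^sub>1\<^sub>/\<^sub>2\<close>\<close>

definition mode :: "real \<Rightarrow> L2 \<Rightarrow> nat \<Rightarrow> real" where
  "mode L x k = inner_half L x (phi L (Suc k))"

lemma phi_eq_emb:
  "phi L n = emb L (\<lambda>s. sqrt (2 * L) / (real n * pi) * sin (real n * pi / L * s))"
  unfolding phi_def emb_def by (intro arg_cong[where f = abs_L2]) auto

definition freq :: "real \<Rightarrow> nat \<Rightarrow> real" where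
  "freq L k = real (Suc k) * pi / L"

lemma lam_Suc: "lam L (Suc k) = (freq L k)\<^sup>2"
  by (simp add: lam_def freq_def)

text \<open>The eigenvalues of the inverse of \<A> plus \<open>\<mu>^2\<close>, and the reciprocals
  of \<open>lam_mu\<close>. In this form they are visibly bounded, and at least
  \<open>\<mu>^2\<close>.\<close>

definition lam_inv :: "real \<Rightarrow> real \<Rightarrow> nat \<Rightarrow> real" where
  "lam_inv L \<mu> k = 1 / lam L (Suc k) + \<mu>\<^sup>2"

context
  fixes L :: real
  assumes L: "0 < L"
begin

lemma freq_pos: "0 < freq L k"
  using L by (simp add: freq_def)

lemma freq_ge: "pi / L \<le> freq L k"
  using L by (simp add: freq_def field_simps)

lemma phi_Suc: "phi L (Suc k) = (1 / freq L k) *\<^sub>R sine_basis L k"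
proof -
  have "sqrt (2 * L) = L * sqrt (2 / L)"
    using L by (simp add: real_sqrt_mult real_sqrt_divide field_simps)
  then have "sqrt (2 * L) / (real (Suc k) * pi) = 1 / freq L k * sqrt (2 / L)"
    using L by (simp add: freq_def field_simps del: of_nat_Suc)
  then have "phi L (Suc k) = emb L (\<lambda>s. (1 / freq L k) * (sqrt (2 / L) * sin (real (Suc k) * pi / L * s)))"
    unfolding phi_eq_emb by (simp add: mult.assoc del: of_nat_Suc)
  also have "\<dots> = (1 / freq L k) *\<^sub>R sine_basis L k"
    unfolding sine_basis_def by (rule scaleR_emb[symmetric]) (intro continuous_intros)
  finally show ?thesis .
qed

interpretation X: hilbert_basis "space_X L" inner "sine_basis L"
  by (rule hilbert_basis_sine[OF L])

lemma sqrt_A_diag: "sqrt_A L = X.diag (freq L)"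
  unfolding sqrt_A_def op_A_diag[OF L] lam_Suc by (rule X.pos_sqrt_diag[OF freq_pos])

lemma hilbert_basis_half: "hilbert_basis (space_half L) (inner_half L) (\<lambda>k. phi L (Suc k))"
proof -
  have "0 < pi / L" using L by simp
  from X.hilbert_basis_dom_diag[where \<sigma> = "freq L", OF this freq_ge]
  show ?thesis
    unfolding space_half_def inner_half_def[abs_def] sqrt_A_diag phi_Suc[symmetric] .
qed

interpretation H: hilbert_basis "space_half L" "inner_half L" "\<lambda>k. phi L (Suc k)"
  by (rule hilbert_basis_half)

lemma space_half_iff: "x \<in> space_half L \<longleftrightarrow> x \<in> space_X L \<and> summable (\<lambda>k. (freq L k * inner x (sine_basis L k))\<^sup>2)"
  unfolding space_half_def sqrt_A_diag by (rule X.dom_diag)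

lemma the_sqrt_A_in: "x \<in> space_half L \<Longrightarrow> the (sqrt_A L x) \<in> space_X L"
  unfolding space_half_def sqrt_A_diag by (rule X.the_diag)

lemma the_sqrt_A_phi: "the (sqrt_A L (phi L (Suc k))) = sine_basis L k"
proof -
  have "sqrt_A L (phi L (Suc k)) = Some (sine_basis L k)"
    using freq_pos[of k] unfolding sqrt_A_diag phi_Suc
    by (auto simp: X.diag_eq_Some_iff inner_commute X.orthonormal)
  then show ?thesis by simp
qed

lemma mode_eq_inner: "mode L x k = inner (the (sqrt_A L x)) (sine_basis L k)"
  by (simp add: mode_def inner_half_def the_sqrt_A_phi)

lemma mode_eq: "x \<in> space_half L \<Longrightarrow> mode L x k = freq L k * inner x (sine_basis L k)"
  unfolding mode_eq_inner space_half_def sqrt_A_diag by (rule X.the_diag)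

lemma norm_half_sums:
  assumes "x \<in> space_half L"
  shows "(\<lambda>k. (mode L x k)\<^sup>2) sums (norm_half L x)\<^sup>2"
proof -
  have "(norm_half L x)\<^sup>2 = inner_half L x x"
    unfolding norm_half_def using H.ip_nonneg[OF assms] by simp
  then show ?thesis using H.parseval[OF assms] by (simp add: mode_def)
qed

lemma lam_inv_pos: "0 < lam_inv L \<mu> k"
  using freq_pos[of k] unfolding lam_inv_def lam_Suc by (intro add_pos_nonneg) auto

lemma lam_inv_le: "lam_inv L \<mu> k \<le> L\<^sup>2 / pi\<^sup>2 + \<mu>\<^sup>2"
proof -
  have "0 < pi / L" using L by simp
  then have "1 / (freq L k)\<^sup>2 \<le> 1 / (pi / L)\<^sup>2"
    using freq_ge[of k] by (intro frac_le power_mono) auto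
  then show ?thesis by (simp add: lam_inv_def lam_Suc power_divide)
qed

lemma lam_mu_eq: "lam_mu L \<mu> (Suc k) = 1 / lam_inv L \<mu> k"
proof -
  have "lam L (Suc k) > 0" using freq_pos[of k] by (simp add: lam_Suc)
  then show ?thesis by (simp add: lam_mu_def lam_inv_def field_simps)
qed

text \<open>The inverse of \<open>op_A\<close> is diagonal in \<open>space_X\<close>, but the root
  is taken in \<open>space_half\<close>. Its bounded factors keep the \<open>freq\<close>-weighted
  coordinates square-summable, so it preserves \<open>space_half\<close> and acts on the modes by
  the same factors.\<close>

lemma op_M_diag: "op_M L \<mu> = H.diag (\<lambda>k. sqrt (lam_inv L \<mu> k))"
proof -
  have "(\<lambda>x. if x \<in> space_half L then Some (the (op_inverse (op_A L) x) + \<mu>\<^sup>2 *\<^sub>R x) else None) =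
      H.diag (\<lambda>k. (sqrt (lam_inv L \<mu> k))\<^sup>2)"
  proof
    fix x
    show "(if x \<in> space_half L then Some (the (op_inverse (op_A L) x) + \<mu>\<^sup>2 *\<^sub>R x) else None) =
      H.diag (\<lambda>k. (sqrt (lam_inv L \<mu> k))\<^sup>2) x"
    proof (cases "x \<in> space_half L")
      case False then show ?thesis by (simp add: H.diag_def)
    next
      case x: True
      then have xX: "x \<in> space_X L" by (simp add: space_half_iff)
      define y where "y = the (op_inverse (op_A L) x)"
      have bd: "\<bar>1 / lam L (Suc k)\<bar> \<le> L\<^sup>2 / pi\<^sup>2" for k
        using lam_inv_le[of 0 k] freq_pos[of k] by (simp add: lam_inv_def lam_Suc)
      have inv: "op_inverse (op_A L) = X.diag (\<lambda>k. 1 / lam L (Suc k))"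
        unfolding op_A_diag[OF L] using freq_pos by (intro X.op_inverse_diag) (auto simp: lam_Suc less_imp_neq[symmetric])
      have "x \<in> dom (X.diag (\<lambda>k. 1 / lam L (Suc k)))" using X.dom_diag_bounded[OF bd] xX by simp
      from X.the_diag[OF this] have y: "y \<in> space_X L"
        "\<And>k. inner y (sine_basis L k) = 1 / lam L (Suc k) * inner x (sine_basis L k)"
        unfolding y_def inv by auto
      have eq: "(\<lambda>k. (freq L k * inner y (sine_basis L k))\<^sup>2) =
          (\<lambda>k. (1 / lam L (Suc k) * (freq L k * inner x (sine_basis L k)))\<^sup>2)"
        by (simp add: y mult_ac)
      have "summable (\<lambda>k. (freq L k * inner y (sine_basis L k))\<^sup>2)" unfolding eq
        using x by (intro H.summable_bounded_mult[OF bd]) (simp add: space_half_iff)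
      then have yH: "y \<in> space_half L" using y by (simp add: space_half_iff)
      have "mode L (y + \<mu>\<^sup>2 *\<^sub>R x) k = lam_inv L \<mu> k * mode L x k" for k
        using mode_eq[OF x] mode_eq[OF yH] x yH
        by (simp add: mode_def H.ip_add H.ip_scaleR y(2) lam_inv_def algebra_simps)
      then have "H.diag (\<lambda>k. (sqrt (lam_inv L \<mu> k))\<^sup>2) x = Some (y + \<mu>\<^sup>2 *\<^sub>R x)"
        using x yH lam_inv_pos by (auto simp: H.diag_eq_Some_iff mode_def less_imp_le)
      then show ?thesis using x by (simp add: y_def)
    qed
  qed
  then show ?thesis
    unfolding op_M_def using lam_inv_pos by (simp add: H.pos_sqrt_diag)
qed

lemma op_K_diag: "op_K L \<mu> = H.diag (\<lambda>k. sqrt (sqrt (lam_inv L \<mu> k)))"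
proof -
  have "op_M L \<mu> = H.diag (\<lambda>k. (sqrt (sqrt (lam_inv L \<mu> k)))\<^sup>2)"
    unfolding op_M_diag using lam_inv_pos by (simp add: less_imp_le)
  then show ?thesis
    unfolding op_K_def using lam_inv_pos by (simp add: H.pos_sqrt_diag)
qed

lemma op_K_sums:
  assumes x: "x \<in> space_half L"
  shows "(\<lambda>k. sqrt (lam_inv L \<mu> k) * (mode L x k)\<^sup>2) sums (norm_half L (the (op_K L \<mu> x)))\<^sup>2"
proof -
  have "\<bar>sqrt (sqrt (lam_inv L \<mu> k))\<bar> \<le> sqrt (sqrt (L\<^sup>2 / pi\<^sup>2 + \<mu>\<^sup>2))" for k
    using lam_inv_le[of \<mu> k] lam_inv_pos[of \<mu> k] by simp
  from H.dom_diag_bounded[OF this] have D: "x \<in> dom (H.diag (\<lambda>k. sqrt (sqrt (lam_inv L \<mu> k))))"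
    using x by simp
  have "(mode L (the (op_K L \<mu> x)) k)\<^sup>2 = sqrt (lam_inv L \<mu> k) * (mode L x k)\<^sup>2" for k
    unfolding op_K_diag mode_def H.the_diag(2)[OF D] using lam_inv_pos[of \<mu> k]
    by (simp add: power_mult_distrib less_imp_le)
  then show ?thesis
    using norm_half_sums[of "the (op_K L \<mu> x)"] H.the_diag(1)[OF D] by (simp add: op_K_diag)
qed

text \<open>\<open>op_J\<close> divides coordinates by \<open>freq\<close>, hence also modes, and
  thus maps \<open>space_half\<close> into itself. The squared factors \<open>1 / lam\<close> and
  the term with \<open>\<mu>^2\<close> add up to \<open>lam_inv\<close>.\<close>

lemma sqnorm_J_sums:
  assumes x: "x \<in> space_half L"
  shows "(\<lambda>k. lam_inv L \<mu> k * (mode L x k)\<^sup>2) sums sqnorm_J L \<mu> x"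
proof -
  have xX: "x \<in> space_X L" using x by (simp add: space_half_iff)
  define y where "y = the (op_J L x)"
  have bd: "\<bar>1 / freq L k\<bar> \<le> L / pi" for k
    using freq_ge[of k] freq_pos[of k] L by (simp add: field_simps)
  have inv: "op_J L = X.diag (\<lambda>k. 1 / freq L k)"
    unfolding op_J_def sqrt_A_diag using freq_pos by (intro X.op_inverse_diag) (auto simp: less_imp_neq[symmetric])
  have "x \<in> dom (X.diag (\<lambda>k. 1 / freq L k))" using X.dom_diag_bounded[OF bd] xX by simp
  from X.the_diag[OF this] have y: "y \<in> space_X L"
    "\<And>k. inner y (sine_basis L k) = 1 / freq L k * inner x (sine_basis L k)"
    unfolding y_def inv by auto
  have eq: "(\<lambda>k. (freq L k * inner y (sine_basis L k))\<^sup>2) =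
      (\<lambda>k. (1 / freq L k * (freq L k * inner x (sine_basis L k)))\<^sup>2)"
    by (simp add: y mult_ac)
  have "summable (\<lambda>k. (freq L k * inner y (sine_basis L k))\<^sup>2)" unfolding eq
    using x by (intro H.summable_bounded_mult[OF bd]) (simp add: space_half_iff)
  then have yH: "y \<in> space_half L" using y by (simp add: space_half_iff)
  have "(mode L y k)\<^sup>2 = 1 / lam L (Suc k) * (mode L x k)\<^sup>2" for k
    using freq_pos[of k] by (simp add: mode_eq[OF x] mode_eq[OF yH] y(2) lam_Suc field_simps power2_eq_square)
  moreover have "(\<lambda>k. (mode L y k)\<^sup>2 + \<mu>\<^sup>2 * (mode L x k)\<^sup>2) sums sqnorm_J L \<mu> x"
    unfolding sqnorm_J_def y_def[symmetric]
    by (intro sums_add sums_mult norm_half_sums x yH)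
  ultimately show ?thesis by (simp add: lam_inv_def distrib_right)
qed

text \<open>Bounded coefficients make the diagonal operator total on \<open>space_half\<close>, so
  the series converges for every \<open>x\<close> there. The shift to \<open>Suc k\<close> matches a
  series that starts at \<open>n = 1\<close>.\<close>

lemma spectral_op_diag:
  assumes bd: "\<And>k. \<bar>f (Suc k)\<bar> \<le> B"
  shows "spectral_op L f = H.diag (\<lambda>k. f (Suc k))"
proof
  fix x
  have sums: "sums_half L (\<lambda>n. (f n * inner_half L x (phi L n)) *\<^sub>R phi L n) y \<longleftrightarrow>
      H.diag (\<lambda>k. f (Suc k)) x = Some y" if x: "x \<in> space_half L" for y
  proof (cases "y \<in> space_half L")
    case True
    have "(\<Sum>n=1..N. (f n * inner_half L x (phi L n)) *\<^sub>R phi L n) =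
        (\<Sum>k<N. (f (Suc k) * inner_half L x (phi L (Suc k))) *\<^sub>R phi L (Suc k))" for N
      using sum.atLeast1_atMost_eq[of "\<lambda>n. (f n * inner_half L x (phi L n)) *\<^sub>R phi L n" N] by simp
    then show ?thesis
      using H.partial_sums_iff_diag[OF x True, of "\<lambda>k. f (Suc k)"] True
      by (simp add: sums_half_def norm_half_def)
  next
    case False then show ?thesis by (auto simp: sums_half_def H.diag_eq_Some_iff)
  qed
  show "spectral_op L f x = H.diag (\<lambda>k. f (Suc k)) x"
  proof (cases "x \<in> space_half L")
    case True
    then obtain y where "H.diag (\<lambda>k. f (Suc k)) x = Some y"
      using H.dom_diag_bounded[of "\<lambda>k. f (Suc k)" B] bd by blast
    moreover have "sums_half L (\<lambda>n. (f n * inner_half L x (phi L n)) *\<^sub>R phi L n) =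
        (\<lambda>y. H.diag (\<lambda>k. f (Suc k)) x = Some y)"
      using sums[OF True] by blast
    ultimately show ?thesis using True by (simp add: spectral_op_def)
  next
    case False then show ?thesis by (simp add: spectral_op_def H.diag_def)
  qed
qed

lemma spectral_op_bounded:
  assumes bd: "\<And>k. \<bar>f (Suc k)\<bar> \<le> B"
  shows "spectral_op L f \<in> bounded_ops_half L"
proof -
  have "norm_half L (the (H.diag (\<lambda>k. f (Suc k)) x)) \<le> \<bar>B\<bar> * norm_half L x" if "x \<in> space_half L" for x
    using H.diag_bounded[of "\<lambda>k. f (Suc k)" B x, OF bd that]
    by (simp add: norm_half_def real_sqrt_mult[symmetric] real_sqrt_abs[symmetric] del: real_sqrt_abs)
  then show ?thesis
    unfolding bounded_ops_half_def spectral_op_diag[of f, OF bd]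
    using H.linear_op_diag H.dom_diag_bounded[of "\<lambda>k. f (Suc k)" B] bd by blast
qed

lemma inner_spectral_op_sums:
  assumes bd: "\<And>k. \<bar>f (Suc k)\<bar> \<le> B" and x: "x \<in> space_half L" and z: "z \<in> space_half L"
  shows "(\<lambda>k. f (Suc k) * (mode L x k * mode L z k)) sums inner_half L x (the (spectral_op L f z))"
proof -
  have D: "z \<in> dom (H.diag (\<lambda>k. f (Suc k)))"
    using H.dom_diag_bounded[of "\<lambda>k. f (Suc k)" B] bd z by blast
  have "(\<lambda>k. mode L x k * (f (Suc k) * mode L z k)) sums inner_half L x (the (spectral_op L f z))"
    unfolding spectral_op_diag[of f, OF bd] mode_def
    using H.parseval_ip[OF x H.the_diag(1)[OF D]] by (simp add: H.the_diag(2)[OF D])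
  then show ?thesis by (simp add: mult_ac)
qed

lemma quad_form_sums:
  assumes bd: "\<And>k. \<bar>p (Suc k)\<bar> \<le> B" "\<And>k. \<bar>q (Suc k)\<bar> \<le> B" "\<And>k. \<bar>r (Suc k)\<bar> \<le> B"
    and x: "x \<in> space_half L" and z: "z \<in> space_half L"
  shows "(\<lambda>k. p (Suc k) / 2 * (mode L x k)\<^sup>2 + q (Suc k) * mode L x k * mode L z k + r (Suc k) / 2 * (mode L z k)\<^sup>2)
    sums quad_form L (spectral_op L p) (spectral_op L q) (spectral_op L r) x z"
proof -
  have "(\<lambda>k. 1 / 2 * (p (Suc k) * (mode L x k * mode L x k)) + q (Suc k) * (mode L x k * mode L z k) +
      1 / 2 * (r (Suc k) * (mode L z k * mode L z k)))
    sums quad_form L (spectral_op L p) (spectral_op L q) (spectral_op L r) x z"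
    unfolding quad_form_def
    by (intro sums_add sums_mult inner_spectral_op_sums[of _ B] x z) (use bd in auto)
  then show ?thesis by (simp add: power2_eq_square mult_ac)
qed

lemma mode_summable: "x \<in> space_half L \<Longrightarrow> summable (\<lambda>k. (mode L x k)\<^sup>2)"
  using norm_half_sums sums_summable by blast

lemma mode_diff: "x \<in> space_half L \<Longrightarrow> y \<in> space_half L \<Longrightarrow> mode L (x - y) k = mode L x k - mode L y k"
  by (simp add: mode_def H.ip_diff)

lemma mode_add: "x \<in> space_half L \<Longrightarrow> y \<in> space_half L \<Longrightarrow> mode L (x + y) k = mode L x k + mode L y k"
  by (simp add: mode_def H.ip_add)

lemma mode_sum_phi:
  "(\<Sum>k<n. a k *\<^sub>R phi L (Suc k)) \<in> space_half L"
  "mode L (\<Sum>k<n. a k *\<^sub>R phi L (Suc k)) j = (if j < n then a j else 0)"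
  using H.coord_sum[where n = n and a = a] by (auto simp: mode_def)

lemma mode_eqI: "x \<in> space_half L \<Longrightarrow> y \<in> space_half L \<Longrightarrow> (\<And>k. mode L x k = mode L y k) \<Longrightarrow> x = y"
  using H.coord_eqI by (simp add: mode_def)

lemma mode_exists: "summable (\<lambda>k. (a k)\<^sup>2) \<Longrightarrow> \<exists>x\<in>space_half L. \<forall>k. mode L x k = a k"
  using H.riesz_fischer by (simp add: mode_def)

lemma space_half_closed:
  "0 \<in> space_half L" "x \<in> space_half L \<Longrightarrow> y \<in> space_half L \<Longrightarrow> x + y \<in> space_half L"
  "x \<in> space_half L \<Longrightarrow> y \<in> space_half L \<Longrightarrow> x - y \<in> space_half L"
  by simp_all

end

section \<open>The scalar linear-quadratic problem\<close>

text \<open>Minus the classical action of a harmonic oscillator, as a function of the elapsed phase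
  \<open>\<phi>\<close>, the start \<open>x\<close> and the target \<open>z\<close>. The angle
  \<open>\<theta>\<close> encodes a soft terminal condition with weight
  \<open>a cot \<theta>\<close>; at \<open>\<theta> = 0\<close> both ends are fixed.\<close>

definition lq_value :: "real \<Rightarrow> real \<Rightarrow> real \<Rightarrow> real \<Rightarrow> real \<Rightarrow> real" where
  "lq_value a \<theta> \<phi> x z =
     a / 2 * ((2 * cos \<theta> * x * z - cos (\<phi> + \<theta>) * x\<^sup>2 - cos \<theta> * cos \<phi> * z\<^sup>2) / sin (\<phi> + \<theta>))"

text \<open>
  \<open>V s = lq_value a \<theta> (\<omega> * (t - s)) (\<xi> s) z\<close> solves the Riccati system, so that the
  running payoff plus \<open>V'\<close> is minus a square.
\<close>

lemma lq_upper_bound: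
  fixes w :: "real \<Rightarrow> real" and x z :: real
  assumes t: "0 \<le> t" and a: "0 < a" and \<omega>: "0 < \<omega>" and \<theta>: "0 < \<theta>" "\<omega> * t + \<theta> < pi"
    and w: "integrable (leb t) w" "integrable (leb t) (\<lambda>s. (w s)\<^sup>2)"
  defines "\<xi> \<equiv> \<lambda>s. x + (\<integral>\<sigma>. w \<sigma> \<partial>leb s)"
  shows "(\<integral>s. a * \<omega> / 2 * (\<xi> s)\<^sup>2 - a / (2 * \<omega>) * (w s)\<^sup>2 \<partial>leb t)
      - a / 2 * (cos \<theta> / sin \<theta>) * (\<xi> t - z)\<^sup>2 \<le> lq_value a \<theta> (\<omega> * t) x z"
proof -
  define \<psi> where "\<psi> s = \<omega> * (t - s)" for s
  have \<psi>: "0 \<le> \<psi> s" "\<psi> s \<le> \<omega> * t" if "s \<in> {0..t}" for s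
    using that \<omega> by (auto simp: \<psi>_def)
  have S: "sin (\<psi> s + \<theta>) > 0" if "s \<in> {0..t}" for s
    using \<psi>[OF that] \<theta> by (intro sin_gt_zero) auto
  have d\<psi>: "(\<psi> has_real_derivative - \<omega>) (at s within T)" for s T
    unfolding \<psi>_def[abs_def] by (auto intro!: derivative_eq_intros)
  have c\<psi>: "continuous_on T \<psi>" for T unfolding \<psi>_def[abs_def] by (intro continuous_intros)
  define A1 where "A1 s = 1 / sin (\<psi> s + \<theta>)" for s
  define A2 where "A2 s = cos (\<psi> s + \<theta>) / sin (\<psi> s + \<theta>)" for s
  define A3 where "A3 s = cos (\<psi> s) / sin (\<psi> s + \<theta>)" for s
  define D1 where "D1 s = \<omega> * cos (\<psi> s + \<theta>) / (sin (\<psi> s + \<theta>))\<^sup>2" for s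
  define D2 where "D2 s = \<omega> / (sin (\<psi> s + \<theta>))\<^sup>2" for s
  define D3 where "D3 s = \<omega> * cos \<theta> / (sin (\<psi> s + \<theta>))\<^sup>2" for s
  have dA1: "(A1 has_real_derivative D1 s) (at s within T)" if "s \<in> {0..t}" for s T
    unfolding A1_def[abs_def] D1_def using S[OF that]
    by (auto intro!: derivative_eq_intros d\<psi> simp: power2_eq_square)
  have dA2: "(A2 has_real_derivative D2 s) (at s within T)" if "s \<in> {0..t}" for s T
  proof -
    let ?S = "sin (\<psi> s + \<theta>)" and ?C = "cos (\<psi> s + \<theta>)"
    have "(A2 has_real_derivative ((- ?S * (- \<omega> + 0)) * ?S
        - ?C * (?C * (- \<omega> + 0))) / (?S * ?S)) (at s within T)"
      unfolding A2_def[abs_def] using S[OF that]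
      by (intro DERIV_divide DERIV_chain2[OF DERIV_sin] DERIV_chain2[OF DERIV_cos] DERIV_add d\<psi> DERIV_const) auto
    also have "(- ?S * (- \<omega> + 0)) * ?S - ?C * (?C * (- \<omega> + 0))
        = \<omega> * ((?S)\<^sup>2 + (?C)\<^sup>2)"
      by algebra
    also have "\<dots> = \<omega>" by simp
    finally show ?thesis by (simp add: D2_def power2_eq_square)
  qed
  have dA3: "(A3 has_real_derivative D3 s) (at s within T)" if "s \<in> {0..t}" for s T
  proof -
    let ?S = "sin (\<psi> s + \<theta>)" and ?C = "cos (\<psi> s + \<theta>)"
    have "(A3 has_real_derivative ((- sin (\<psi> s) * (- \<omega>)) * ?S
        - cos (\<psi> s) * (?C * (- \<omega> + 0))) / (?S * ?S)) (at s within T)"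
      unfolding A3_def[abs_def] using S[OF that]
      by (intro DERIV_divide DERIV_chain2[OF DERIV_sin] DERIV_chain2[OF DERIV_cos] DERIV_add d\<psi> DERIV_const) auto
    moreover have "(- sin (\<psi> s) * (- \<omega>)) * ?S - cos (\<psi> s) * (?C * (- \<omega> + 0))
        = \<omega> * cos ((\<psi> s + \<theta>) - \<psi> s)"
      unfolding cos_diff by (simp add: algebra_simps)
    ultimately show ?thesis by (simp add: D3_def power2_eq_square)
  qed
  have "continuous_on {0..t} D1" "continuous_on {0..t} D2" "continuous_on {0..t} D3"
    unfolding D1_def[abs_def] D2_def[abs_def] D3_def[abs_def] using S
    by (auto intro!: continuous_intros c\<psi> simp: less_imp_neq[symmetric])
  then have acA: "abs_continuous_on 0 t A1" "abs_continuous_on 0 t A2" "abs_continuous_on 0 t A3"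
    using dA1 dA2 dA3 abs_continuous_on_C1[of 0 t A1 D1] abs_continuous_on_C1[of 0 t A2 D2]
      abs_continuous_on_C1[of 0 t A3 D3] by auto
  have ac\<xi>: "abs_continuous_on 0 t \<xi>"
    unfolding \<xi>_def
    by (intro abs_continuous_on_add abs_continuous_on_const abs_continuous_on_indefinite_integral w)
  obtain N where N: "negligible N" "\<And>s. s \<in> {0<..<t} - N \<Longrightarrow>
      ((\<lambda>x. \<integral>\<sigma>. w \<sigma> \<partial>leb x) has_real_derivative w s) (at s)"
    using indefinite_integral_ae_derivative[OF w(1)] by blast
  define V where "V s = a / 2 * (2 * cos \<theta> * z * (A1 s * \<xi> s) + - (A2 s * (\<xi> s * \<xi> s)) + - (cos \<theta> * z\<^sup>2 * A3 s))" for s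
  define V' where "V' s = a / 2 * (2 * cos \<theta> * z * (D1 s * \<xi> s + A1 s * w s)
      - (D2 s * (\<xi> s * \<xi> s) + A2 s * (2 * \<xi> s * w s)) - cos \<theta> * z\<^sup>2 * D3 s)" for s
  have V_eq: "V s = lq_value a \<theta> (\<psi> s) (\<xi> s) z" for s
    unfolding V_def lq_value_def A1_def A2_def A3_def
    by (simp add: diff_divide_distrib add_divide_distrib power2_eq_square mult_ac)
  have "abs_continuous_on 0 t V"
    unfolding V_def[abs_def]
    by (intro abs_continuous_on_add abs_continuous_on_mult abs_continuous_on_uminus abs_continuous_on_const acA ac\<xi>)
  then have hV: "(V' has_integral (V t - V 0)) {0..t}"
  proof (rule abs_continuous_has_integral[OF t])
    \<comment> \<open>The end points join the exceptional set because \<open>N\<close> controls the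
      derivative of the integral only in the open interval.\<close>
    show "negligible (N \<union> {0, t})" using N(1) by (intro negligible_Un) auto
    fix s assume s: "s \<in> {0..t} - (N \<union> {0, t})"
    then have "(\<xi> has_real_derivative 0 + w s) (at s)"
      unfolding \<xi>_def by (intro DERIV_add DERIV_const N(2)) auto
    then have d\<xi>: "(\<xi> has_real_derivative w s) (at s)" by simp
    have sI: "s \<in> {0..t}" using s by auto
    have "(V has_real_derivative V' s) (at s)"
      unfolding V_def[abs_def] V'_def
      by (rule derivative_eq_intros refl dA1[OF sI] dA2[OF sI] dA3[OF sI] d\<xi>)+ (simp add: algebra_simps)
    then show "(V has_real_derivative V' s) (at s within {0..t})"
      by (rule has_field_derivative_at_within)
  qed
  let ?f = "\<lambda>s. a * \<omega> / 2 * (\<xi> s)\<^sup>2 - a / (2 * \<omega>) * (w s)\<^sup>2"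
  have "integrable (leb t) (\<lambda>s. (\<xi> s)\<^sup>2)"
    using abs_continuous_on_imp_continuous_on[OF ac\<xi>]
    by (intro continuous_imp_integrable_real continuous_intros)
  then have fi: "integrable (leb t) ?f" using w(2) by auto
  have hf: "(?f has_integral (\<integral>s. ?f s \<partial>leb t)) {0..t}"
    by (rule has_integral_integral_lebesgue_on[OF fi]) simp
  have "(\<integral>s. ?f s \<partial>leb t) + (V t - V 0) \<le> 0"
  proof (rule has_integral_le[OF has_integral_add[OF hf hV] has_integral_0])
    fix s assume s: "s \<in> {0..t}"
    define X where "X = \<xi> s"
    define W where "W = w s"
    define Si where "Si = sin (\<psi> s + \<theta>)"
    define Co where "Co = cos (\<psi> s + \<theta>)"
    have Si: "Si > 0" using S[OF s] by (simp add: Si_def)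
    have SC: "Co\<^sup>2 = 1 - Si\<^sup>2" by (simp add: Co_def Si_def cos_squared_eq)
    define u where "u = 1 / Si"
    have u2: "Co\<^sup>2 * u\<^sup>2 = u\<^sup>2 - 1" using Si by (simp add: SC u_def field_simps)
    let ?v = "2 * cos \<theta> * z * (\<omega> * Co * u\<^sup>2 * X + u * W)
      - (\<omega> * u\<^sup>2 * X\<^sup>2 + Co * u * (2 * X * W)) - cos \<theta> * z\<^sup>2 * (\<omega> * cos \<theta> * u\<^sup>2)"
    have "V' s = a / 2 * (?v)"
      unfolding V'_def A1_def A2_def D1_def D2_def D3_def Si_def[symmetric] Co_def[symmetric] X_def[symmetric] W_def[symmetric] u_def
      by (simp add: power2_eq_square)
    moreover have "?f s = a / 2 * (\<omega> * X\<^sup>2 - W\<^sup>2 / \<omega>)"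
      using \<omega> by (simp add: X_def W_def field_simps)
    ultimately have "?f s + V' s = a / 2 * ((\<omega> * X\<^sup>2 - W\<^sup>2 / \<omega>) + (?v))"
      by (simp only: distrib_left)
    \<comment> \<open>Completing the square in the velocity \<open>W\<close>: the square vanishes
      exactly for the optimal feedback, and the leftover coefficient of \<open>X^2\<close> is zero
      by \<open>sin^2 + cos^2 = 1\<close>. This is the Riccati equation.\<close>
    also have "(\<omega> * X\<^sup>2 - W\<^sup>2 / \<omega>) + (?v) =
      - (1 / \<omega> * (W - \<omega> * (cos \<theta> * z - Co * X) * u)\<^sup>2) + \<omega> * X\<^sup>2 * (1 - u\<^sup>2 + Co\<^sup>2 * u\<^sup>2)"
      using \<omega> by (simp add: field_simps power2_eq_square)
    also have "1 - u\<^sup>2 + Co\<^sup>2 * u\<^sup>2 = 0" by (simp add: u2)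
    finally have "?f s + V' s = - (a / (2 * \<omega>) * (W - \<omega> * (cos \<theta> * z - Co * X) * u)\<^sup>2)"
      by simp
    then show "?f s + V' s \<le> 0" using a \<omega> by simp
  qed
  \<comment> \<open>At the terminal time the phase \<open>\<psi>\<close> is 0 and the quadratic form
    collapses to the penalty.\<close>
  moreover have "V t = - (a / 2 * (cos \<theta> / sin \<theta>) * (\<xi> t - z)\<^sup>2)"
    unfolding V_eq lq_value_def \<psi>_def
    by (simp add: power2_eq_square algebra_simps diff_divide_distrib add_divide_distrib)
  moreover have "V 0 = lq_value a \<theta> (\<omega> * t) x z"
    unfolding V_eq \<psi>_def \<xi>_def integral_lebesgue_on_point by simp
  ultimately show ?thesis by simp
qed

text \<open>The extremal: it solves \<open>\<xi>'' = - \<omega>^2 \<xi>\<close> with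
  \<open>\<xi> 0 = x\<close> and, at time \<open>t\<close>, the transversality condition
  \<open>\<xi>' = - \<omega> cot \<theta> (\<xi> - z)\<close>. At \<open>\<theta> = 0\<close> that
  condition turns into \<open>\<xi> t = z\<close>, so one formula serves both problems.\<close>

definition lq_traj :: "real \<Rightarrow> real \<Rightarrow> real \<Rightarrow> real \<Rightarrow> real \<Rightarrow> real \<Rightarrow> real" where
  "lq_traj \<omega> \<theta> t x z s = (x * sin (\<omega> * (t - s) + \<theta>) + z * cos \<theta> * sin (\<omega> * s)) / sin (\<omega> * t + \<theta>)"

definition lq_control :: "real \<Rightarrow> real \<Rightarrow> real \<Rightarrow> real \<Rightarrow> real \<Rightarrow> real \<Rightarrow> real" where
  "lq_control \<omega> \<theta> t x z s = \<omega> * (z * cos \<theta> * cos (\<omega> * s) - x * cos (\<omega> * (t - s) + \<theta>)) / sin (\<omega> * t + \<theta>)"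

lemma lq_traj_derivative:
  "(lq_traj \<omega> \<theta> t x z has_real_derivative lq_control \<omega> \<theta> t x z s) (at s within T)"
  unfolding lq_traj_def[abs_def] lq_control_def
  by (cases "sin (\<omega> * t + \<theta>) = 0") (auto intro!: derivative_eq_intros simp: field_simps)

lemma lq_control_derivative:
  "(lq_control \<omega> \<theta> t x z has_real_derivative - (\<omega>\<^sup>2) * lq_traj \<omega> \<theta> t x z s) (at s within T)"
  unfolding lq_traj_def lq_control_def[abs_def]
  by (cases "sin (\<omega> * t + \<theta>) = 0") (auto intro!: derivative_eq_intros simp: field_simps power2_eq_square)

lemma continuous_lq: "continuous_on T (lq_traj \<omega> \<theta> t x z)" "continuous_on T (lq_control \<omega> \<theta> t x z)"
  by (rule DERIV_continuous_on, rule lq_traj_derivative) (rule DERIV_continuous_on, rule lq_control_derivative)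

lemma integral_lq_control:
  assumes "0 \<le> s" "sin (\<omega> * t + \<theta>) \<noteq> 0"
  shows "x + (\<integral>\<sigma>. lq_control \<omega> \<theta> t x z \<sigma> \<partial>leb s) = lq_traj \<omega> \<theta> t x z s"
proof -
  have "(lq_control \<omega> \<theta> t x z has_integral (lq_traj \<omega> \<theta> t x z s - lq_traj \<omega> \<theta> t x z 0)) {0..s}"
    using assms(1) lq_traj_derivative
    by (intro fundamental_theorem_of_calculus) (auto simp: has_real_derivative_iff_has_vector_derivative)
  then have "integral {0..s} (lq_control \<omega> \<theta> t x z) = lq_traj \<omega> \<theta> t x z s - lq_traj \<omega> \<theta> t x z 0"
    by (rule integral_unique)
  moreover have "(\<integral>\<sigma>. lq_control \<omega> \<theta> t x z \<sigma> \<partial>leb s) = integral {0..s} (lq_control \<omega> \<theta> t x z)"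
    by (intro lebesgue_integral_eq_integral continuous_imp_integrable_real continuous_lq) auto
  ultimately show ?thesis using assms(2) by (simp add: lq_traj_def)
qed

text \<open>Since \<open>w' = - \<omega>^2 \<xi>\<close>, the integrand is the derivative of
  \<open>- a / (2 \<omega>) \<xi> w\<close>, and only boundary terms remain.\<close>

lemma lq_running_payoff:
  assumes t: "0 \<le> t" and \<omega>: "0 < \<omega>" and S: "sin (\<omega> * t + \<theta>) \<noteq> 0"
  shows "(\<integral>s. a * \<omega> / 2 * (lq_traj \<omega> \<theta> t x z s)\<^sup>2 - a / (2 * \<omega>) * (lq_control \<omega> \<theta> t x z s)\<^sup>2 \<partial>leb t)
    = a / (2 * \<omega>) * (x * lq_control \<omega> \<theta> t x z 0 - lq_traj \<omega> \<theta> t x z t * lq_control \<omega> \<theta> t x z t)"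
proof -
  let ?\<xi> = "lq_traj \<omega> \<theta> t x z" and ?w = "lq_control \<omega> \<theta> t x z"
  let ?F = "\<lambda>s. - (a / (2 * \<omega>)) * (?\<xi> s * ?w s)"
  let ?f = "\<lambda>s. a * \<omega> / 2 * (?\<xi> s)\<^sup>2 - a / (2 * \<omega>) * (?w s)\<^sup>2"
  have "(?f has_integral (?F t - ?F 0)) {0..t}"
  proof (rule fundamental_theorem_of_calculus[OF t])
    fix s
    have "(?F has_real_derivative - (a / (2 * \<omega>)) * (?w s * ?w s + - (\<omega>\<^sup>2) * ?\<xi> s * ?\<xi> s)) (at s within {0..t})"
      by (intro DERIV_cmult DERIV_mult lq_traj_derivative lq_control_derivative)
    also have "- (a / (2 * \<omega>)) * (?w s * ?w s + - (\<omega>\<^sup>2) * ?\<xi> s * ?\<xi> s) = a * \<omega> / 2 * (?\<xi> s)\<^sup>2 - a / (2 * \<omega>) * (?w s)\<^sup>2"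
      using \<omega> by (simp add: field_simps power2_eq_square)
    finally show "(?F has_vector_derivative a * \<omega> / 2 * (?\<xi> s)\<^sup>2 - a / (2 * \<omega>) * (?w s)\<^sup>2) (at s within {0..t})"
      by (simp only: has_real_derivative_iff_has_vector_derivative)
  qed
  then have "integral {0..t} ?f = ?F t - ?F 0"
    by (rule integral_unique)
  moreover have "integral\<^sup>L (leb t) ?f =
      integral {0..t} ?f"
    by (intro lebesgue_integral_eq_integral continuous_imp_integrable_real continuous_intros continuous_lq) auto
  moreover have "?\<xi> 0 = x" using S by (simp add: lq_traj_def)
  ultimately show ?thesis by (simp add: algebra_simps)
qed

lemma lq_boundary_value:
  assumes \<omega>: "0 < \<omega>" and S: "sin (\<omega> * t + \<theta>) \<noteq> 0"
  shows "a / (2 * \<omega>) * (x * lq_control \<omega> \<theta> t x z 0 - z * lq_control \<omega> \<theta> t x z t) = lq_value a \<theta> (\<omega> * t) x z"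
proof -
  have 1: "a / (2 * \<omega>) * (\<omega> * v) = a / 2 * v" for v using \<omega> by simp
  have 2: "x * lq_control \<omega> \<theta> t x z 0 - z * lq_control \<omega> \<theta> t x z t =
      \<omega> * ((2 * cos \<theta> * x * z - cos (\<omega> * t + \<theta>) * x\<^sup>2 - cos \<theta> * cos (\<omega> * t) * z\<^sup>2) / sin (\<omega> * t + \<theta>))"
    unfolding lq_control_def divide_inverse by (simp add: algebra_simps power2_eq_square)
  show ?thesis unfolding 2 1 lq_value_def ..
qed

text \<open>By the transversality condition \<open>cot\<close>, the penalty equals
  \<open>- a / (2 \<omega>) w (\<xi> - z)\<close> at time \<open>t\<close>. Subtracting it replaces
  \<open>\<xi> t\<close> by \<open>z\<close> in the boundary term, which then is the one of
  \<open>lq_boundary_value\<close>.\<close>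

lemma lq_attained:
  assumes t: "0 \<le> t" and \<omega>: "0 < \<omega>" and S: "sin (\<omega> * t + \<theta>) \<noteq> 0" and \<theta>: "sin \<theta> \<noteq> 0"
  shows "(\<integral>s. a * \<omega> / 2 * (lq_traj \<omega> \<theta> t x z s)\<^sup>2 - a / (2 * \<omega>) * (lq_control \<omega> \<theta> t x z s)\<^sup>2 \<partial>leb t)
    - a / 2 * (cos \<theta> / sin \<theta>) * (lq_traj \<omega> \<theta> t x z t - z)\<^sup>2 = lq_value a \<theta> (\<omega> * t) x z"
proof -
  let ?X = "lq_traj \<omega> \<theta> t x z t" and ?W = "lq_control \<omega> \<theta> t x z t"
  have "?X - z = sin \<theta> * (x - z * cos (\<omega> * t)) / sin (\<omega> * t + \<theta>)"
    using S unfolding lq_traj_def by (simp add: field_simps sin_add)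
  moreover have "?W = - (\<omega> * cos \<theta> * (x - z * cos (\<omega> * t)) / sin (\<omega> * t + \<theta>))"
    unfolding lq_control_def by (simp add: algebra_simps minus_divide_left)
  ultimately have cot: "cos \<theta> / sin \<theta> * (?X - z) = - (?W / \<omega>)"
    using \<theta> \<omega> by simp
  have "a / 2 * (cos \<theta> / sin \<theta>) * (?X - z)\<^sup>2 = a / 2 * (cos \<theta> / sin \<theta> * (?X - z)) * (?X - z)"
    by (simp only: power2_eq_square mult.assoc)
  also have "\<dots> = - (a / (2 * \<omega>)) * ?W * (?X - z)"
    unfolding cot by simp
  finally show ?thesis
    unfolding lq_running_payoff[OF t \<omega> S] lq_boundary_value[OF \<omega> S, symmetric] by (simp add: algebra_simps diff_divide_distrib)
qed

lemma lq_attained_0: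
  assumes t: "0 \<le> t" and \<omega>: "0 < \<omega>" and S: "sin (\<omega> * t) \<noteq> 0"
  shows "(\<integral>s. a * \<omega> / 2 * (lq_traj \<omega> 0 t x z s)\<^sup>2 - a / (2 * \<omega>) * (lq_control \<omega> 0 t x z s)\<^sup>2 \<partial>leb t)
    = lq_value a 0 (\<omega> * t) x z" "lq_traj \<omega> 0 t x z t = z"
proof -
  show z: "lq_traj \<omega> 0 t x z t = z" using S by (simp add: lq_traj_def)
  show "(\<integral>s. a * \<omega> / 2 * (lq_traj \<omega> 0 t x z s)\<^sup>2 - a / (2 * \<omega>) * (lq_control \<omega> 0 t x z s)\<^sup>2 \<partial>leb t)
    = lq_value a 0 (\<omega> * t) x z"
    using lq_running_payoff[OF t \<omega>, of 0 a x z] lq_boundary_value[OF \<omega>, of t 0 a x z] S z by simp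
qed

section \<open>Controls and trajectories in coordinates\<close>

text \<open>For nonnegative terms the sum \<open>F\<close> itself dominates every partial sum, so
  dominated convergence exchanges series and integral.\<close>

lemma sums_integral_nonneg:
  fixes f :: "nat \<Rightarrow> 'a \<Rightarrow> real"
  assumes meas: "\<And>k. f k \<in> borel_measurable M"
    and nonneg: "\<And>k s. s \<in> space M \<Longrightarrow> 0 \<le> f k s"
    and sums: "\<And>s. s \<in> space M \<Longrightarrow> (\<lambda>k. f k s) sums F s"
    and F: "integrable M F"
  shows "integrable M (f k)" "(\<lambda>k. \<integral>s. f k s \<partial>M) sums (\<integral>s. F s \<partial>M)"
proof -
  have le: "(\<Sum>k<n. f k s) \<le> F s" if "s \<in> space M" for n s
    using sum_le_suminf[of "\<lambda>k. f k s" "{..<n}"] sums[OF that] nonneg[OF that]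
    by (auto simp: sums_iff)
  have int: "integrable M (f k)" for k
  proof (rule Bochner_Integration.integrable_bound[OF F meas], rule AE_I2)
    fix s assume s: "s \<in> space M"
    have "f k s \<le> (\<Sum>k<Suc k. f k s)" using nonneg[OF s] by (simp add: sum_nonneg)
    also have "\<dots> \<le> F s" by (rule le[OF s])
    finally show "norm (f k s) \<le> norm (F s)" using nonneg[OF s, of k] by simp
  qed
  then show "integrable M (f k)" .
  have "(\<lambda>n. \<integral>s. (\<Sum>k<n. f k s) \<partial>M) \<longlonglongrightarrow> (\<integral>s. F s \<partial>M)"
  proof (rule integral_dominated_convergence[where w = F])
    show "AE s in M. (\<lambda>n. \<Sum>k<n. f k s) \<longlonglongrightarrow> F s"
      using sums by (intro AE_I2) (simp add: sums_def)
    show "AE s in M. norm (\<Sum>k<n. f k s) \<le> F s" for n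
      using le nonneg by (intro AE_I2) (simp add: sum_nonneg)
  qed (use F int meas in auto)
  then show "(\<lambda>k. \<integral>s. f k s \<partial>M) sums (\<integral>s. F s \<partial>M)"
    using int by (simp add: sums_def Bochner_Integration.integral_sum)
qed

lemma integrable_lebesgue_on_subset:
  fixes f :: "real \<Rightarrow> 'b::{banach, second_countable_topology}"
  assumes "integrable (lebesgue_on S) f" "T \<subseteq> S" "S \<in> sets lebesgue" "T \<in> sets lebesgue"
  shows "integrable (lebesgue_on T) f"
proof -
  have "set_integrable lebesgue S f"
    using assms by (simp add: set_integrable_def integrable_restrict_space)
  from set_integrable_subset[OF this assms(4,2)] have "set_integrable lebesgue T f" .
  then show ?thesis using assms by (simp add: set_integrable_def integrable_restrict_space)
qed

text \<open>This is \<open>op_J\<close> after the orthogonal projection onto \<open>space_X\<close>.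
  Unlike \<open>op_J\<close> it is a total function on \<open>L2\<close>, hence a bounded linear map
  that commutes with the Bochner integral.\<close>

definition half_lift :: "real \<Rightarrow> L2 \<Rightarrow> L2" where
  "half_lift L y = (THE x. x \<in> space_half L \<and> (\<forall>k. mode L x k = inner y (sine_basis L k)))"

context
  fixes L :: real
  assumes L: "0 < L"
begin

interpretation X: hilbert_basis "space_X L" inner "sine_basis L"
  by (rule hilbert_basis_sine[OF L])

interpretation H: hilbert_basis "space_half L" "inner_half L" "\<lambda>k. phi L (Suc k)"
  by (rule hilbert_basis_half[OF L])

lemma half_lift:
  "half_lift L y \<in> space_half L" "mode L (half_lift L y) k = inner y (sine_basis L k)"
proof -
  have "summable (\<lambda>k. (inner y (sine_basis L k))\<^sup>2)"
    by (rule bessel_summable[OF X.orthonormal])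
  then obtain x where x: "x \<in> space_half L" "\<forall>k. mode L x k = inner y (sine_basis L k)"
    using mode_exists[OF L, of "\<lambda>k. inner y (sine_basis L k)"] by blast
  then have "half_lift L y = x"
    unfolding half_lift_def by (intro the_equality) (auto intro: mode_eqI[OF L])
  then show "half_lift L y \<in> space_half L" "mode L (half_lift L y) k = inner y (sine_basis L k)"
    using x by auto
qed

lemma mode_scaleR: "x \<in> space_half L \<Longrightarrow> mode L (r *\<^sub>R x) k = r * mode L x k"
  by (simp add: mode_def H.ip_scaleR)

lemma half_lift_sqrt_A: "x \<in> space_half L \<Longrightarrow> half_lift L (the (sqrt_A L x)) = x"
proof (rule mode_eqI[OF L])
  show "mode L (half_lift L (the (sqrt_A L x))) k = mode L x k" for k
    by (rule trans[OF half_lift(2) mode_eq_inner[OF L, symmetric]])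
qed (auto simp: half_lift)

text \<open>The constant is the reciprocal of the lowest frequency. The argument \<open>y\<close>
  may have a part outside \<open>space_X\<close>, so its coordinates are summed by Bessel's
  inequality instead of Parseval's identity.\<close>

lemma bounded_linear_half_lift: "bounded_linear (half_lift L)"
proof (rule bounded_linear_intro[where K = "L / pi"])
  show "half_lift L (x + y) = half_lift L x + half_lift L y" for x y
    by (rule mode_eqI[OF L]) (auto simp: half_lift mode_add[OF L] inner_add_left)
  show "half_lift L (r *\<^sub>R x) = r *\<^sub>R half_lift L x" for r x
  proof (rule mode_eqI[OF L])
    show "mode L (half_lift L (r *\<^sub>R x)) k = mode L (r *\<^sub>R half_lift L x) k" for k
      by (simp add: half_lift mode_scaleR)
  qed (auto simp: half_lift)
  fix y
  let ?x = "half_lift L y"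
  have xX: "?x \<in> space_X L" using half_lift(1)[of y] by (simp add: space_half_iff[OF L])
  have "(inner ?x (sine_basis L k))\<^sup>2 \<le> (L / pi)\<^sup>2 * (inner y (sine_basis L k))\<^sup>2" for k
  proof -
    have "freq L k * inner ?x (sine_basis L k) = inner y (sine_basis L k)"
      by (rule trans[OF mode_eq[OF L half_lift(1), symmetric] half_lift(2)])
    then have "inner ?x (sine_basis L k) = 1 / freq L k * inner y (sine_basis L k)"
      using freq_pos[OF L, of k] by (simp add: field_simps)
    moreover have "(1 / freq L k)\<^sup>2 \<le> (L / pi)\<^sup>2"
      using freq_ge[OF L, of k] freq_pos[OF L, of k] L by (intro power_mono) (auto simp: field_simps)
    ultimately show ?thesis by (simp only: power_mult_distrib) (rule mult_right_mono, auto)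
  qed
  then have sum_le: "(\<Sum>k<n. (inner ?x (sine_basis L k))\<^sup>2) \<le> (\<Sum>k<n. (L / pi)\<^sup>2 * (inner y (sine_basis L k))\<^sup>2)" for n
    by (rule sum_mono)
  have bound: "(\<Sum>k<n. (inner ?x (sine_basis L k))\<^sup>2) \<le> (L / pi)\<^sup>2 * (norm y)\<^sup>2" for n
    using order_trans[OF sum_le[of n, unfolded sum_distrib_left[symmetric]]
        mult_left_mono[OF bessel[OF X.orthonormal] zero_le_power2]] .
  have "(\<lambda>n. \<Sum>k<n. (inner ?x (sine_basis L k))\<^sup>2) \<longlonglongrightarrow> (norm ?x)\<^sup>2"
    using X.parseval[OF xX] by (simp add: sums_def power2_norm_eq_inner)
  then have "(norm ?x)\<^sup>2 \<le> (L / pi)\<^sup>2 * (norm y)\<^sup>2"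
    by (rule LIMSEQ_le_const2) (use bound in blast)
  then have "(norm ?x)\<^sup>2 \<le> (norm y * (L / pi))\<^sup>2" by (simp only: power_mult_distrib mult.commute)
  then show "norm ?x \<le> norm y * (L / pi)" by (rule power2_le_imp_le) (use L in simp)
qed

lemma norm_half_eq: "norm_half L x = norm (the (sqrt_A L x))"
  by (simp add: norm_half_def inner_half_def norm_eq_sqrt_inner)

lemma control_integrable:
  assumes "w \<in> controls L t"
  shows "integrable (leb t) (\<lambda>s. the (sqrt_A L (w s)))"
proof (rule Bochner_Integration.integrable_bound)
  show "integrable (leb t) (\<lambda>s. 1 + (norm_half L (w s))\<^sup>2)"
    using assms by (auto simp: controls_def intro!: Bochner_Integration.integrable_add continuous_imp_integrable_real)
  have "norm y \<le> 1 + (norm y)\<^sup>2" for y :: L2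
  proof -
    have "2 * norm y \<le> 1 + (norm y)\<^sup>2"
      using zero_le_power2[of "norm y - 1"] by (simp add: power2_diff)
    then show ?thesis using norm_ge_zero[of y] by linarith
  qed
  then show "AE s in leb t. norm (the (sqrt_A L (w s))) \<le> norm (1 + (norm_half L (w s))\<^sup>2)"
    by (intro AE_I2) (simp add: norm_half_eq)
qed (use assms in \<open>simp add: controls_def\<close>)

lemma control_modes:
  assumes w: "w \<in> controls L t"
  shows "integrable (leb t) (\<lambda>s. mode L (w s) k)"
    "integrable (leb t) (\<lambda>s. (mode L (w s) k)\<^sup>2)"
proof -
  show i: "integrable (leb t) (\<lambda>s. mode L (w s) k)"
    unfolding mode_eq_inner[OF L] using control_integrable[OF w] by (rule integrable_inner_left)
  show "integrable (leb t) (\<lambda>s. (mode L (w s) k)\<^sup>2)"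
  proof (rule Bochner_Integration.integrable_bound)
    show "integrable (leb t) (\<lambda>s. (norm_half L (w s))\<^sup>2)" using w by (simp add: controls_def)
    show "(\<lambda>s. (mode L (w s) k)\<^sup>2) \<in> borel_measurable (leb t)"
      using borel_measurable_integrable[OF i] by simp
    show "AE s in leb t. norm ((mode L (w s) k)\<^sup>2) \<le> norm ((norm_half L (w s))\<^sup>2)"
    proof (rule AE_I2)
      fix s assume "s \<in> space (leb t)"
      then have "w s \<in> space_half L" using w by (simp add: controls_def)
      then have "(mode L (w s) k)\<^sup>2 \<le> (norm_half L (w s))\<^sup>2"
        using H.coord_sq_le[of "w s" k] H.ip_nonneg[of "w s"] by (simp add: mode_def norm_half_def)
      then show "norm ((mode L (w s) k)\<^sup>2) \<le> norm ((norm_half L (w s))\<^sup>2)" by simp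
    qed
  qed
qed

text \<open>The integral of a control is formed in \<open>L2\<close>. Writing \<open>w\<close> as
  the lift of \<open>sqrt_A w\<close> and pulling the bounded map out of the integral shows that the
  trajectory stays in \<open>space_half\<close>.\<close>

lemma trajectory_eq:
  assumes w: "w \<in> controls L t" and s: "s \<in> {0..t}"
  shows "trajectory x w s = x + half_lift L (\<integral>\<sigma>. the (sqrt_A L (w \<sigma>)) \<partial>leb s)"
proof -
  have g: "integrable (leb s) (\<lambda>\<sigma>. the (sqrt_A L (w \<sigma>)))"
    using integrable_lebesgue_on_subset[OF control_integrable[OF w], of "{0..s}"] s by auto
  have "(\<integral>\<sigma>. w \<sigma> \<partial>leb s) = (\<integral>\<sigma>. half_lift L (the (sqrt_A L (w \<sigma>))) \<partial>leb s)"
    using w s by (intro Bochner_Integration.integral_cong) (auto simp: controls_def half_lift_sqrt_A)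
  also have "\<dots> = half_lift L (\<integral>\<sigma>. the (sqrt_A L (w \<sigma>)) \<partial>leb s)"
    by (rule integral_bounded_linear[OF bounded_linear_half_lift g])
  finally show ?thesis by (simp add: trajectory_def)
qed

lemma trajectory_modes:
  assumes x: "x \<in> space_half L" and w: "w \<in> controls L t" and s: "s \<in> {0..t}"
  shows "trajectory x w s \<in> space_half L"
    "mode L (trajectory x w s) k = mode L x k + (\<integral>\<sigma>. mode L (w \<sigma>) k \<partial>leb s)"
proof -
  have g: "integrable (leb s) (\<lambda>\<sigma>. the (sqrt_A L (w \<sigma>)))"
    using integrable_lebesgue_on_subset[OF control_integrable[OF w], of "{0..s}"] s by auto
  show "trajectory x w s \<in> space_half L"
    unfolding trajectory_eq[OF w s] using x half_lift(1) by simp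
  show "mode L (trajectory x w s) k = mode L x k + (\<integral>\<sigma>. mode L (w \<sigma>) k \<partial>leb s)"
    unfolding trajectory_eq[OF w s] mode_add[OF L x half_lift(1)] half_lift(2)
    using g by (simp add: mode_eq_inner[OF L])
qed

text \<open>The bound does not depend on \<open>s\<close>; it supplies the dominating constant for
  integrability of the squared norm along the trajectory.\<close>

lemma trajectory_bound:
  assumes x: "x \<in> space_half L" and w: "w \<in> controls L t" and s: "s \<in> {0..t}"
  shows "(norm_half L (trajectory x w s))\<^sup>2 \<le>
    2 * (norm_half L x)\<^sup>2 + 2 * (\<integral>\<sigma>. norm (the (sqrt_A L (w \<sigma>))) \<partial>leb t)\<^sup>2"
proof -
  let ?g = "\<lambda>\<sigma>. the (sqrt_A L (w \<sigma>))"
  define G where "G = (\<integral>\<sigma>. ?g \<sigma> \<partial>leb s)"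
  have gt: "integrable (leb t) (\<lambda>\<sigma>. norm (?g \<sigma>))"
    using control_integrable[OF w] by (rule integrable_norm)
  have "norm G \<le> (\<integral>\<sigma>. norm (?g \<sigma>) \<partial>leb s)"
    unfolding G_def by (rule integral_norm_bound)
  also have "\<dots> = (\<integral>\<sigma>. indicator {0..s} \<sigma> *\<^sub>R norm (?g \<sigma>) \<partial>lebesgue)"
    by (rule integral_restrict_space) simp
  also have "\<dots> \<le> (\<integral>\<sigma>. indicator {0..t} \<sigma> *\<^sub>R norm (?g \<sigma>) \<partial>lebesgue)"
  proof (rule integral_mono)
    show "integrable lebesgue (\<lambda>\<sigma>. indicator {0..s} \<sigma> *\<^sub>R norm (?g \<sigma>))"
      using integrable_lebesgue_on_subset[OF gt, of "{0..s}"] s by (simp add: integrable_restrict_space)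
    show "integrable lebesgue (\<lambda>\<sigma>. indicator {0..t} \<sigma> *\<^sub>R norm (?g \<sigma>))"
      using gt by (simp add: integrable_restrict_space)
  qed (use s in \<open>auto simp: indicator_def\<close>)
  also have "\<dots> = (\<integral>\<sigma>. norm (?g \<sigma>) \<partial>leb t)"
    by (rule integral_restrict_space[symmetric]) simp
  finally have G: "(norm G)\<^sup>2 \<le> (\<integral>\<sigma>. norm (?g \<sigma>) \<partial>leb t)\<^sup>2"
    by (rule power_mono) simp
  have tH: "trajectory x w s \<in> space_half L" by (rule trajectory_modes[OF x w s])
  have "(\<Sum>k<n. (mode L (trajectory x w s) k)\<^sup>2) \<le> 2 * (norm_half L x)\<^sup>2 + 2 * (norm G)\<^sup>2" for n
  proof -
    have "(\<Sum>k<n. (mode L (trajectory x w s) k)\<^sup>2) \<le> (\<Sum>k<n. 2 * (mode L x k)\<^sup>2 + 2 * (inner G (sine_basis L k))\<^sup>2)"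
    proof (rule sum_mono)
      fix k
      have "mode L (trajectory x w s) k = mode L x k + inner G (sine_basis L k)"
        unfolding trajectory_eq[OF w s] mode_add[OF L x half_lift(1)] half_lift(2) G_def ..
      then show "(mode L (trajectory x w s) k)\<^sup>2 \<le> 2 * (mode L x k)\<^sup>2 + 2 * (inner G (sine_basis L k))\<^sup>2"
        using zero_le_power2[of "mode L x k - inner G (sine_basis L k)"] by (simp add: power2_eq_square algebra_simps)
    qed
    also have "\<dots> = 2 * (\<Sum>k<n. (mode L x k)\<^sup>2) + 2 * (\<Sum>k<n. (inner G (sine_basis L k))\<^sup>2)"
      by (simp add: sum.distrib sum_distrib_left)
    also have "\<dots> \<le> 2 * (norm_half L x)\<^sup>2 + 2 * (norm G)\<^sup>2"
    proof -
      have "(\<Sum>k<n. (mode L x k)\<^sup>2) \<le> (norm_half L x)\<^sup>2"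
        using sum_le_suminf[OF mode_summable[OF L x], of "{..<n}"] sums_unique[OF norm_half_sums[OF L x]] by simp
      then show ?thesis using bessel[OF X.orthonormal, where n = n and x = G] by linarith
    qed
    finally show ?thesis .
  qed
  then have "(norm_half L (trajectory x w s))\<^sup>2 \<le> 2 * (norm_half L x)\<^sup>2 + 2 * (norm G)\<^sup>2"
    using norm_half_sums[OF L tH] unfolding sums_def by (intro LIMSEQ_le_const2) auto
  then show ?thesis using G by linarith
qed

text \<open>The integrand has no sign, so its two nonnegative parts are summed and integrated
  separately and subtracted afterwards. Their measurability comes from the partial sums over
  modes.\<close>

lemma running_payoff_sums:
  assumes x: "x \<in> space_half L" and w: "w \<in> controls L t"
  shows "(\<lambda>k. \<integral>s. \<kappa> / 2 * (mode L x k + (\<integral>\<sigma>. mode L (w \<sigma>) k \<partial>leb s))\<^sup>2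
        - M / 2 * lam_inv L \<mu> k * (mode L (w s) k)\<^sup>2 \<partial>leb t)
    sums (\<integral>s. \<kappa> / 2 * (norm_half L (trajectory x w s))\<^sup>2 - M / 2 * sqnorm_J L \<mu> (w s) \<partial>leb t)"
proof -
  let ?M = "leb t"
  let ?q = "\<lambda>k s. lam_inv L \<mu> k * (mode L (w s) k)\<^sup>2"
  define \<xi> where "\<xi> k s = mode L x k + (\<integral>\<sigma>. mode L (w \<sigma>) k \<partial>leb s)" for k s
  have traj: "trajectory x w s \<in> space_half L" "mode L (trajectory x w s) k = \<xi> k s" if "s \<in> {0..t}" for s k
    using trajectory_modes[OF x w that] by (auto simp: \<xi>_def)
  have wH: "w s \<in> space_half L" if "s \<in> {0..t}" for s using w that by (simp add: controls_def)
  have sums1: "(\<lambda>k. (\<xi> k s)\<^sup>2) sums (norm_half L (trajectory x w s))\<^sup>2" if "s \<in> {0..t}" for s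
    using norm_half_sums[OF L traj(1)[OF that]] by (simp add: traj(2)[OF that])
  have sums2: "(\<lambda>k. ?q k s) sums sqnorm_J L \<mu> (w s)" if "s \<in> {0..t}" for s
    using sqnorm_J_sums[OF L wH[OF that]] .
  have "continuous_on {0..t} (\<xi> k)" for k
    unfolding \<xi>_def[abs_def]
    by (intro abs_continuous_on_imp_continuous_on abs_continuous_on_add abs_continuous_on_const
        abs_continuous_on_indefinite_integral control_modes w)
  then have m1: "(\<lambda>s. (\<xi> k s)\<^sup>2) \<in> borel_measurable ?M" for k
    by (intro continuous_imp_measurable_on_sets_lebesgue continuous_intros) auto
  have m2: "(\<lambda>s. ?q k s) \<in> borel_measurable ?M" for k
    using borel_measurable_integrable[OF control_modes(2)[OF w]] by simp
  have i1: "integrable ?M (\<lambda>s. (norm_half L (trajectory x w s))\<^sup>2)"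
  proof (rule Bochner_Integration.integrable_bound)
    let ?C = "2 * (norm_half L x)\<^sup>2 + 2 * (\<integral>\<sigma>. norm (the (sqrt_A L (w \<sigma>))) \<partial>leb t)\<^sup>2"
    show "integrable ?M (\<lambda>_. ?C)"
      by (intro continuous_imp_integrable_real continuous_intros)
    show "AE s in ?M. norm ((norm_half L (trajectory x w s))\<^sup>2) \<le> norm ?C"
      using trajectory_bound[OF x w] by (intro AE_I2) (auto intro: order_trans)
    show "(\<lambda>s. (norm_half L (trajectory x w s))\<^sup>2) \<in> borel_measurable ?M"
      by (rule borel_measurable_LIMSEQ_metric[where f = "\<lambda>n s. \<Sum>k<n. (\<xi> k s)\<^sup>2"])
         (use sums1 m1 in \<open>auto simp: sums_def\<close>)
  qed
  have i2: "integrable ?M (\<lambda>s. sqnorm_J L \<mu> (w s))"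
  proof (rule Bochner_Integration.integrable_bound)
    let ?C = "L\<^sup>2 / pi\<^sup>2 + \<mu>\<^sup>2"
    show "integrable ?M (\<lambda>s. ?C * (norm_half L (w s))\<^sup>2)" using w by (simp add: controls_def)
    show "(\<lambda>s. sqnorm_J L \<mu> (w s)) \<in> borel_measurable ?M"
      by (rule borel_measurable_LIMSEQ_metric[where f = "\<lambda>n s. \<Sum>k<n. ?q k s"])
         (use sums2 m2 in \<open>auto simp: sums_def\<close>)
    show "AE s in ?M. norm (sqnorm_J L \<mu> (w s)) \<le> norm (?C * (norm_half L (w s))\<^sup>2)"
    proof (rule AE_I2)
      fix s assume "s \<in> space ?M"
      then have s: "s \<in> {0..t}" by simp
      have "sqnorm_J L \<mu> (w s) \<le> ?C * (norm_half L (w s))\<^sup>2"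
        by (rule sums_le[OF _ sums2[OF s] sums_mult[OF norm_half_sums[OF L wH[OF s]]]])
           (intro mult_right_mono lam_inv_le[OF L] zero_le_power2)
      moreover have "0 \<le> sqnorm_J L \<mu> (w s)" by (simp add: sqnorm_J_def)
      ultimately show "norm (sqnorm_J L \<mu> (w s)) \<le> norm (?C * (norm_half L (w s))\<^sup>2)" by simp
    qed
  qed
  have li: "0 \<le> lam_inv L \<mu> k" for k using lam_inv_pos[OF L, of \<mu> k] by simp
  note s1 = sums_integral_nonneg[of "\<lambda>k s. (\<xi> k s)\<^sup>2" ?M, OF m1 _ _ i1, simplified, OF sums1]
  note s2 = sums_integral_nonneg[of "\<lambda>k s. ?q k s" ?M, OF m2 _ _ i2]
  have s2a: "integrable ?M (\<lambda>s. ?q k s)" for k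
    using s2(1) li sums2 by simp
  have s2b: "(\<lambda>k. \<integral>s. ?q k s \<partial>?M) sums (\<integral>s. sqnorm_J L \<mu> (w s) \<partial>?M)"
    using s2(2) li sums2 by simp
  have "(\<lambda>k. \<kappa> / 2 * (\<integral>s. (\<xi> k s)\<^sup>2 \<partial>?M) - M / 2 * (\<integral>s. ?q k s \<partial>?M)) sums
      (\<kappa> / 2 * (\<integral>s. (norm_half L (trajectory x w s))\<^sup>2 \<partial>?M) - M / 2 * (\<integral>s. sqnorm_J L \<mu> (w s) \<partial>?M))"
    using s1(2) s2b by (intro sums_diff sums_mult) auto
  also have "(\<lambda>k. \<kappa> / 2 * (\<integral>s. (\<xi> k s)\<^sup>2 \<partial>?M) - M / 2 * (\<integral>s. ?q k s \<partial>?M)) =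
      (\<lambda>k. \<integral>s. \<kappa> / 2 * (\<xi> k s)\<^sup>2 - M / 2 * (?q k s) \<partial>?M)"
    using s1(1) s2a by simp
  also have "\<kappa> / 2 * (\<integral>s. (norm_half L (trajectory x w s))\<^sup>2 \<partial>?M) - M / 2 * (\<integral>s. sqnorm_J L \<mu> (w s) \<partial>?M) =
      (\<integral>s. \<kappa> / 2 * (norm_half L (trajectory x w s))\<^sup>2 - M / 2 * sqnorm_J L \<mu> (w s) \<partial>?M)"
    using i1 i2 by simp
  finally show ?thesis by (simp only: \<xi>_def mult.assoc)
qed

lemma finite_mode_control:
  fixes n :: nat
  assumes a: "\<And>k. continuous_on {0..t} (a k)" and v: "v \<in> space_half L"
  defines "w \<equiv> \<lambda>s. (\<Sum>k<n. a k s *\<^sub>R phi L (Suc k)) + v"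
  shows "w \<in> controls L t" "mode L (w s) j = (if j < n then a j s else 0) + mode L v j"
proof -
  have wH: "w s \<in> space_half L" for s
    unfolding w_def using v mode_sum_phi(1)[OF L] by simp
  show mode: "mode L (w s) j = (if j < n then a j s else 0) + mode L v j" for s j
    unfolding w_def using v mode_sum_phi[OF L, of "\<lambda>k. a k s" n] by (simp add: mode_add[OF L])
  define g where "g s = (\<Sum>k<n. a k s *\<^sub>R sine_basis L k) + the (sqrt_A L v)" for s
  have g: "the (sqrt_A L (w s)) = g s" for s
  proof (rule X.coord_eqI)
    show "the (sqrt_A L (w s)) \<in> space_X L" by (rule the_sqrt_A_in[OF L wH])
    show "g s \<in> space_X L"
      unfolding g_def using the_sqrt_A_in[OF L v] X.coord_sum[where a = "\<lambda>k. a k s"] by simp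
    show "inner (the (sqrt_A L (w s))) (sine_basis L k) = inner (g s) (sine_basis L k)" for k
      using mode[of s k] X.coord_sum[where a = "\<lambda>k. a k s" and n = n and j = k]
      by (simp add: mode_eq_inner[OF L] g_def inner_add_left)
  qed
  have cg: "continuous_on {0..t} g"
    unfolding g_def[abs_def] by (intro continuous_intros a)
  show "w \<in> controls L t"
    unfolding controls_def mem_Collect_eq norm_half_eq g using wH cg
    by (auto intro!: continuous_imp_measurable_on_sets_lebesgue continuous_imp_integrable_real continuous_intros)
qed

end

section \<open>The value functions\<close>

lemma sqrt2_less_pi_half: "sqrt 2 < pi / 2"
proof -
  have "sqrt 2 < sqrt ((3 / 2)\<^sup>2)" by (subst real_sqrt_less_iff) (simp add: power2_eq_square)
  then show ?thesis using pi_gt3 by simp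
qed

lemma c_bar_pos: "0 < m \<Longrightarrow> 0 < \<kappa> \<Longrightarrow> 0 < c_bar \<kappa> m"
  unfolding c_bar_def using sqrt2_less_pi_half by (intro mult_pos_pos tan_gt_zero) auto

lemma theta_pos: "0 < m \<Longrightarrow> 0 < \<kappa> \<Longrightarrow> 0 < c \<Longrightarrow> 0 < theta \<kappa> m c"
  by (simp add: theta_def zero_less_arctan_iff)

text \<open>At \<open>c = c_bar\<close> the angle equals \<open>pi / 2 - sqrt 2\<close>, because the
  cotangent of \<open>sqrt 2\<close> is the tangent of the complementary angle; larger
  \<open>c\<close> makes it smaller.\<close>

lemma theta_less:
  assumes "0 < m" "0 < \<kappa>" and c: "c_bar \<kappa> m < c"
  shows "theta \<kappa> m c < pi / 2 - sqrt 2"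
proof -
  have tan: "0 < tan (sqrt 2)" using sqrt2_less_pi_half by (intro tan_gt_zero) auto
  have c0: "0 < c" using c_bar_pos[OF assms(1,2)] c by simp
  have "sqrt (m * \<kappa>) * tan (sqrt 2) < c" using c by (simp add: c_bar_def)
  then have "sqrt (m * \<kappa>) / c < inverse (tan (sqrt 2))"
    using tan c0 by (simp add: field_simps)
  also have "\<dots> = tan (pi / 2 - sqrt 2)" by (rule tan_cot[symmetric])
  finally have "theta \<kappa> m c < arctan (tan (pi / 2 - sqrt 2))"
    unfolding theta_def by (simp add: arctan_less_iff)
  also have "\<dots> = pi / 2 - sqrt 2"
  proof (rule arctan_tan)
    have "0 < sqrt (2 :: real)" by simp
    then show "- (pi / 2) < pi / 2 - sqrt 2" "pi / 2 - sqrt 2 < pi / 2"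
      using sqrt2_less_pi_half by linarith+
  qed
  finally show ?thesis .
qed

lemma theta_tendsto: "(theta \<kappa> m \<longlongrightarrow> 0) at_top"
proof -
  have "((\<lambda>c. sqrt (m * \<kappa>) / c) \<longlongrightarrow> 0) at_top"
    by (rule tendsto_divide_0[OF tendsto_const filterlim_at_top_imp_at_infinity[OF filterlim_ident]])
  from tendsto_arctan[OF this] show ?thesis by (simp add: theta_def[abs_def])
qed

lemma lq_value_coefficients:
  "lq_value a \<theta> \<phi> x z = - (a * cos (\<phi> + \<theta>) / sin (\<phi> + \<theta>)) / 2 * x\<^sup>2
     + a * cos \<theta> / sin (\<phi> + \<theta>) * x * z + - (a * (cos \<theta> * cos \<phi>) / sin (\<phi> + \<theta>)) / 2 * z\<^sup>2"
  by (simp add: lq_value_def diff_divide_distrib add_divide_distrib algebra_simps)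

lemma abs_mult_divide_le:
  fixes a u S :: real
  assumes "0 \<le> a" "a \<le> b" "\<bar>u\<bar> \<le> 1" "0 < s" "s \<le> S"
  shows "\<bar>a * u / S\<bar> \<le> b / s"
proof -
  have "\<bar>a * u / S\<bar> = a * \<bar>u\<bar> / S" using assms by (simp add: abs_mult)
  also have "\<dots> \<le> b / s"
    using assms mult_mono[of a b "\<bar>u\<bar>" 1] by (intro frac_le) auto
  finally show ?thesis .
qed

lemma abs_cos_mult_le: "\<bar>cos x * cos y\<bar> \<le> (1 :: real)"
  unfolding abs_mult using mult_mono[of "\<bar>cos x\<bar>" 1 "\<bar>cos y\<bar>" 1] by simp

text \<open>The bound is free of \<open>\<theta>\<close> and \<open>\<phi>\<close> except through
  the lower bound \<open>s\<close> of the denominator, so it can dominate a series uniformly in the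
  penalty.\<close>

lemma abs_lq_value_le:
  assumes "0 \<le> a" "a \<le> b" "0 < s" "s \<le> sin (\<phi> + \<theta>)"
  shows "\<bar>lq_value a \<theta> \<phi> x z\<bar> \<le> b / s * (x\<^sup>2 + z\<^sup>2)"
proof -
  note c = abs_mult_divide_le[OF assms(1,2) _ assms(3,4)]
  have p: "\<bar>a * cos (\<phi> + \<theta>) / sin (\<phi> + \<theta>)\<bar> \<le> b / s" and q: "\<bar>a * cos \<theta> / sin (\<phi> + \<theta>)\<bar> \<le> b / s"
    and r: "\<bar>a * (cos \<theta> * cos \<phi>) / sin (\<phi> + \<theta>)\<bar> \<le> b / s"
    by (intro c abs_cos_le_one abs_cos_mult_le)+
  define P where "P = a * cos (\<phi> + \<theta>) / sin (\<phi> + \<theta>)"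
  define Q where "Q = a * cos \<theta> / sin (\<phi> + \<theta>)"
  define R where "R = a * (cos \<theta> * cos \<phi>) / sin (\<phi> + \<theta>)"
  define B where "B = b / s"
  have B: "0 \<le> B" using order_trans[OF abs_ge_zero q] by (simp add: B_def)
  have "\<bar>x * z\<bar> \<le> (x\<^sup>2 + z\<^sup>2) / 2"
    using zero_le_power2[of "\<bar>x\<bar> - \<bar>z\<bar>"] by (simp add: power2_diff abs_mult)
  then have "\<bar>Q * (x * z)\<bar> \<le> B * ((x\<^sup>2 + z\<^sup>2) / 2)"
    unfolding abs_mult[of Q] using q B by (intro mult_mono) (auto simp: Q_def B_def)
  moreover have "\<bar>P * x\<^sup>2\<bar> \<le> B * x\<^sup>2" "\<bar>R * z\<^sup>2\<bar> \<le> B * z\<^sup>2"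
    using p[folded P_def B_def] r[folded R_def B_def] by (simp_all add: abs_mult mult_right_mono)
  moreover have "lq_value a \<theta> \<phi> x z = - (P * x\<^sup>2) / 2 + Q * (x * z) - (R * z\<^sup>2) / 2"
    unfolding lq_value_coefficients P_def Q_def R_def by simp
  ultimately have "\<bar>lq_value a \<theta> \<phi> x z\<bar> \<le> B * x\<^sup>2 / 2 + B * ((x\<^sup>2 + z\<^sup>2) / 2) + B * z\<^sup>2 / 2" by linarith
  then show ?thesis by (simp add: B_def algebra_simps add_divide_distrib)
qed

text \<open>The truncation argument in the abstract: \<open>f\<close> holds the optimal values of
  the modes, \<open>g\<close> those of the tail control, \<open>P n\<close> is the payoff with
  \<open>n\<close> modes steered optimally. The case \<open>n = 0\<close> says that \<open>g\<close>
  is summable, so \<open>P n\<close> differs from its sum by the finite sum of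
  \<open>f - g\<close>.\<close>

lemma replaced_head_sums_tendsto:
  fixes f g :: "nat \<Rightarrow> real"
  assumes f: "f sums F" and h: "\<And>n. (\<lambda>k. if k < n then f k else g k) sums P n"
  shows "P \<longlonglongrightarrow> F"
proof -
  define G where "G = P 0"
  have g: "g sums G" using h[of 0] by (simp add: G_def)
  have "P n = (\<Sum>k<n. f k) - (\<Sum>k<n. g k) + G" for n
  proof -
    have "(\<lambda>k. (if k \<in> {..<n} then f k - g k else 0) + g k) sums ((\<Sum>k<n. f k - g k) + G)"
      by (intro sums_add g sums_If_finite_set) auto
    also have "(\<lambda>k. (if k \<in> {..<n} then f k - g k else 0) + g k) = (\<lambda>k. if k < n then f k else g k)" by auto
    finally show ?thesis using sums_unique2[OF h[of n]] by (simp add: sum_subtractf)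
  qed
  then have "P = (\<lambda>n. (\<Sum>k<n. f k) - (\<Sum>k<n. g k) + G)" by blast
  moreover have "(\<lambda>n. (\<Sum>k<n. f k) - (\<Sum>k<n. g k) + G) \<longlonglongrightarrow> F - G + G"
    using f g unfolding sums_def by (intro tendsto_add tendsto_diff tendsto_const)
  ultimately show ?thesis by simp
qed

context
  fixes L \<kappa> m \<mu> t :: real
  assumes L: "0 < L" and \<kappa>: "0 < \<kappa>" and m: "0 < m" and \<mu>: "0 < \<mu>"
    and t: "0 \<le> t" "t < t_bar \<kappa> m \<mu>"
begin

abbreviation (input) "\<beta> \<equiv> lam_inv L \<mu>"
abbreviation (input) "A k \<equiv> 1 / alpha L \<kappa> m \<mu> (Suc k)"
abbreviation (input) "\<Omega> k \<equiv> omega L \<kappa> m \<mu> (Suc k)"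

lemma A_eq: "A k = sqrt (m * \<kappa>) * sqrt (\<beta> k)"
  using lam_inv_pos[OF L, of \<mu> k] m \<kappa>
  by (simp add: alpha_def lam_mu_eq[OF L] real_sqrt_divide real_sqrt_mult)

lemma \<Omega>_eq: "\<Omega> k = sqrt (\<kappa> / (m * \<beta> k))"
  by (simp add: omega_def lam_mu_eq[OF L])

lemma A_pos: "0 < A k"
  unfolding A_eq using lam_inv_pos[OF L, of \<mu> k] m \<kappa> by simp

lemma \<Omega>_pos: "0 < \<Omega> k"
  unfolding \<Omega>_eq using lam_inv_pos[OF L, of \<mu> k] m \<kappa> by simp

lemma A_le: "A k \<le> sqrt (m * \<kappa>) * sqrt (L\<^sup>2 / pi\<^sup>2 + \<mu>\<^sup>2)"
  unfolding A_eq using lam_inv_le[OF L, of \<mu> k] m \<kappa> by (intro mult_left_mono) auto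

text \<open>With \<open>A_over_\<Omega>\<close>, the dictionary to the scalar problem: the weights
  \<open>\<kappa> / 2\<close> and \<open>m \<beta> / 2\<close> of a mode become
  \<open>a \<omega> / 2\<close> and \<open>a / (2 \<omega>)\<close>.\<close>

lemma A_times_\<Omega>: "A k * \<Omega> k = \<kappa>"
proof -
  have b: "\<beta> k > 0" by (rule lam_inv_pos[OF L])
  have "A k * \<Omega> k = sqrt ((m * \<kappa>) * \<beta> k * (\<kappa> / (m * \<beta> k)))"
    unfolding A_eq \<Omega>_eq by (simp only: real_sqrt_mult)
  also have "(m * \<kappa>) * \<beta> k * (\<kappa> / (m * \<beta> k)) = \<kappa>\<^sup>2"
    using b m by (simp add: field_simps power2_eq_square)
  finally show ?thesis using \<kappa> by simp
qed

lemma A_over_\<Omega>: "A k / \<Omega> k = m * \<beta> k"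
proof -
  have b: "\<beta> k > 0" by (rule lam_inv_pos[OF L])
  have "A k / \<Omega> k = sqrt ((m * \<kappa>) * \<beta> k / (\<kappa> / (m * \<beta> k)))"
    unfolding A_eq \<Omega>_eq by (simp only: real_sqrt_mult real_sqrt_divide)
  also have "(m * \<kappa>) * \<beta> k / (\<kappa> / (m * \<beta> k)) = (m * \<beta> k)\<^sup>2"
    using b \<kappa> by (simp add: field_simps power2_eq_square)
  finally show ?thesis using m b by simp
qed

text \<open>Both \<open>A k\<close> and the terminal weight \<open>c sqrt (\<beta> k)\<close> scale
  like \<open>sqrt (\<beta> k)\<close>; their ratio, and with it the angle, is therefore common to
  all modes.\<close>

lemma A_cot_theta:
  assumes c: "0 < c"
  shows "A k * (cos (theta \<kappa> m c) / sin (theta \<kappa> m c)) = c * sqrt (\<beta> k)"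
proof -
  have "tan (theta \<kappa> m c) = sqrt (m * \<kappa>) / c" by (simp add: theta_def tan_arctan)
  then have "cos (theta \<kappa> m c) / sin (theta \<kappa> m c) = c / sqrt (m * \<kappa>)"
    by (metis inverse_divide tan_def)
  then show ?thesis unfolding A_eq using m \<kappa> by simp
qed

text \<open>As \<open>\<beta> k\<close> is at least \<open>\<mu>^2\<close>, no frequency exceeds
  \<open>sqrt (\<kappa> / m) / \<mu>\<close>, and \<open>t_bar\<close> is \<open>sqrt 2\<close>
  divided by this bound.\<close>

lemma \<Omega>_t_less: "\<Omega> k * t < sqrt 2"
proof -
  have b: "\<mu>\<^sup>2 \<le> \<beta> k" "0 < \<mu>\<^sup>2" using freq_pos[OF L, of k] \<mu> by (auto simp: lam_inv_def lam_Suc)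
  have "t\<^sup>2 < (t_bar \<kappa> m \<mu>)\<^sup>2" using t by (intro power_strict_mono) auto
  also have "\<dots> = 2 * (m * \<mu>\<^sup>2 / \<kappa>)" using m \<kappa> by (simp add: t_bar_def power_mult_distrib)
  finally have "\<kappa> / (m * \<mu>\<^sup>2) * t\<^sup>2 < \<kappa> / (m * \<mu>\<^sup>2) * (2 * (m * \<mu>\<^sup>2 / \<kappa>))"
    using \<kappa> m b by (intro mult_strict_left_mono) auto
  also have "\<dots> = 2" using \<kappa> m b by simp
  finally have "\<kappa> / (m * \<mu>\<^sup>2) * t\<^sup>2 < 2" .
  moreover have "\<kappa> / (m * \<beta> k) * t\<^sup>2 \<le> \<kappa> / (m * \<mu>\<^sup>2) * t\<^sup>2"
    using \<kappa> m b by (intro mult_right_mono frac_le mult_left_mono) auto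
  moreover have "(\<Omega> k)\<^sup>2 = \<kappa> / (m * \<beta> k)"
    unfolding \<Omega>_eq using \<kappa> m lam_inv_pos[OF L, of \<mu> k] by (intro real_sqrt_pow2) simp
  ultimately have "(\<Omega> k * t)\<^sup>2 < 2"
    unfolding power_mult_distrib by simp
  then show ?thesis by (rule real_less_rsqrt)
qed

lemma \<Omega>_mono: "\<Omega> 0 \<le> \<Omega> k"
proof -
  have "freq L 0 \<le> freq L k" using L by (simp add: freq_def field_simps)
  then have "1 / (freq L k)\<^sup>2 \<le> 1 / (freq L 0)\<^sup>2"
    using freq_pos[OF L, of 0] by (intro frac_le power_mono) auto
  then have "\<beta> k \<le> \<beta> 0" by (simp add: lam_inv_def lam_Suc)
  then show ?thesis
    unfolding \<Omega>_eq using lam_inv_pos[OF L, of \<mu> k] m \<kappa> by (intro real_sqrt_le_mono frac_le mult_left_mono) auto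
qed

text \<open>The mode contributes less than \<open>sqrt 2\<close> and \<open>\<theta>\<close> at most
  the rest of the way to \<open>pi / 2\<close>, so both phases lie where the sine increases.\<close>

lemma sin_mono_bound:
  assumes "0 \<le> \<phi>\<^sub>0" "\<phi>\<^sub>0 \<le> \<Omega> k * t + \<theta>" "\<theta> \<le> pi / 2 - sqrt 2"
  shows "sin \<phi>\<^sub>0 \<le> sin (\<Omega> k * t + \<theta>)"
  using assms \<Omega>_t_less[of k] by (intro sin_monotone_2pi_le) auto

lemma p_c_eq: "p_c L \<kappa> m \<mu> c t (Suc k) = - (A k * cos (\<Omega> k * t + theta \<kappa> m c) / sin (\<Omega> k * t + theta \<kappa> m c))"
  by (simp add: p_c_def tan_def)

lemma cos_theta_eq: "sqrt (1 / (1 + (sqrt (m * \<kappa>) / c)\<^sup>2)) = cos (theta \<kappa> m c)"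
  by (simp add: theta_def cos_arctan real_sqrt_divide)

lemma q_c_eq: "q_c L \<kappa> m \<mu> c t (Suc k) = A k * cos (theta \<kappa> m c) / sin (\<Omega> k * t + theta \<kappa> m c)"
  unfolding q_c_def cos_theta_eq by simp

text \<open>Rests on \<open>tan \<theta> + cot (\<phi> + \<theta>) = cos \<phi> / (cos \<theta> sin
  (\<phi> + \<theta>))\<close>, which brings the coefficient to the form of
  \<open>lq_value_coefficients\<close>.\<close>

lemma r_c_eq:
  assumes S: "sin (\<Omega> k * t + theta \<kappa> m c) \<noteq> 0"
  shows "r_c L \<kappa> m \<mu> c t (Suc k) = - (A k * (cos (theta \<kappa> m c) * cos (\<Omega> k * t)) / sin (\<Omega> k * t + theta \<kappa> m c))"
proof -
  define \<theta> where "\<theta> = theta \<kappa> m c"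
  define \<phi> where "\<phi> = \<Omega> k * t"
  have c0: "cos \<theta> \<noteq> 0" by (simp add: \<theta>_def theta_def)
  have "0 \<le> 1 / (1 + (sqrt (m * \<kappa>) / c)\<^sup>2)" by simp
  then have "1 / (1 + (sqrt (m * \<kappa>) / c)\<^sup>2) = (sqrt (1 / (1 + (sqrt (m * \<kappa>) / c)\<^sup>2)))\<^sup>2" by simp
  then have 1: "1 / (1 + (sqrt (m * \<kappa>) / c)\<^sup>2) = (cos \<theta>)\<^sup>2"
    unfolding cos_theta_eq \<theta>_def .
  have 2: "sqrt (m * \<kappa>) / c = sin \<theta> / cos \<theta>"
    using tan_arctan[of "sqrt (m * \<kappa>) / c"] by (simp add: \<theta>_def theta_def tan_def)
  have "(cos \<theta>)\<^sup>2 * (sin \<theta> / cos \<theta> + cos (\<phi> + \<theta>) / sin (\<phi> + \<theta>)) =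
      cos \<theta> * (cos (\<phi> + \<theta>) * cos \<theta> + sin (\<phi> + \<theta>) * sin \<theta>) / sin (\<phi> + \<theta>)"
    using c0 S by (simp add: \<phi>_def \<theta>_def field_simps power2_eq_square)
  also have "cos (\<phi> + \<theta>) * cos \<theta> + sin (\<phi> + \<theta>) * sin \<theta> = cos \<phi>"
    using cos_diff[of "\<phi> + \<theta>" \<theta>] by simp
  finally have 3: "(cos \<theta>)\<^sup>2 * (sin \<theta> / cos \<theta> + cos (\<phi> + \<theta>) / sin (\<phi> + \<theta>)) = cos \<theta> * cos \<phi> / sin (\<phi> + \<theta>)" .
  have "r_c L \<kappa> m \<mu> c t (Suc k) = - A k * ((cos \<theta>)\<^sup>2 * (sin \<theta> / cos \<theta> + cos (\<phi> + \<theta>) / sin (\<phi> + \<theta>)))"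
    unfolding r_c_def 1 unfolding 2 by (simp add: tan_def \<phi>_def \<theta>_def)
  then show ?thesis unfolding 3 by (simp add: \<phi>_def \<theta>_def)
qed

lemma p_inf_eq: "p_inf L \<kappa> m \<mu> t (Suc k) = - (A k * cos (\<Omega> k * t + 0) / sin (\<Omega> k * t + 0))"
  by (simp add: p_inf_def tan_def)

lemma q_inf_eq: "q_inf L \<kappa> m \<mu> t (Suc k) = A k * cos 0 / sin (\<Omega> k * t + 0)"
  by (simp add: q_inf_def)

lemma r_inf_eq: "r_inf L \<kappa> m \<mu> t (Suc k) = - (A k * (cos 0 * cos (\<Omega> k * t)) / sin (\<Omega> k * t + 0))"
  by (simp add: r_inf_def tan_def)

text \<open>Stated for a free angle so that it serves both problems:
  \<open>\<theta> = theta \<kappa> m c\<close> for a finite penalty, \<open>\<theta> = 0\<close> for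
  the hard constraint. The numerators are bounded since \<open>A k\<close> is, and \<open>s\<close>
  bounds the denominators from below.\<close>

lemma spectral_lq:
  assumes p: "\<And>k. p (Suc k) = - (A k * cos (\<Omega> k * t + \<theta>) / sin (\<Omega> k * t + \<theta>))"
    and q: "\<And>k. q (Suc k) = A k * cos \<theta> / sin (\<Omega> k * t + \<theta>)"
    and r: "\<And>k. r (Suc k) = - (A k * (cos \<theta> * cos (\<Omega> k * t)) / sin (\<Omega> k * t + \<theta>))"
    and s: "0 < s" "\<And>k. s \<le> sin (\<Omega> k * t + \<theta>)"
  shows "spectral_op L p \<in> bounded_ops_half L" "spectral_op L q \<in> bounded_ops_half L"
    "spectral_op L r \<in> bounded_ops_half L"
    "x \<in> space_half L \<Longrightarrow> z \<in> space_half L \<Longrightarrow>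
      (\<lambda>k. lq_value (A k) \<theta> (\<Omega> k * t) (mode L x k) (mode L z k)) sums
        quad_form L (spectral_op L p) (spectral_op L q) (spectral_op L r) x z"
proof -
  define B where "B = sqrt (m * \<kappa>) * sqrt (L\<^sup>2 / pi\<^sup>2 + \<mu>\<^sup>2) / s"
  note b = abs_mult_divide_le[OF less_imp_le[OF A_pos] A_le _ s(1) s(2)]
  have bd: "\<bar>p (Suc k)\<bar> \<le> B" "\<bar>q (Suc k)\<bar> \<le> B" "\<bar>r (Suc k)\<bar> \<le> B" for k
    unfolding p q r abs_minus_cancel B_def by (intro b abs_cos_le_one abs_cos_mult_le)+
  show "spectral_op L p \<in> bounded_ops_half L" "spectral_op L q \<in> bounded_ops_half L"
    "spectral_op L r \<in> bounded_ops_half L"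
    using bd by (auto intro: spectral_op_bounded[OF L])
  assume "x \<in> space_half L" "z \<in> space_half L"
  from quad_form_sums[where p = p and q = q and r = r and B = B, OF L bd this]
  show "(\<lambda>k. lq_value (A k) \<theta> (\<Omega> k * t) (mode L x k) (mode L z k)) sums
        quad_form L (spectral_op L p) (spectral_op L q) (spectral_op L r) x z"
    unfolding lq_value_coefficients p q r .
qed

section \<open>Decomposition of the payoffs into modes\<close>

definition mode_payoff :: "nat \<Rightarrow> real \<Rightarrow> (real \<Rightarrow> real) \<Rightarrow> real" where
  "mode_payoff k x u = (\<integral>s. A k * \<Omega> k / 2 * (x + (\<integral>\<sigma>. u \<sigma> \<partial>leb s))\<^sup>2
      - A k / (2 * \<Omega> k) * (u s)\<^sup>2 \<partial>leb t)"

definition penalised_payoff :: "real \<Rightarrow> nat \<Rightarrow> real \<Rightarrow> real \<Rightarrow> (real \<Rightarrow> real) \<Rightarrow> real" where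
  "penalised_payoff c k x z u = mode_payoff k x u
     - c / 2 * (sqrt (\<beta> k) * (x + (\<integral>\<sigma>. u \<sigma> \<partial>leb t) - z)\<^sup>2)"

lemma mode_payoff_sums:
  assumes x: "x \<in> space_half L" and w: "w \<in> controls L t"
  shows "(\<lambda>k. mode_payoff k (mode L x k) (\<lambda>s. mode L (w s) k)) sums
    (\<integral>s. \<kappa> / 2 * (norm_half L (trajectory x w s))\<^sup>2 - m / 2 * sqnorm_J L \<mu> (w s) \<partial>leb t)"
proof -
  have "A k / (2 * \<Omega> k) = m / 2 * \<beta> k" for k
    using A_over_\<Omega>[of k] by simp
  then show ?thesis
    unfolding mode_payoff_def A_times_\<Omega> by (simp only:) (rule running_payoff_sums[OF L x w])
qed

lemma mode_payoff_lq_control: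
  assumes S: "sin (\<Omega> k * t + \<theta>) \<noteq> 0"
  shows "mode_payoff k x (lq_control (\<Omega> k) \<theta> t x z) =
    (\<integral>s. A k * \<Omega> k / 2 * (lq_traj (\<Omega> k) \<theta> t x z s)\<^sup>2 - A k / (2 * \<Omega> k) * (lq_control (\<Omega> k) \<theta> t x z s)\<^sup>2 \<partial>leb t)"
  unfolding mode_payoff_def
  by (rule Bochner_Integration.integral_cong[OF refl]) (simp add: integral_lq_control S)

lemma truncated_controls:
  assumes a: "\<And>k. continuous_on {0..t} (a k)" and b: "summable (\<lambda>k. (b k)\<^sup>2)"
  obtains w where "\<And>n. w n \<in> controls L t" "\<And>n s k. mode L (w n s) k = (if k < n then a k s else b k)"
proof -
  have "\<exists>w. w \<in> controls L t \<and> (\<forall>s k. mode L (w s) k = (if k < n then a k s else b k))" for n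
  proof -
    have "summable (\<lambda>k. (if k < n then 0 else b k)\<^sup>2)"
      by (rule summable_comparison_test'[OF b, of 0]) auto
    then obtain v where v: "v \<in> space_half L" "\<And>k. mode L v k = (if k < n then 0 else b k)"
      using mode_exists[OF L, of "\<lambda>k. if k < n then 0 else b k"] by blast
    show ?thesis
      using finite_mode_control[OF L a v(1), where n = n]
      by (intro exI[of _ "\<lambda>s. (\<Sum>k<n. a k s *\<^sub>R phi L (Suc k)) + v"]) (simp add: v(2))
  qed
  then show thesis using that by metis
qed

lemma mode_zero: "mode L 0 k = 0"
  using mode_diff[OF L space_half_closed(1)[OF L] space_half_closed(1)[OF L], of k] by simp

abbreviation (input) "J\<^sub>c c x z \<equiv> payoff L \<kappa> \<mu> m (\<lambda>y. psi_c L \<mu> c y z) t x"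

lemma payoff_c_sums:
  assumes x: "x \<in> space_half L" and z: "z \<in> space_half L" and w: "w \<in> controls L t"
  shows "\<exists>P. J\<^sub>c c x z w = ereal P \<and>
    (\<lambda>k. penalised_payoff c k (mode L x k) (mode L z k) (\<lambda>s. mode L (w s) k)) sums P"
proof -
  have tt: "t \<in> {0..t}" using t by simp
  have tH: "trajectory x w t - z \<in> space_half L"
    using trajectory_modes(1)[OF L x w tt] z by (rule space_half_closed(3)[OF L])
  have "mode L (trajectory x w t - z) k =
      mode L x k + (\<integral>\<sigma>. mode L (w \<sigma>) k \<partial>leb t) - mode L z k" for k
    using mode_diff[OF L trajectory_modes(1)[OF L x w tt] z, of k] trajectory_modes(2)[OF L x w tt, of k] by simp
  then have "(\<lambda>k. c / 2 * (sqrt (\<beta> k) * (mode L x k + (\<integral>\<sigma>. mode L (w \<sigma>) k \<partial>leb t) - mode L z k)\<^sup>2))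
      sums (c / 2 * (norm_half L (the (op_K L \<mu> (trajectory x w t - z))))\<^sup>2)"
    using sums_mult[OF op_K_sums[OF L tH, of \<mu>], of "c / 2"] by simp
  from sums_diff[OF mode_payoff_sums[OF x w] this] show ?thesis
    by (intro exI conjI) (auto simp: payoff_def psi_c_def penalised_payoff_def)
qed

section \<open>The problem with a finite terminal penalty\<close>

context
  fixes c :: real
  assumes c: "c_bar \<kappa> m < c"
begin

lemma c_pos: "0 < c"
  using c_bar_pos[OF m \<kappa>] c by simp

lemma theta_range: "0 < theta \<kappa> m c" "theta \<kappa> m c < pi / 2 - sqrt 2" "0 < sin (theta \<kappa> m c)"
proof -
  show 1: "0 < theta \<kappa> m c" by (rule theta_pos[OF m \<kappa> c_pos])
  show 2: "theta \<kappa> m c < pi / 2 - sqrt 2" by (rule theta_less[OF m \<kappa> c])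
  have "0 < sqrt (2 :: real)" by simp
  then show "0 < sin (theta \<kappa> m c)" using 1 2 by (intro sin_gt_zero) linarith+
qed

lemma sin_theta_le: "sin (theta \<kappa> m c) \<le> sin (\<Omega> k * t + theta \<kappa> m c)"
  using theta_range(1,2) \<Omega>_pos[of k] t(1) by (intro sin_mono_bound) auto

lemma sin_theta_nz: "sin (\<Omega> k * t + theta \<kappa> m c) \<noteq> 0"
  using sin_theta_le[of k] theta_range(3) by linarith

lemmas spectral_c = spectral_lq[OF p_c_eq q_c_eq r_c_eq[OF sin_theta_nz] theta_range(3) sin_theta_le]

lemma W_breve_c_sums:
  assumes "x \<in> space_half L" "z \<in> space_half L"
  shows "(\<lambda>k. lq_value (A k) (theta \<kappa> m c) (\<Omega> k * t) (mode L x k) (mode L z k)) sums W_breve_c L \<kappa> m \<mu> c t x z"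
  unfolding W_breve_c_def by (rule spectral_c(4)[OF assms])

lemma terminal_weight:
  "c / 2 * (sqrt (\<beta> k) * y) = A k / 2 * (cos (theta \<kappa> m c) / sin (theta \<kappa> m c)) * y"
proof -
  have "c / 2 * (sqrt (\<beta> k) * y) = (c * sqrt (\<beta> k)) / 2 * y" by simp
  then show ?thesis unfolding A_cot_theta[OF c_pos, symmetric] by simp
qed

lemma W_c_eq:
  assumes x: "x \<in> space_half L" and z: "z \<in> space_half L"
  shows "W_c L \<kappa> m \<mu> c t x z = ereal (W_breve_c L \<kappa> m \<mu> c t x z)"
proof (rule antisym)
  let ?\<theta> = "theta \<kappa> m c" and ?W = "W_breve_c L \<kappa> m \<mu> c t x z"
  let ?val = "\<lambda>k. lq_value (A k) ?\<theta> (\<Omega> k * t) (mode L x k) (mode L z k)"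
  show "W_c L \<kappa> m \<mu> c t x z \<le> ereal ?W"
    unfolding W_c_def value_fn_def
  proof (rule SUP_least)
    fix w assume w: "w \<in> controls L t"
    obtain P where P: "J\<^sub>c c x z w = ereal P"
      "(\<lambda>k. penalised_payoff c k (mode L x k) (mode L z k) (\<lambda>s. mode L (w s) k)) sums P"
      using payoff_c_sums[OF x z w] by blast
    have "P \<le> ?W"
    proof (rule sums_le[OF _ P(2) W_breve_c_sums[OF x z]])
      fix k
      have "\<Omega> k * t + ?\<theta> < pi" using \<Omega>_t_less[of k] theta_range(2) pi_gt_zero by linarith
      from lq_upper_bound[where x = "mode L x k" and z = "mode L z k",
          OF t(1) A_pos[of k] \<Omega>_pos[of k] theta_range(1) this control_modes[OF L w, of k]]
      show "penalised_payoff c k (mode L x k) (mode L z k) (\<lambda>s. mode L (w s) k) \<le> ?val k"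
        unfolding penalised_payoff_def terminal_weight mode_payoff_def .
    qed
    then show "J\<^sub>c c x z w \<le> ereal ?W" by (simp add: P(1))
  qed
  \<comment> \<open>Zero velocity is good enough in the tail: missing the target there costs only a
    finite penalty.\<close>
  obtain w where w: "\<And>n. w n \<in> controls L t"
    "\<And>n s k. mode L (w n s) k = (if k < n then lq_control (\<Omega> k) ?\<theta> t (mode L x k) (mode L z k) s else 0)"
    using truncated_controls[of "\<lambda>k. lq_control (\<Omega> k) ?\<theta> t (mode L x k) (mode L z k)" "\<lambda>_. 0"]
      continuous_lq(2) by auto
  have "\<exists>P. \<forall>n. J\<^sub>c c x z (w n) = ereal (P n) \<and>
    (\<lambda>k. penalised_payoff c k (mode L x k) (mode L z k) (\<lambda>s. mode L (w n s) k)) sums P n"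
    by (intro choice allI payoff_c_sums x z w)
  then obtain P where P: "\<And>n. J\<^sub>c c x z (w n) = ereal (P n)"
    "\<And>n. (\<lambda>k. penalised_payoff c k (mode L x k) (mode L z k) (\<lambda>s. mode L (w n s) k)) sums P n"
    by blast
  define T where "T k = penalised_payoff c k (mode L x k) (mode L z k) (\<lambda>_. 0)" for k
  have "P \<longlonglongrightarrow> ?W"
  proof (rule replaced_head_sums_tendsto[OF W_breve_c_sums[OF x z]])
    fix n
    have "penalised_payoff c k (mode L x k) (mode L z k) (\<lambda>s. mode L (w n s) k) =
      (if k < n then ?val k else T k)" for k
    proof (cases "k < n")
      case True
      have "sin ?\<theta> \<noteq> 0" using theta_range(3) by simp
      from lq_attained[OF t(1) \<Omega>_pos sin_theta_nz this, of "A k" k "mode L x k" "mode L z k"]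
      show ?thesis
        unfolding penalised_payoff_def w(2) terminal_weight using True
        by (simp add: mode_payoff_lq_control[OF sin_theta_nz] integral_lq_control[OF t(1) sin_theta_nz])
    next
      case False then show ?thesis by (simp add: w(2) T_def)
    qed
    with P(2)[of n] show "(\<lambda>k. if k < n then ?val k else T k) sums P n" by simp
  qed
  then have "(\<lambda>n. ereal (P n)) \<longlonglongrightarrow> ereal ?W" by simp
  moreover have "\<exists>N. \<forall>n\<ge>N. ereal (P n) \<le> W_c L \<kappa> m \<mu> c t x z"
    unfolding W_c_def value_fn_def P(1)[symmetric] by (blast intro: SUP_upper[OF w(1)])
  ultimately show "ereal ?W \<le> W_c L \<kappa> m \<mu> c t x z"
    by (rule LIMSEQ_le_const2)
qed

end

section \<open>The hard terminal constraint and the limit of infinite penalty\<close>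

context
  assumes t_pos: "0 < t"
begin

text \<open>The bound \<open>sin_theta_le\<close> tends to 0 as \<open>c\<close> grows. The slowest
  mode \<open>k = 0\<close> at a positive time gives a bound that is independent of both the mode
  and the angle.\<close>

lemma sin_0_bounds: "0 < sin (\<Omega> 0 * t)" "\<theta> \<in> {0..pi / 2 - sqrt 2} \<Longrightarrow> sin (\<Omega> 0 * t) \<le> sin (\<Omega> k * t + \<theta>)"
proof -
  show "0 < sin (\<Omega> 0 * t)"
    using \<Omega>_pos[of 0] t_pos \<Omega>_t_less[of 0] sqrt2_less_pi_half pi_gt_zero by (intro sin_gt_zero mult_pos_pos) linarith+
  have "\<Omega> 0 * t \<le> \<Omega> k * t" using \<Omega>_mono t(1) by (rule mult_right_mono)
  then show "\<theta> \<in> {0..pi / 2 - sqrt 2} \<Longrightarrow> sin (\<Omega> 0 * t) \<le> sin (\<Omega> k * t + \<theta>)"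
    using \<Omega>_pos[of 0] t(1) by (intro sin_mono_bound) auto
qed

lemma sin_0_le: "sin (\<Omega> 0 * t) \<le> sin (\<Omega> k * t + 0)"
  using sin_0_bounds(2)[of 0 k] sqrt2_less_pi_half by simp

lemma sin_nz: "sin (\<Omega> k * t) \<noteq> 0"
  using sin_0_le[of k] sin_0_bounds(1) by simp

lemmas spectral_inf = spectral_lq[OF p_inf_eq q_inf_eq r_inf_eq sin_0_bounds(1) sin_0_le]

lemma W_breve_inf_sums:
  assumes "x \<in> space_half L" "z \<in> space_half L"
  shows "(\<lambda>k. lq_value (A k) 0 (\<Omega> k * t) (mode L x k) (mode L z k)) sums W_breve_inf L \<kappa> m \<mu> t x z"
  unfolding W_breve_inf_def by (rule spectral_inf(4)[OF assms])

lemma W_breve_c_tendsto: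
  assumes x: "x \<in> space_half L" and z: "z \<in> space_half L"
  shows "((\<lambda>c. W_breve_c L \<kappa> m \<mu> c t x z) \<longlongrightarrow> W_breve_inf L \<kappa> m \<mu> t x z) at_top"
proof -
  define a where "a k c = lq_value (A k) (theta \<kappa> m c) (\<Omega> k * t) (mode L x k) (mode L z k)" for k c
  define b where "b k = lq_value (A k) 0 (\<Omega> k * t) (mode L x k) (mode L z k)" for k
  define M where "M k = sqrt (m * \<kappa>) * sqrt (L\<^sup>2 / pi\<^sup>2 + \<mu>\<^sup>2) / sin (\<Omega> 0 * t) * ((mode L x k)\<^sup>2 + (mode L z k)\<^sup>2)" for k
  have lim: "(a k \<longlongrightarrow> b k) at_top" for k
    unfolding a_def[abs_def] b_def lq_value_def using sin_nz[of k]
    by (intro tendsto_intros tendsto_eq_intros theta_tendsto) (auto intro!: tendsto_eq_intros theta_tendsto)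
  have bd: "norm (a k c) \<le> M k" if "c_bar \<kappa> m < c" for k c
  proof -
    have "theta \<kappa> m c \<in> {0..pi / 2 - sqrt 2}" using theta_range[OF that] by simp
    from abs_lq_value_le[OF less_imp_le[OF A_pos] A_le sin_0_bounds(1) sin_0_bounds(2)[OF this]]
    show ?thesis by (simp add: a_def M_def)
  qed
  have "eventually (\<lambda>c. \<forall>k. norm (a k c) \<le> M k) at_top"
    using eventually_gt_at_top[of "c_bar \<kappa> m"] by eventually_elim (use bd in blast)
  \<comment> \<open>\<open>tannerys_theorem\<close> asks for a bound that is eventual in the pair of
    mode and penalty; here it holds for all modes as soon as \<open>c\<close> exceeds
    \<open>c_bar\<close>.\<close>
  then have "eventually (\<lambda>(i :: nat, c). \<forall>k. norm (a k c) \<le> M k) (at_top \<times>\<^sub>F at_top)"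
    by (subst eventually_prod2) auto
  then have bound: "eventually (\<lambda>(k, c). norm (a k c) \<le> M k) (at_top \<times>\<^sub>F at_top)"
    by (rule eventually_mono) auto
  have "summable M"
    unfolding M_def by (intro summable_mult summable_add mode_summable[OF L] x z)
  from tannerys_theorem[OF lim bound this] have "((\<lambda>c. suminf (\<lambda>k. a k c)) \<longlongrightarrow> suminf b) at_top" by simp
  moreover have "suminf b = W_breve_inf L \<kappa> m \<mu> t x z"
    unfolding b_def using sums_unique[OF W_breve_inf_sums[OF x z]] by simp
  moreover have "eventually (\<lambda>c. suminf (\<lambda>k. a k c) = W_breve_c L \<kappa> m \<mu> c t x z) at_top"
    using eventually_gt_at_top[of "c_bar \<kappa> m"]
    by eventually_elim (use sums_unique[OF W_breve_c_sums[OF _ x z]] in \<open>simp add: a_def\<close>)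
  ultimately show ?thesis using tendsto_cong by force
qed

text \<open>Where the hard constraint pays 0 the soft penalty is 0 as well; elsewhere the former is
  minus infinity.\<close>

lemma W_inf_le_W_c: "W_inf L \<kappa> m \<mu> t x z \<le> W_c L \<kappa> m \<mu> c t x z"
  unfolding W_inf_def W_c_def value_fn_def payoff_def
  by (intro SUP_mono' add_left_mono) (auto simp: psi_inf_def psi_c_def)

lemma W_inf_eq:
  assumes x: "x \<in> space_half L" and z: "z \<in> space_half L"
  shows "W_inf L \<kappa> m \<mu> t x z = ereal (W_breve_inf L \<kappa> m \<mu> t x z)"
proof (rule antisym)
  let ?W = "W_breve_inf L \<kappa> m \<mu> t x z"
  let ?val = "\<lambda>k. lq_value (A k) 0 (\<Omega> k * t) (mode L x k) (mode L z k)"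
  have "((\<lambda>c. ereal (W_breve_c L \<kappa> m \<mu> c t x z)) \<longlongrightarrow> ereal ?W) at_top"
    using W_breve_c_tendsto[OF x z] by simp
  moreover have "eventually (\<lambda>c. W_inf L \<kappa> m \<mu> t x z \<le> ereal (W_breve_c L \<kappa> m \<mu> c t x z)) at_top"
    using eventually_gt_at_top[of "c_bar \<kappa> m"]
    by eventually_elim (metis W_inf_le_W_c W_c_eq[OF _ x z])
  ultimately show "W_inf L \<kappa> m \<mu> t x z \<le> ereal ?W"
    by (rule tendsto_lowerbound) simp
  \<comment> \<open>Resting in the tail could miss \<open>z\<close> and cost minus infinity, so the
    tail moves at the constant velocity that reaches \<open>z\<close> exactly at time
    \<open>t\<close>.\<close>
  define b where "b k = (mode L z k - mode L x k) / t" for k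
  have "summable (\<lambda>k. (1 / t)\<^sup>2 * (mode L (z - x) k)\<^sup>2)"
    by (intro summable_mult mode_summable[OF L] space_half_closed(3)[OF L] x z)
  then have b: "summable (\<lambda>k. (b k)\<^sup>2)"
    by (simp add: b_def mode_diff[OF L z x] power_divide)
  obtain w where w: "\<And>n. w n \<in> controls L t"
    "\<And>n s k. mode L (w n s) k = (if k < n then lq_control (\<Omega> k) 0 t (mode L x k) (mode L z k) s else b k)"
    using truncated_controls[OF _ b, of "\<lambda>k. lq_control (\<Omega> k) 0 t (mode L x k) (mode L z k)"]
      continuous_lq(2) by blast
  define P where "P n = (\<integral>s. \<kappa> / 2 * (norm_half L (trajectory x (w n) s))\<^sup>2 - m / 2 * sqnorm_J L \<mu> (w n s) \<partial>leb t)" for n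
  have tt: "t \<in> {0..t}" using t by simp
  have end_z: "trajectory x (w n) t = z" for n
  proof (rule mode_eqI[OF L trajectory_modes(1)[OF L x w(1) tt] z])
    fix k
    have "mode L x k + (\<integral>\<sigma>. mode L (w n \<sigma>) k \<partial>leb t) = mode L z k"
    proof (cases "k < n")
      case True
      then show ?thesis
        using integral_lq_control[OF t(1), of "\<Omega> k" t 0 "mode L x k" "mode L z k"] sin_nz[of k]
          lq_attained_0(2)[OF t(1) \<Omega>_pos sin_nz, of k "mode L x k" "mode L z k"]
        by (simp add: w(2))
    next
      case False
      have "(\<integral>\<sigma>. b k \<partial>leb t) = integral {0..t} (\<lambda>_. b k)"
        by (intro lebesgue_integral_eq_integral continuous_imp_integrable_real continuous_intros) auto
      then show ?thesis using False t_pos by (simp add: w(2) b_def)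
    qed
    then show "mode L (trajectory x (w n) t) k = mode L z k"
      unfolding trajectory_modes(2)[OF L x w(1) tt] .
  qed
  \<comment> \<open>The terminal payoff is 0 only once \<open>op_K\<close> of the zero vector is
    known to have norm 0; its mode series shows this.\<close>
  have "(\<lambda>k. 0) sums (norm_half L (the (op_K L \<mu> (z - z))))\<^sup>2"
    using op_K_sums[OF L space_half_closed(1)[OF L], of \<mu>] by (simp add: mode_zero)
  from sums_unique2[OF this sums_zero] have payoff: "payoff L \<kappa> \<mu> m (\<lambda>y. psi_inf L \<mu> y z) t x (w n) = ereal (P n)" for n
    unfolding payoff_def end_z P_def by (simp add: psi_inf_def)
  define T where "T k = mode_payoff k (mode L x k) (\<lambda>_. b k)" for k
  have "P \<longlonglongrightarrow> ?W"
  proof (rule replaced_head_sums_tendsto[OF W_breve_inf_sums[OF x z]])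
    fix n
    have "mode_payoff k (mode L x k) (\<lambda>s. mode L (w n s) k) = (if k < n then ?val k else T k)" for k
      using mode_payoff_lq_control[of k 0 "mode L x k" "mode L z k"] sin_nz[of k]
        lq_attained_0(1)[OF t(1) \<Omega>_pos sin_nz, of "A k" k "mode L x k" "mode L z k"]
      by (simp add: w(2) T_def)
    with mode_payoff_sums[OF x w(1)[of n]] show "(\<lambda>k. if k < n then ?val k else T k) sums P n"
      by (simp add: P_def)
  qed
  then have "(\<lambda>n. ereal (P n)) \<longlonglongrightarrow> ereal ?W" by simp
  moreover have "\<exists>N. \<forall>n\<ge>N. ereal (P n) \<le> W_inf L \<kappa> m \<mu> t x z"
    unfolding W_inf_def value_fn_def payoff[symmetric] by (blast intro: SUP_upper[OF w(1)])
  ultimately show "ereal ?W \<le> W_inf L \<kappa> m \<mu> t x z"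
    by (rule LIMSEQ_le_const2)
qed

end

end

theorem theorem3p11:
  fixes L \<kappa> m m_low \<mu> :: real
  assumes "0 < L" and "0 < \<kappa>" and "0 < m"
    and "0 < m_low" and "m_low < m"
    and standing: "\<forall>\<nu>\<in>{0<..1}. \<forall>t\<in>{0<..<t_bar \<kappa> m \<nu>}. \<forall>x\<in>space_half L.
           W_bar L \<kappa> m_low \<nu> t x < \<infinity>"
    and "\<mu> \<in> {0<..1}"
  shows
    "(\<forall>c>c_bar \<kappa> m. \<forall>t\<in>{0..<t_bar \<kappa> m \<mu>}.
        spectral_op L (p_c L \<kappa> m \<mu> c t) \<in> bounded_ops_half L \<and>
        spectral_op L (q_c L \<kappa> m \<mu> c t) \<in> bounded_ops_half L \<and>
        spectral_op L (r_c L \<kappa> m \<mu> c t) \<in> bounded_ops_half L \<and>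
        (\<forall>x\<in>space_half L. \<forall>z\<in>space_half L.
           W_c L \<kappa> m \<mu> c t x z = ereal (W_breve_c L \<kappa> m \<mu> c t x z)))
     \<and>
     (\<forall>\<delta>\<in>{0<..<t_bar \<kappa> m \<mu>}. \<forall>t\<in>{\<delta><..<t_bar \<kappa> m \<mu>}.
        spectral_op L (p_inf L \<kappa> m \<mu> t) \<in> bounded_ops_half L \<and>
        spectral_op L (q_inf L \<kappa> m \<mu> t) \<in> bounded_ops_half L \<and>
        spectral_op L (r_inf L \<kappa> m \<mu> t) \<in> bounded_ops_half L \<and>
        (\<forall>x\<in>space_half L. \<forall>z\<in>space_half L.
           W_inf L \<kappa> m \<mu> t x z = ereal (W_breve_inf L \<kappa> m \<mu> t x z) \<and>
           ((\<lambda>c. W_breve_c L \<kappa> m \<mu> c t x z) \<longlongrightarrow> W_breve_inf L \<kappa> m \<mu> t x z) at_top))"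
proof (intro conjI allI impI ballI)
  have \<mu>: "0 < \<mu>" using assms(7) by simp
  fix c t assume c: "c_bar \<kappa> m < c" and t: "t \<in> {0..<t_bar \<kappa> m \<mu>}"
  then have t': "0 \<le> t" "t < t_bar \<kappa> m \<mu>" by auto
  note base = assms(1-3) \<mu> t'
  show "spectral_op L (p_c L \<kappa> m \<mu> c t) \<in> bounded_ops_half L"
    "spectral_op L (q_c L \<kappa> m \<mu> c t) \<in> bounded_ops_half L"
    "spectral_op L (r_c L \<kappa> m \<mu> c t) \<in> bounded_ops_half L"
    by (rule spectral_c[OF base c])+
  fix x z assume "x \<in> space_half L" "z \<in> space_half L"
  then show "W_c L \<kappa> m \<mu> c t x z = ereal (W_breve_c L \<kappa> m \<mu> c t x z)"
    by (rule W_c_eq[OF base c])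
next
  have \<mu>: "0 < \<mu>" using assms(7) by simp
  fix \<delta> t assume "\<delta> \<in> {0<..<t_bar \<kappa> m \<mu>}" "t \<in> {\<delta><..<t_bar \<kappa> m \<mu>}"
  \<comment> \<open>The lower bound \<open>\<delta>\<close> supplies \<open>0 < t\<close>, which
    keeps the denominators \<open>sin (\<Omega> k * t)\<close> away from zero.\<close>
  then have t': "0 \<le> t" "t < t_bar \<kappa> m \<mu>" "0 < t" by auto
  note base = assms(1-3) \<mu> t'
  show "spectral_op L (p_inf L \<kappa> m \<mu> t) \<in> bounded_ops_half L"
    "spectral_op L (q_inf L \<kappa> m \<mu> t) \<in> bounded_ops_half L"
    "spectral_op L (r_inf L \<kappa> m \<mu> t) \<in> bounded_ops_half L"
    by (rule spectral_inf[OF base])+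
  fix x z assume xz: "x \<in> space_half L" "z \<in> space_half L"
  show "W_inf L \<kappa> m \<mu> t x z = ereal (W_breve_inf L \<kappa> m \<mu> t x z)"
    by (rule W_inf_eq[OF base xz])
  show "((\<lambda>c. W_breve_c L \<kappa> m \<mu> c t x z) \<longlongrightarrow> W_breve_inf L \<kappa> m \<mu> t x z) at_top"
    by (rule W_breve_c_tendsto[OF base xz])
qed

end
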